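(* Let $\Omega\subseteq\mathbb{R}^n$ be a connected open set and $\bar L(\cdot):=b(x)\partial_\mu(a^{\mu\nu}(x)\partial_\nu(\cdot))$ with $b\in C^\infty(\Omega,\mathbb{R})$, $b>0$, and $a\in C^\infty(\Omega,M_{n\times n}(\mathbb{C}))$ pointwise symmetric with $\mathrm{Re}(a^{\mu\nu}(x)\xi^*_\mu\xi_\nu)\ge\ell(x)\delta^{\mu\nu}\xi^*_\mu\xi_\nu$ for all $\xi\in\mathbb{C}^n$ and some continuous $\ell:\Omega\to\mathbb{R}_{>0}$. Let $(f_j)_{j\in\mathbb{N}_0}$ be a sequence in $L^2_{\mathrm{loc}}(\Omega)$ and $k\in\mathbb{N}$ such that $f_j,\bar Lf_j,\dots,\bar L^kf_j\in L^2_{\mathrm{loc}}(\Omega)$ for all $j$. Suppose $F:B_S(0)\to L^2_{\mathrm{loc}}(\Omega)$, $B_S(0)=\{\zeta\in\mathbb{C}:|\zeta|<S\}$, is analytic and for each $\zeta\in B_S(0)$: (i) $F(\zeta)=\sum_{j=0}^\infty\frac{\zeta^j}{j!}f_j$ with convergence in $L^2_{\mathrm{loc}}(\Omega)$; (ii) $F(\zeta),\bar LF(\zeta),\dots,\bar L^kF(\zeta)\in L^2_{\mathrm{loc}}(\Omega)$; (iii) for each $l\in\{1,\dots,k\}$, $\bar L^lF(\zeta)=\sum_{j=0}^\infty\frac{\zeta^j}{j!}\bar L^lf_j$ with convergence in $L^2_{\mathrm{loc}}(\Omega)$. If there is $m\in\mathbb{N}_0$ with $k>m/2+n/4$, then for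 each $\zeta\in B_S(0)$ there is a $C^m(\Omega)$ representative $F(\zeta,\cdot)$ of $F(\zeta)$, and the map $B_S(0)\times\Omega\ni(\zeta,x)\mapsto F(\zeta,x)\in\mathbb{C}$ is jointly $C^m$.
   Context: $L^2_{\mathrm{loc}}(\Omega)$ is defined with respect to Lebesgue measure, with convergence meaning $L^2$-convergence on every relatively compact open subset of $\Omega$; $\bar L^j$ acts distributionally. *)

theory Defs
  imports "HOL-Analysis.Analysis"
begin

fun Ck :: "nat \<Rightarrow> 'a::euclidean_space set \<Rightarrow> ('a \<Rightarrow> 'b::real_normed_vector) \<Rightarrow> bool" where
  "Ck 0 U f = continuous_on U f"
| "Ck (Suc m) U f = ((\<forall>x\<in>U. f differentiable (at x)) \<and>
      (\<forall>v\<in>Basis. Ck m U (\<lambda>x. frechet_derivative f (at x) v)))"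

definition smooth_on :: "'a::euclidean_space set \<Rightarrow> ('a \<Rightarrow> 'b::real_normed_vector) \<Rightarrow> bool" where
  "smooth_on U f \<longleftrightarrow> (\<forall>m. Ck m U f)"

definition partial :: "'n::finite \<Rightarrow> (real^'n \<Rightarrow> 'b::real_normed_vector) \<Rightarrow> real^'n \<Rightarrow> 'b" where
  "partial i f x = frechet_derivative f (at x) (axis i 1)"

definition test_fun :: "(real^'n::finite) set \<Rightarrow> (real^'n \<Rightarrow> complex) \<Rightarrow> bool" where
  "test_fun \<Omega> \<phi> \<longleftrightarrow> smooth_on UNIV \<phi> \<and> compact (closure {x. \<phi> x \<noteq> 0})
      \<and> closure {x. \<phi> x \<noteq> 0} \<subseteq> \<Omega>"

definition relcompact_open :: "'a::euclidean_space set \<Rightarrow> 'a set \<Rightarrow> bool" where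
  "relcompact_open U \<Omega> \<longleftrightarrow> open U \<and> compact (closure U) \<and> closure U \<subseteq> \<Omega>"

definition L2loc :: "(real^'n::finite) set \<Rightarrow> (real^'n \<Rightarrow> complex) \<Rightarrow> bool" where
  "L2loc \<Omega> f \<longleftrightarrow> set_borel_measurable lebesgue \<Omega> f \<and>
     (\<forall>U. relcompact_open U \<Omega> \<longrightarrow> set_integrable lebesgue U (\<lambda>x. (norm (f x))\<^sup>2))"

definition L2dist :: "(real^'n::finite) set \<Rightarrow> (real^'n \<Rightarrow> complex) \<Rightarrow> (real^'n \<Rightarrow> complex) \<Rightarrow> real" where
  "L2dist U f g = (LINT x:U|lebesgue. (norm (f x - g x))\<^sup>2)"

definition L2loc_lim :: "(real^'n::finite) set \<Rightarrow> (nat \<Rightarrow> real^'n \<Rightarrow> complex) \<Rightarrow> (real^'n \<Rightarrow> complex) \<Rightarrow> bool" where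
  "L2loc_lim \<Omega> g f \<longleftrightarrow> (\<forall>U. relcompact_open U \<Omega> \<longrightarrow> (\<lambda>N. L2dist U (g N) f) \<longlonglongrightarrow> 0)"

definition analytic_L2loc :: "(real^'n::finite) set \<Rightarrow> complex set \<Rightarrow> (complex \<Rightarrow> real^'n \<Rightarrow> complex) \<Rightarrow> bool" where
  "analytic_L2loc \<Omega> D F \<longleftrightarrow> (\<forall>z0\<in>D. \<exists>G. L2loc \<Omega> G \<and>
     (\<forall>U. relcompact_open U \<Omega> \<longrightarrow>
        ((\<lambda>z. L2dist U (\<lambda>x. (F z x - F z0 x) / (z - z0)) G) \<longlongrightarrow> 0) (at z0)))"

text \<open>Formal transpose of Lbar u = b \<partial>_\<mu>(a^{\<mu>\<nu>} \<partial>_\<nu> u) acting on test functions: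
  Lbar^t \<phi> = \<partial>_\<nu>(a^{\<mu>\<nu>} \<partial>_\<mu>(b \<phi>)).\<close>
definition Lbar_transpose :: "('n::finite \<Rightarrow> 'n \<Rightarrow> real^'n \<Rightarrow> complex) \<Rightarrow> (real^'n \<Rightarrow> real)
     \<Rightarrow> (real^'n \<Rightarrow> complex) \<Rightarrow> real^'n \<Rightarrow> complex" where
  "Lbar_transpose a b \<phi> x = (\<Sum>\<nu>\<in>UNIV. \<Sum>\<mu>\<in>UNIV.
      partial \<nu> (\<lambda>y. a \<mu> \<nu> y * partial \<mu> (\<lambda>z. complex_of_real (b z) * \<phi> z) y) x)"

definition Lbar_weak :: "(real^'n::finite) set \<Rightarrow> ('n \<Rightarrow> 'n \<Rightarrow> real^'n \<Rightarrow> complex) \<Rightarrow> (real^'n \<Rightarrow> real)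
     \<Rightarrow> (real^'n \<Rightarrow> complex) \<Rightarrow> (real^'n \<Rightarrow> complex) \<Rightarrow> bool" where
  "Lbar_weak \<Omega> a b u g \<longleftrightarrow> (\<forall>\<phi>. test_fun \<Omega> \<phi> \<longrightarrow>
      (LINT x:\<Omega>|lebesgue. g x * \<phi> x) = (LINT x:\<Omega>|lebesgue. u x * Lbar_transpose a b \<phi> x))"

end

theory Submission
  imports Defs
begin

text \<open>Elliptic regularity is used in a form that never mentions weak derivatives. A compactly supported
  cutoff of \<open>f\<^sub>j\<close> is mollified, and the elliptic estimate for test functions is applied to the
  mollification; the Friedrichs commutators of mollification with the coefficients are bounded in the
  mean uniformly in the mollification parameter. Bootstrapping through \<open>f\<^sub>j, Lbar f\<^sub>j, \<dots>, Lbar\<^sup>k f\<^sub>j\<close> bounds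
  all derivatives of order at most \<open>2k\<close> of the mollifications in the mean, uniformly over the family
  \<open>\<rho>\<^sup>j / j! \<cdot> f\<^sub>j\<close> for any \<open>\<rho> < S\<close>, since the terms of a convergent series are bounded. As \<open>2k > m + n/2\<close>,
  the Sobolev embedding turns these into pointwise bounds, and every \<open>f\<^sub>j\<close> has a \<open>C\<^sup>m\<close> representative
  whose derivatives up to order \<open>m\<close> are locally bounded by a multiple of \<open>j! / \<rho>\<^sup>j\<close>. The power
  series therefore converges locally uniformly with all its derivatives up to order \<open>m\<close>, and Fatou's
  lemma identifies the pointwise limit with \<open>F(\<zeta>)\<close> almost everywhere.\<close>

text \<open>The difficulty is uniformity: every constant has to be independent both of the
  mollification width and of \<open>j\<close>. Mollifying the equation leaves commutators with the
  coefficients; they are kept under a divergence, so that they cost only the order \<open>s\<close>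
  already known and the elliptic estimate still returns order \<open>s + 1\<close>. Each application
  of Lbar is worth two such steps, which is where \<open>2k\<close> comes from. The embedding avoids
  the Fourier transform: \<open>v x\<close> is joined to its average at scale \<open>t\<close>, and
  the derivative in \<open>t\<close> of an average of \<open>v\<close> is again an average, of first
  derivatives of \<open>v\<close>. An average is at most t^(-n/2) times the mean-square norm, each
  derivative lowers this exponent by one, and beyond order n/2 the bound is integrable at
  \<open>t = 0\<close>. The same argument leaves an arbitrarily small factor in front of the Sobolev
  norm, which upgrades convergence in the mean of bounded sequences to uniform convergence. The
  representative of \<open>f\<^sub>j\<close> is the pointwise limit of its mollifications, so that
  the functions found on different balls and for different \<open>\<rho>\<close> agree
  automatically.\<close>

section \<open>Calculus of \<open>Ck\<close> functions\<close>

text \<open>Congruence at level \<open>m\<close> is a hypothesis because \<open>Ck_cong_imp\<close>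
  is itself proved through this rule, feeding in its induction hypothesis; \<open>Ck_SucI'\<close>
  then discharges it.\<close>

lemma Ck_SucI:
  fixes f :: "'a::euclidean_space \<Rightarrow> 'b::real_normed_vector"
  assumes "\<And>x. x \<in> U \<Longrightarrow> (f has_derivative f' x) (at x)"
    and "\<And>v. v \<in> Basis \<Longrightarrow> Ck m U (\<lambda>x. f' x v)"
    and cong: "\<And>g h. (\<And>x. x \<in> U \<Longrightarrow> g x = h x) \<Longrightarrow> Ck m U (g::'a \<Rightarrow> 'b) \<Longrightarrow> Ck m U h"
  shows "Ck (Suc m) U f"
proof -
  have "f' x = frechet_derivative f (at x)" if "x \<in> U" for x
    using assms(1)[OF that] by (rule frechet_derivative_at)
  moreover have "f differentiable (at x)" if "x \<in> U" for x
    using assms(1)[OF that] by (auto simp: differentiable_def)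
  moreover from calculation have "Ck m U (\<lambda>x. frechet_derivative f (at x) v)" if "v \<in> Basis" for v
    using that by (intro cong[OF _ assms(2)[OF that]]) simp
  ultimately show ?thesis by simp
qed

lemma Ck_cong_imp:
  fixes f g :: "'a::euclidean_space \<Rightarrow> 'b::real_normed_vector"
  assumes "open U"
  shows "(\<And>x. x \<in> U \<Longrightarrow> f x = g x) \<Longrightarrow> Ck m U f \<Longrightarrow> Ck m U g"
proof (induction m arbitrary: f g)
  case 0
  then show ?case by (metis Ck.simps(1) continuous_on_cong)
next
  case (Suc m)
  show ?case
  proof (rule Ck_SucI[where f'="\<lambda>x. frechet_derivative f (at x)"])
    fix x assume x: "x \<in> U"
    then have "(f has_derivative frechet_derivative f (at x)) (at x)"
      using Suc.prems(2) by (simp add: frechet_derivative_works)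
    then show "(g has_derivative frechet_derivative f (at x)) (at x)"
      using has_derivative_transform_within_open[OF _ assms x] Suc.prems(1) by blast
  qed (use Suc in auto)
qed

lemma Ck_SucI':
  fixes f :: "'a::euclidean_space \<Rightarrow> 'b::real_normed_vector"
  assumes "open U" "\<And>x. x \<in> U \<Longrightarrow> (f has_derivative f' x) (at x)"
    and "\<And>v. v \<in> Basis \<Longrightarrow> Ck m U (\<lambda>x. f' x v)"
  shows "Ck (Suc m) U f"
  using Ck_SucI[OF assms(2,3) Ck_cong_imp[OF assms(1)]] .

lemma Ck_SucD:
  assumes "Ck (Suc m) U f" "x \<in> U"
  shows "(f has_derivative frechet_derivative f (at x)) (at x)"
  using assms by (simp add: frechet_derivative_works)

lemma Ck_SucD_frechet:
  "Ck (Suc m) U f \<Longrightarrow> v \<in> Basis \<Longrightarrow> Ck m U (\<lambda>x. frechet_derivative f (at x) v)"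
  by simp

lemma Ck_lower: "Ck (Suc m) U f \<Longrightarrow> Ck m U f"
proof (induction m arbitrary: f)
  case 0
  then show ?case
    by (auto intro!: continuous_at_imp_continuous_on differentiable_imp_continuous_within)
next
  case (Suc m)
  have "f differentiable at x" if "x \<in> U" for x
    using Suc.prems that by (auto simp only: Ck.simps)
  moreover have "Ck m U (\<lambda>x. frechet_derivative f (at x) v)" if "v \<in> Basis" for v
    using Suc.prems Suc.IH that by (auto simp only: Ck.simps)
  ultimately show ?case by simp
qed

lemma Ck_le: "m \<le> n \<Longrightarrow> Ck n U f \<Longrightarrow> Ck m U f"
  by (induction n rule: dec_induct) (blast intro: Ck_lower)+

lemma Ck_continuous_on: "Ck m U f \<Longrightarrow> continuous_on U f"
  using Ck_le[of 0 m] by auto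

lemma Ck_subset: "V \<subseteq> U \<Longrightarrow> Ck m U f \<Longrightarrow> Ck m V f"
  by (induction m arbitrary: f) (auto intro: continuous_on_subset)

lemma Ck_local:
  assumes "\<And>x. x \<in> U \<Longrightarrow> \<exists>V. open V \<and> x \<in> V \<and> Ck m V f"
  shows "Ck m U f"
  using assms
proof (induction m arbitrary: f)
  case 0
  then have "continuous (at x) f" if "x \<in> U" for x
    using that by (metis Ck.simps(1) continuous_on_eq_continuous_at)
  then show ?case by (simp add: continuous_at_imp_continuous_on)
next
  case (Suc m)
  have "f differentiable at x" if "x \<in> U" for x
    using Suc.prems[OF that] by auto
  moreover have "Ck m U (\<lambda>x. frechet_derivative f (at x) v)" if "v \<in> Basis" for v
    using Suc.prems that by (intro Suc.IH) force
  ultimately show ?case by simp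
qed

lemma Ck_const [simp]: "Ck m U (\<lambda>x. c)"
proof (induction m arbitrary: c)
  case (Suc m)
  have "frechet_derivative (\<lambda>x. c) (at x) = (\<lambda>h. 0)" for x :: 'a
    by simp
  then show ?case using Suc by simp
qed simp

lemma Ck_bounded_linear:
  fixes f :: "'a::euclidean_space \<Rightarrow> 'b::real_normed_vector"
  assumes "bounded_linear T" "open U"
  shows "Ck m U f \<Longrightarrow> Ck m U (\<lambda>x. T (f x))"
proof (induction m arbitrary: f)
  case 0
  then show ?case using bounded_linear.continuous_on[OF assms(1)] by auto
next
  case (Suc m)
  note D = Ck_SucD[OF Suc.prems] and F = Ck_SucD_frechet[OF Suc.prems]
  show ?case
    by (rule Ck_SucI'[OF assms(2) bounded_linear.has_derivative[OF assms(1) D]], assumption)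
       (rule Suc.IH[OF F])
qed

lemma Ck_linear:
  assumes "bounded_linear T" "open U"
  shows "Ck m U T"
proof (cases m)
  case 0
  then show ?thesis using assms(1) by (simp add: linear_continuous_on)
next
  case (Suc k)
  then show ?thesis using assms
    by (simp only: Suc) (rule Ck_SucI'[where f'="\<lambda>x. T"], auto intro: bounded_linear_imp_has_derivative)
qed

lemma Ck_add:
  fixes f g :: "'a::euclidean_space \<Rightarrow> 'b::real_normed_vector"
  assumes "open U"
  shows "Ck m U f \<Longrightarrow> Ck m U g \<Longrightarrow> Ck m U (\<lambda>x. f x + g x)"
proof (induction m arbitrary: f g)
  case 0
  then show ?case by (auto intro: continuous_on_add)
next
  case (Suc m)
  note D = Ck_SucD[OF Suc.prems(1)] Ck_SucD[OF Suc.prems(2)]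
    and F = Ck_SucD_frechet[OF Suc.prems(1)] Ck_SucD_frechet[OF Suc.prems(2)]
  show ?case
    by (rule Ck_SucI'[OF assms has_derivative_add[OF D]], assumption, assumption)
       (rule Suc.IH[OF F])
qed

lemma Ck_mult:
  fixes f g :: "'a::euclidean_space \<Rightarrow> 'b::real_normed_algebra"
  assumes "open U"
  shows "Ck m U f \<Longrightarrow> Ck m U g \<Longrightarrow> Ck m U (\<lambda>x. f x * g x)"
proof (induction m arbitrary: f g)
  case 0
  then show ?case by (auto intro: continuous_on_mult)
next
  case (Suc m)
  note D = Ck_SucD[OF Suc.prems(1)] Ck_SucD[OF Suc.prems(2)]
    and F = Ck_SucD_frechet[OF Suc.prems(1)] Ck_SucD_frechet[OF Suc.prems(2)]
    and L = Ck_lower[OF Suc.prems(1)] Ck_lower[OF Suc.prems(2)]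
  show ?case
    by (rule Ck_SucI'[OF assms has_derivative_mult[OF D]], assumption, assumption)
       (rule Ck_add[OF assms Suc.IH[OF L(1) F(2)] Suc.IH[OF F(1) L(2)]])
qed

lemma Ck_uminus:
  fixes f :: "'a::euclidean_space \<Rightarrow> 'b::real_normed_vector"
  assumes "open U" "Ck m U f"
  shows "Ck m U (\<lambda>x. - f x)"
  using Ck_bounded_linear[OF bounded_linear_minus[OF bounded_linear_ident] assms] .

lemma Ck_diff:
  fixes f g :: "'a::euclidean_space \<Rightarrow> 'b::real_normed_vector"
  assumes "open U" "Ck m U f" "Ck m U g"
  shows "Ck m U (\<lambda>x. f x - g x)"
  using Ck_add[OF assms(1,2) Ck_uminus[OF assms(1,3)]] by simp

lemma Ck_sum:
  fixes f :: "'i \<Rightarrow> 'a::euclidean_space \<Rightarrow> 'b::real_normed_vector"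
  assumes "open U" "\<And>i. i \<in> I \<Longrightarrow> Ck m U (f i)"
  shows "Ck m U (\<lambda>x. \<Sum>i\<in>I. f i x)"
  using assms(2) by (induction I rule: infinite_finite_induct) (auto intro: Ck_add assms)

text \<open>The derivative -(1/f) f' (1/f) contains 1/f only one level lower, so the induction
  closes with products.\<close>

lemma Ck_inverse:
  fixes f :: "'a::euclidean_space \<Rightarrow> 'b::real_normed_div_algebra"
  assumes "open U" "\<And>x. x \<in> U \<Longrightarrow> f x \<noteq> 0"
  shows "Ck m U f \<Longrightarrow> Ck m U (\<lambda>x. inverse (f x))"
proof (induction m)
  case 0
  then show ?case using assms(2) by (auto intro!: continuous_on_inverse)
next
  case (Suc m)
  have 1: "Ck m U (\<lambda>x. inverse (f x))"
    using Suc Ck_lower by blast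
  note D = Ck_SucD[OF Suc.prems] and F = Ck_SucD_frechet[OF Suc.prems]
  show ?case
    by (rule Ck_SucI'[OF assms(1) Deriv.has_derivative_inverse[OF assms(2) D]], assumption, assumption)
       (intro Ck_uminus Ck_mult assms(1) F 1)
qed

lemma has_derivative_affine_comp:
  fixes f :: "'a::real_normed_vector \<Rightarrow> 'b::real_normed_vector"
  assumes "(f has_derivative F) (at (d + c *\<^sub>R x))"
  shows "((\<lambda>x. f (d + c *\<^sub>R x)) has_derivative (\<lambda>h. c *\<^sub>R F h)) (at x)"
proof -
  have A: "((\<lambda>x. d + c *\<^sub>R x) has_derivative (\<lambda>h. c *\<^sub>R h)) (at x)"
    by (auto intro!: derivative_eq_intros)
  have "linear F" using assms by (auto dest: has_derivative_linear)
  then show ?thesis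
    using has_derivative_compose[OF A assms] by (simp add: linear_scale)
qed

lemma has_vector_derivative_line:
  fixes f :: "'a::real_normed_vector \<Rightarrow> 'b::real_normed_vector"
  assumes "(f has_derivative F) (at (y + t *\<^sub>R h))"
  shows "((\<lambda>t. f (y + t *\<^sub>R h)) has_vector_derivative F h) (at t)"
proof -
  have A: "((\<lambda>t. y + t *\<^sub>R h) has_derivative (\<lambda>s. s *\<^sub>R h)) (at t)"
    by (auto intro!: derivative_eq_intros)
  have "linear F" using assms by (auto dest: has_derivative_linear)
  then show ?thesis
    using has_derivative_compose[OF A assms] by (simp add: linear_scale has_vector_derivative_def)
qed

lemma Ck_affine:
  fixes f :: "'a::euclidean_space \<Rightarrow> 'b::real_normed_vector"
  shows "Ck m UNIV f \<Longrightarrow> Ck m UNIV (\<lambda>x. f (d + c *\<^sub>R x))"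
proof (induction m arbitrary: f)
  case 0
  then show ?case
    using continuous_on_compose2[of UNIV f UNIV "\<lambda>x. d + c *\<^sub>R x"] by (simp add: continuous_intros)
next
  case (Suc m)
  show ?case
    by (rule Ck_SucI'[OF open_UNIV has_derivative_affine_comp[OF Ck_SucD[OF Suc.prems UNIV_I]]])
       (rule Ck_bounded_linear[OF bounded_linear_scaleR_right open_UNIV Suc.IH[OF Ck_SucD_frechet[OF Suc.prems]]])
qed

lemma smooth_on_continuous_on: "smooth_on U f \<Longrightarrow> continuous_on U f"
  unfolding smooth_on_def using Ck_continuous_on by blast

lemma smooth_on_has_derivative:
  "smooth_on U f \<Longrightarrow> x \<in> U \<Longrightarrow> (f has_derivative frechet_derivative f (at x)) (at x)"
  unfolding smooth_on_def using Ck_SucD by blast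

lemma smooth_on_frechet_derivative:
  "smooth_on U f \<Longrightarrow> v \<in> Basis \<Longrightarrow> smooth_on U (\<lambda>x. frechet_derivative f (at x) v)"
  unfolding smooth_on_def by (metis Ck.simps(2))

lemma smooth_on_mult:
  fixes f g :: "'a::euclidean_space \<Rightarrow> 'b::real_normed_algebra"
  assumes "open U" "smooth_on U f" "smooth_on U g"
  shows "smooth_on U (\<lambda>x. f x * g x)"
  using assms Ck_mult unfolding smooth_on_def by metis

lemma smooth_on_add:
  fixes f g :: "'a::euclidean_space \<Rightarrow> 'b::real_normed_vector"
  assumes "open U" "smooth_on U f" "smooth_on U g"
  shows "smooth_on U (\<lambda>x. f x + g x)"
  using assms Ck_add unfolding smooth_on_def by metis

subsection \<open>Partial derivatives and test functions on all of space\<close>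

text \<open>Cut-off coefficients and mollifications live on all of space, so that integrals run over
  \<open>lborel\<close> and integration by parts has no boundary terms.\<close>

abbreviation tf :: "(real^'n::finite \<Rightarrow> complex) \<Rightarrow> bool" where
  "tf \<equiv> test_fun UNIV"

lemma axis_Basis [simp]: "axis i (1::real) \<in> Basis"
  by (simp add: axis_in_Basis_iff)

lemma Basis_vec_real: "v \<in> (Basis :: (real^'n::finite) set) \<longleftrightarrow> (\<exists>i. v = axis i 1)"
  by (auto simp: Basis_vec_def)

lemma vec_sum_axis: "(\<Sum>i\<in>UNIV. x $ i *\<^sub>R axis i 1) = (x :: real^'n::finite)"
  using basis_expansion[of x] by (simp add: scalar_mult_eq_scaleR)

lemma tf_iff: "tf \<phi> \<longleftrightarrow> smooth_on UNIV \<phi> \<and> bounded {x. \<phi> x \<noteq> 0}"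
  by (simp add: test_fun_def compact_closure)

lemma test_fun_tf: "test_fun \<Omega> \<phi> \<Longrightarrow> tf \<phi>"
  by (simp add: test_fun_def)

lemma tf_smooth: "tf \<phi> \<Longrightarrow> smooth_on UNIV \<phi>"
  by (simp add: tf_iff)

lemma tf_has_derivative: "tf f \<Longrightarrow> (f has_derivative frechet_derivative f (at x)) (at x)"
  using smooth_on_has_derivative[OF tf_smooth] by auto

lemma tf_continuous_on: "tf f \<Longrightarrow> continuous_on A f"
  using smooth_on_continuous_on[OF tf_smooth] continuous_on_subset by blast

lemma tf_isCont: "tf f \<Longrightarrow> isCont f x"
  using tf_has_derivative has_derivative_continuous by blast

lemma tf_measurable [measurable (raw)]: "tf f \<Longrightarrow> f \<in> borel_measurable borel"
  by (intro borel_measurable_continuous_onI tf_continuous_on)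

lemma partialI:
  "(f has_derivative f') (at x) \<Longrightarrow> partial i f x = f' (axis i 1)"
  unfolding partial_def using frechet_derivative_at by metis

lemma frechet_partial_sum:
  fixes f :: "real^'n::finite \<Rightarrow> 'b::real_normed_vector"
  assumes "(f has_derivative frechet_derivative f (at x)) (at x)"
  shows "frechet_derivative f (at x) h = (\<Sum>i\<in>UNIV. h $ i *\<^sub>R partial i f x)"
proof -
  have l: "linear (frechet_derivative f (at x))"
    using assms by (auto dest: has_derivative_linear)
  have "frechet_derivative f (at x) h = frechet_derivative f (at x) (\<Sum>i\<in>UNIV. h $ i *\<^sub>R axis i 1)"
    by (simp add: vec_sum_axis)
  also have "\<dots> = (\<Sum>i\<in>UNIV. h $ i *\<^sub>R partial i f x)"
    by (simp add: linear_sum[OF l] linear_scale[OF l] partial_def)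
  finally show ?thesis .
qed

lemma partial_add:
  assumes "f differentiable at x" "g differentiable at x"
  shows "partial i (\<lambda>x. f x + g x) x = partial i f x + partial i g x"
  using partialI[OF has_derivative_add[OF assms[unfolded frechet_derivative_works]]]
  by (simp add: partial_def)

lemma partial_diff:
  assumes "f differentiable at x" "g differentiable at x"
  shows "partial i (\<lambda>x. f x - g x) x = partial i f x - partial i g x"
  using partialI[OF has_derivative_diff[OF assms[unfolded frechet_derivative_works]]]
  by (simp add: partial_def)

lemma partial_mult:
  fixes f g :: "real^'n::finite \<Rightarrow> complex"
  assumes "f differentiable at x" "g differentiable at x"
  shows "partial i (\<lambda>x. f x * g x) x = partial i f x * g x + f x * partial i g x"
  using partialI[OF has_derivative_mult[OF assms[unfolded frechet_derivative_works]]]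
  by (simp add: partial_def)

lemma partial_sum:
  assumes "\<And>j. j \<in> I \<Longrightarrow> f j differentiable at x"
  shows "partial i (\<lambda>x. \<Sum>j\<in>I. f j x) x = (\<Sum>j\<in>I. partial i (f j) x)"
  using partialI[OF has_derivative_sum[OF assms[unfolded frechet_derivative_works]]]
  by (simp add: partial_def)

lemma partial_const [simp]: "partial i (\<lambda>x. c) x = 0"
  by (simp add: partial_def)

lemma partial_cong_open:
  assumes "open U" "x \<in> U" "\<And>y. y \<in> U \<Longrightarrow> f y = g y"
  shows "partial i f x = partial i g x"
proof -
  have "(f has_derivative D) (at x) \<longleftrightarrow> (g has_derivative D) (at x)" for D
    using has_derivative_transform_within_open[OF _ assms(1,2)] assms(3) by metis
  then show ?thesis unfolding partial_def frechet_derivative_def by simp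
qed

lemma tf_differentiable: "tf f \<Longrightarrow> f differentiable at x"
  using tf_has_derivative differentiable_def by blast

lemma closure_supportI: "f x \<noteq> 0 \<Longrightarrow> x \<in> closure {x. f x \<noteq> 0}"
  using closure_subset by fast

lemma zero_outside_closure_support:
  assumes "x \<notin> closure {x. f x \<noteq> 0}"
  shows "partial i f x = 0"
proof -
  have "partial i f x = partial i (\<lambda>x. 0) x"
  proof (rule partial_cong_open)
    show "f y = 0" if "y \<in> - closure {x. f x \<noteq> 0}" for y
      using that closure_supportI[of f y] by blast
  qed (use assms in auto)
  then show ?thesis by simp
qed

lemma support_partial: "{x. partial i f x \<noteq> 0} \<subseteq> closure {x. f x \<noteq> 0}"
  using zero_outside_closure_support by blast

lemma test_funI:
  assumes "smooth_on UNIV f" "{x. f x \<noteq> 0} \<subseteq> C" "closed C" "C \<subseteq> \<Omega>" "bounded C"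
  shows "test_fun \<Omega> f"
proof -
  have "closure {x. f x \<noteq> 0} \<subseteq> C"
    using assms by (intro closure_minimal)
  then show ?thesis
    unfolding test_fun_def using assms bounded_subset closed_closure compact_eq_bounded_closed
    by (metis subset_trans)
qed

lemma test_fun_partial:
  assumes "test_fun \<Omega> f" shows "test_fun \<Omega> (partial i f)"
proof (rule test_funI[where C="closure {x. f x \<noteq> 0}"])
  show "smooth_on UNIV (partial i f)"
    using smooth_on_frechet_derivative[of UNIV f "axis i 1"] assms
    by (simp add: partial_def[abs_def] test_fun_def)
qed (use assms support_partial in \<open>auto simp: test_fun_def compact_imp_bounded\<close>)

lemma test_fun_mult_left:
  assumes "test_fun \<Omega> f" "smooth_on UNIV g" shows "test_fun \<Omega> (\<lambda>x. f x * g x)"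
  by (rule test_funI[where C="closure {x. f x \<noteq> 0}"])
     (use assms in \<open>auto simp: test_fun_def compact_imp_bounded intro!: smooth_on_mult closure_supportI\<close>)

lemma test_fun_mult_right:
  assumes "test_fun \<Omega> f" "smooth_on UNIV g" shows "test_fun \<Omega> (\<lambda>x. g x * f x)"
  using test_fun_mult_left[OF assms] by (simp add: mult.commute)

lemma test_fun_const_mult:
  "test_fun \<Omega> f \<Longrightarrow> test_fun \<Omega> (\<lambda>x. c * f x)"
  by (rule test_fun_mult_right) (auto simp: smooth_on_def)

lemma test_fun_zero [simp]: "test_fun \<Omega> (\<lambda>x. 0)"
  by (simp add: test_fun_def smooth_on_def)

lemma test_fun_add:
  assumes "test_fun \<Omega> f" "test_fun \<Omega> g" shows "test_fun \<Omega> (\<lambda>x. f x + g x)"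
  by (rule test_funI[where C="closure {x. f x \<noteq> 0} \<union> closure {x. g x \<noteq> 0}"])
     (use assms in \<open>auto simp: test_fun_def compact_imp_bounded intro!: smooth_on_add closure_supportI\<close>)

lemma test_fun_diff:
  assumes "test_fun \<Omega> f" "test_fun \<Omega> g" shows "test_fun \<Omega> (\<lambda>x. f x - g x)"
  using test_fun_add[OF assms(1) test_fun_const_mult[OF assms(2), of "-1"]] by simp

lemma test_fun_sum:
  "(\<And>i. i \<in> I \<Longrightarrow> test_fun \<Omega> (f i)) \<Longrightarrow> test_fun \<Omega> (\<lambda>x. \<Sum>i\<in>I. f i x)"
  by (induction I rule: infinite_finite_induct) (auto intro: test_fun_add)

lemma test_fun_mult:
  "test_fun \<Omega> f \<Longrightarrow> test_fun \<Omega>' g \<Longrightarrow> test_fun \<Omega> (\<lambda>x. f x * g x)"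
  by (rule test_fun_mult_left) (auto simp: test_fun_def)

lemma tf_affine:
  assumes "tf f" "c \<noteq> 0" shows "tf (\<lambda>x. f (d + c *\<^sub>R x))"
proof -
  have "{x. f (d + c *\<^sub>R x) \<noteq> 0} \<subseteq> (\<lambda>y. (1/c) *\<^sub>R (y - d)) ` {x. f x \<noteq> 0}"
  proof
    fix x assume "x \<in> {x. f (d + c *\<^sub>R x) \<noteq> 0}"
    then show "x \<in> (\<lambda>y. (1/c) *\<^sub>R (y - d)) ` {x. f x \<noteq> 0}"
      using assms(2) by (intro image_eqI[of _ _ "d + c *\<^sub>R x"]) auto
  qed
  moreover have "bounded ((\<lambda>y. (1/c) *\<^sub>R (y - d)) ` {x. f x \<noteq> 0})"
    using assms(1) by (auto simp: tf_iff image_image[symmetric, of "\<lambda>y. (1/c) *\<^sub>R y" "\<lambda>y. y - d"]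
         intro!: bounded_scaling bounded_translation_minus)
  ultimately show ?thesis
    using assms Ck_affine unfolding tf_iff smooth_on_def by (metis bounded_subset)
qed

lemma tf_cnj:
  assumes "tf f" shows "tf (\<lambda>x. cnj (f x))"
  using assms Ck_bounded_linear[OF bounded_linear_cnj open_UNIV] unfolding tf_iff smooth_on_def
  by (simp del: Ck.simps) blast

lemma partial_cnj:
  assumes "tf f" shows "partial i (\<lambda>x. cnj (f x)) x = cnj (partial i f x)"
  by (subst partialI[OF bounded_linear.has_derivative[OF bounded_linear_cnj tf_has_derivative[OF assms]]])
     (simp add: partial_def)

lemma partial_affine:
  assumes "tf f" shows "partial i (\<lambda>x. f (d + c *\<^sub>R x)) x = c *\<^sub>R partial i f (d + c *\<^sub>R x)"
proof -
  show ?thesis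
    using partialI[OF has_derivative_affine_comp[OF tf_has_derivative[OF assms]]] by (simp add: partial_def)
qed

lemma tf_bounded:
  assumes "tf f" obtains B where "B > 0" "\<And>x. norm (f x) \<le> B"
proof -
  have "compact (closure {x. f x \<noteq> 0})"
    using assms by (simp add: tf_iff compact_closure)
  then have "bounded (f ` closure {x. f x \<noteq> 0})"
    by (intro compact_imp_bounded compact_continuous_image tf_continuous_on assms)
  then obtain B where B: "B > 0" "\<And>y. y \<in> closure {x. f x \<noteq> 0} \<Longrightarrow> norm (f y) \<le> B"
    unfolding bounded_pos by auto
  have "norm (f x) \<le> B" for x
    using B closure_subset[of "{x. f x \<noteq> 0}"] by (cases "f x = 0") auto
  then show ?thesis using B(1) that by blast
qed

lemma tf_frechet_bound:
  assumes "tf f"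
  obtains L where "L > 0" "\<And>x h. norm (frechet_derivative f (at x) h) \<le> L * norm h"
proof -
  have "\<exists>B>0. \<forall>x. norm (partial i f x) \<le> B" for i
    using tf_bounded[OF test_fun_partial[OF assms, of i]] by metis
  then obtain B where B: "\<And>i. B i > 0" "\<And>i x. norm (partial i f x) \<le> B i"
    by metis
  define L where "L = 1 + (\<Sum>i\<in>UNIV. B i)"
  have L: "L > 0" unfolding L_def using B(1) by (intro add_pos_nonneg sum_nonneg) (auto simp: less_imp_le)
  have "norm (frechet_derivative f (at x) h) \<le> L * norm h" for x h
  proof -
    have "norm (frechet_derivative f (at x) h) \<le> (\<Sum>i\<in>UNIV. \<bar>h $ i\<bar> * norm (partial i f x))"
      unfolding frechet_partial_sum[OF tf_has_derivative[OF assms]]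
      by (rule sum_norm_le) simp
    also have "\<dots> \<le> (\<Sum>i\<in>UNIV. norm h * B i)"
      by (intro sum_mono mult_mono B component_le_norm_cart) auto
    also have "\<dots> = (\<Sum>i\<in>UNIV. B i) * norm h"
      by (subst sum_distrib_right) (simp add: mult.commute)
    also have "\<dots> \<le> L * norm h"
      unfolding L_def by (simp add: distrib_right)
    finally show ?thesis .
  qed
  then show ?thesis using L that by blast
qed

lemma tf_lipschitz:
  assumes "tf f" obtains L where "L > 0" "\<And>x y. norm (f x - f y) \<le> L * norm (x - y)"
proof -
  obtain L where L: "L > 0" "\<And>x h. norm (frechet_derivative f (at x) h) \<le> L * norm h"
    using tf_frechet_bound[OF assms] by metis
  have "norm (f x - f y) \<le> L * norm (x - y)" for x y
    by (rule differentiable_bound[where S=UNIV and f'="\<lambda>x. frechet_derivative f (at x)"])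
       (use tf_has_derivative[OF assms] L in \<open>auto intro!: onorm_le\<close>)
  then show ?thesis using L(1) that by blast
qed

text \<open>Two nested mean value inequalities: along \<open>axis j\<close> for
  \<open>partial i f\<close>, then along \<open>axis i\<close> for the difference of
  \<open>f\<close> across the step in direction \<open>j\<close>. Its purpose is
  \<open>partial_commute\<close>.\<close>

lemma second_difference_estimate:
  fixes f :: "real^'n::finite \<Rightarrow> complex"
  assumes f: "tf f" and "e > 0"
  shows "\<exists>\<delta>>0. \<forall>s. 0 < s \<longrightarrow> s < \<delta> \<longrightarrow>
    norm (f (x + s *\<^sub>R axis i 1 + s *\<^sub>R axis j 1) - f (x + s *\<^sub>R axis i 1) - f (x + s *\<^sub>R axis j 1) + f x
      - (s * s) *\<^sub>R partial j (partial i f) x) \<le> e * s * s"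
proof -
  let ?g = "partial j (partial i f)"
  have tg: "tf (partial i f)" "tf ?g" using f by (auto intro: test_fun_partial)
  obtain d where d: "d > 0" "\<And>y. dist y x < d \<Longrightarrow> dist (?g y) (?g x) < e"
    using tf_isCont[OF tg(2), of x] \<open>e > 0\<close> unfolding continuous_at_eps_delta by blast
  have D: "((\<lambda>t. h (y + t *\<^sub>R axis k 1)) has_vector_derivative partial k h (y + t *\<^sub>R axis k 1)) (at t)"
    if "tf h" for h :: "real^'n \<Rightarrow> complex" and y k t
    unfolding partial_def by (rule has_vector_derivative_line[OF tf_has_derivative[OF that]])
  show ?thesis
  proof (intro exI[of _ "d/2"] conjI allI impI)
    fix s assume s: "0 < s" "s < d/2"
    \<comment> \<open>Along \<open>axis j\<close>, with the displacement \<open>r\<close> along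
      \<open>axis i\<close> frozen; continuity of the mixed derivative at \<open>x\<close> bounds
      the derivative of \<open>?H\<close> by \<open>e\<close>.\<close>
    have inner: "norm (partial i f (x + r *\<^sub>R axis i 1 + s *\<^sub>R axis j 1) - partial i f (x + r *\<^sub>R axis i 1) - s *\<^sub>R ?g x)
        \<le> e * s" if r: "0 < r" "r < s" for r
    proof -
      let ?H = "\<lambda>t. partial i f (x + r *\<^sub>R axis i 1 + t *\<^sub>R axis j 1) - t *\<^sub>R ?g x"
      have D': "(?H has_vector_derivative (?g (x + r *\<^sub>R axis i 1 + t *\<^sub>R axis j 1) - ?g x)) (at t)" for t
        by (intro has_vector_derivative_diff D tg) (auto intro!: derivative_eq_intros)
      have "norm (?H s - ?H 0) \<le> (\<lambda>t. e * t) s - (\<lambda>t. e * t) 0"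
      proof (rule differentiable_bound_general[where \<phi>'="\<lambda>_. e" and f' = "\<lambda>t. ?g (x + r *\<^sub>R axis i 1 + t *\<^sub>R axis j 1) - ?g x"])
        show "continuous_on {0..s} ?H"
          by (intro continuous_at_imp_continuous_on ballI) (use D' has_vector_derivative_continuous in blast)
        fix t assume t: "0 < t" "t < s"
        have "norm (r *\<^sub>R axis i 1 + t *\<^sub>R axis j (1::real)) \<le> norm (r *\<^sub>R axis i (1::real) :: real^'n) + norm (t *\<^sub>R axis j (1::real) :: real^'n)"
          by (rule norm_triangle_ineq)
        also have "\<dots> < d" using t r s by simp
        finally have "dist (x + r *\<^sub>R axis i 1 + t *\<^sub>R axis j 1) x < d"
          by (simp add: dist_norm add.assoc)
        from d(2)[OF this] show "norm (?g (x + r *\<^sub>R axis i 1 + t *\<^sub>R axis j 1) - ?g x) \<le> e"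
          by (simp add: dist_norm)
      qed (use s D' in \<open>auto intro!: derivative_eq_intros continuous_intros\<close>)
      then show ?thesis by (simp add: algebra_simps)
    qed
    \<comment> \<open>Along \<open>axis i\<close>: the derivative of \<open>?G\<close> at
      \<open>r\<close> is exactly the quantity bounded by \<open>inner\<close>.\<close>
    let ?G = "\<lambda>r. f ((x + s *\<^sub>R axis j 1) + r *\<^sub>R axis i 1) - f (x + r *\<^sub>R axis i 1) - r *\<^sub>R (s *\<^sub>R ?g x)"
    have D': "(?G has_vector_derivative (partial i f ((x + s *\<^sub>R axis j 1) + r *\<^sub>R axis i 1) - partial i f (x + r *\<^sub>R axis i 1) - s *\<^sub>R ?g x)) (at r)" for r
      by (intro has_vector_derivative_diff D f) (auto intro!: derivative_eq_intros)
    have "norm (?G s - ?G 0) \<le> (\<lambda>t. e * s * t) s - (\<lambda>t. e * s * t) 0"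
    proof (rule differentiable_bound_general[where \<phi>'="\<lambda>_. e * s" and f'="\<lambda>r. partial i f ((x + s *\<^sub>R axis j 1) + r *\<^sub>R axis i 1) - partial i f (x + r *\<^sub>R axis i 1) - s *\<^sub>R ?g x"])
      show "continuous_on {0..s} ?G"
        by (intro continuous_at_imp_continuous_on ballI) (use D' has_vector_derivative_continuous in blast)
      fix r assume "0 < r" "r < s"
      from inner[OF this]
      show "norm (partial i f ((x + s *\<^sub>R axis j 1) + r *\<^sub>R axis i 1) - partial i f (x + r *\<^sub>R axis i 1) - s *\<^sub>R ?g x) \<le> e * s"
        by (simp add: ac_simps)
    qed (use s D' in \<open>auto intro!: derivative_eq_intros continuous_intros\<close>)
    then show "norm (f (x + s *\<^sub>R axis i 1 + s *\<^sub>R axis j 1) - f (x + s *\<^sub>R axis i 1) - f (x + s *\<^sub>R axis j 1) + f x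
      - (s * s) *\<^sub>R ?g x) \<le> e * s * s"
      by (simp add: algebra_simps)
  qed (use d in auto)
qed

text \<open>The second difference \<open>A\<close> is symmetric in \<open>i\<close> and
  \<open>j\<close>, so both mixed derivatives lie within \<open>e\<close> of A/s^2.\<close>

lemma partial_commute:
  assumes f: "tf f" shows "partial i (partial j f) x = partial j (partial i f) x"
proof -
  have "norm (partial i (partial j f) x - partial j (partial i f) x) \<le> 2 * e" if e: "e > 0" for e
  proof -
    obtain d1 where d1: "d1 > 0" "\<And>s. 0 < s \<Longrightarrow> s < d1 \<Longrightarrow>
      norm (f (x + s *\<^sub>R axis i 1 + s *\<^sub>R axis j 1) - f (x + s *\<^sub>R axis i 1) - f (x + s *\<^sub>R axis j 1) + f x
      - (s * s) *\<^sub>R partial j (partial i f) x) \<le> e * s * s"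
      using second_difference_estimate[OF f e, of x i j] by blast
    obtain d2 where d2: "d2 > 0" "\<And>s. 0 < s \<Longrightarrow> s < d2 \<Longrightarrow>
      norm (f (x + s *\<^sub>R axis j 1 + s *\<^sub>R axis i 1) - f (x + s *\<^sub>R axis j 1) - f (x + s *\<^sub>R axis i 1) + f x
      - (s * s) *\<^sub>R partial i (partial j f) x) \<le> e * s * s"
      using second_difference_estimate[OF f e, of x j i] by blast
    define s where "s = min d1 d2 / 2"
    have s: "0 < s" "s < d1" "s < d2" using d1(1) d2(1) by (auto simp: s_def)
    define A where "A = f (x + s *\<^sub>R axis i 1 + s *\<^sub>R axis j 1) - f (x + s *\<^sub>R axis i 1) - f (x + s *\<^sub>R axis j 1) + f x"
    have 1: "norm (A - (s * s) *\<^sub>R partial j (partial i f) x) \<le> e * s * s"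
      using d1(2)[OF s(1,2)] by (simp add: A_def)
    have 2: "norm (A - (s * s) *\<^sub>R partial i (partial j f) x) \<le> e * s * s"
      using d2(2)[OF s(1,3)] by (simp add: A_def add.assoc add.commute[of "s *\<^sub>R axis j 1" "s *\<^sub>R axis i 1"] algebra_simps)
    have "norm ((s * s) *\<^sub>R (partial i (partial j f) x - partial j (partial i f) x)) \<le> e * s * s + e * s * s"
      using norm_triangle_le_diff[OF add_mono[OF 1 2]] by (simp add: scaleR_diff_right)
    then have "(s * s) * norm (partial i (partial j f) x - partial j (partial i f) x) \<le> (s * s) * (2 * e)"
      by (simp add: mult_ac)
    then show ?thesis by (rule mult_left_le_imp_le) (simp add: s(1))
  qed
  note le = this
  have "norm (partial i (partial j f) x - partial j (partial i f) x) \<le> 0 + e" if "e > 0" for e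
    using le[of "e/2"] that by simp
  from field_le_epsilon[OF this] show ?thesis by simp
qed

subsection \<open>A smooth bump function\<close>

text \<open>Dividing by powers of \<open>t\<close> makes the family closed under differentiation
  (\<open>DERIV_eta\<close>), so smoothness of the whole family follows by one induction generalised
  over \<open>p\<close>.\<close>

definition eta :: "nat \<Rightarrow> real \<Rightarrow> real" where
  "eta p t = (if t > 0 then exp (- (1/t)) / t ^ p else 0)"

text \<open>The exponential series dominates its term of index \<open>p + 2\<close>. The quadratic
  decay makes the difference quotient of \<open>eta p\<close> at 0 tend to 0.\<close>

lemma eta_le: "t > 0 \<Longrightarrow> eta p t \<le> fact (p + 2) * t ^ 2"
proof -
  assume t: "t > 0"
  have "(1/t) ^ (p+2) / fact (p+2) \<le> (\<Sum>i<p+3. (1/t) ^ i / fact i)"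
    using t by (intro member_le_sum[of "p+2" _ "\<lambda>i. (1/t) ^ i / fact i"]) auto
  also have "\<dots> \<le> exp (1/t)"
  proof -
    have "(\<Sum>i<p+3. (1/t) ^ i /\<^sub>R fact i) \<le> (\<Sum>i. (1/t) ^ i /\<^sub>R fact i)"
      using t by (intro sum_le_suminf summable_exp_generic) (auto)
    then show ?thesis by (simp add: exp_def divide_inverse mult.commute)
  qed
  finally have "(1/t) ^ (p+2) / fact (p+2) \<le> exp (1/t)" .
  then have *: "(1/t) ^ (p+2) \<le> fact (p+2) * exp (1/t)"
    by (simp add: pos_divide_le_eq mult.commute del: fact_Suc add_2_eq_Suc')
  have "eta p t = t ^ 2 * ((1/t) ^ (p+2) * exp (- (1/t)))"
    using t by (simp add: eta_def power_add power_divide power2_eq_square del: add_2_eq_Suc')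
  also have "\<dots> \<le> t ^ 2 * ((fact (p+2) * exp (1/t)) * exp (- (1/t)))"
    by (intro mult_left_mono mult_right_mono *) auto
  also have "\<dots> = fact (p+2) * t ^ 2"
    by (simp add: exp_minus del: fact_Suc add_2_eq_Suc')
  finally show ?thesis .
qed

lemma DERIV_eta: "(eta p has_real_derivative (eta (p+2) t - of_nat p * eta (p+1) t)) (at t)"
proof -
  consider "t > 0" | "t < 0" | "t = 0" by linarith
  then show ?thesis
  proof cases
    case 1
    have "((\<lambda>t. exp (- (1/t)) / t ^ p) has_real_derivative (eta (p+2) t - of_nat p * eta (p+1) t)) (at t)"
      using 1
      apply (auto intro!: derivative_eq_intros simp: eta_def)
      apply (cases p; simp add: field_simps power2_eq_square)
      done
    then show ?thesis
      by (rule DERIV_cong_ev[THEN iffD1, rotated 3])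
         (use 1 eventually_gt_at_top in \<open>auto simp: eta_def eventually_nhds intro!: exI[of _ "{0<..}"]\<close>)
  next
    case 2
    have "((\<lambda>t. 0) has_real_derivative (eta (p+2) t - of_nat p * eta (p+1) t)) (at t)"
      using 2 by (auto simp: eta_def)
    then show ?thesis
      by (rule DERIV_cong_ev[THEN iffD1, rotated 3])
         (use 2 in \<open>auto simp: eta_def eventually_nhds intro!: exI[of _ "{..<0}"]\<close>)
  next
    case 3
    have "((\<lambda>h. (eta p (0 + h) - eta p 0) / h) \<longlongrightarrow> 0) (at 0)"
    proof (rule tendsto_0_le[where f="\<lambda>h. h" and K="fact (p+2)"])
      show "\<forall>\<^sub>F h in at 0. norm ((eta p (0 + h) - eta p 0) / h) \<le> norm h * fact (p + 2)"
      proof (intro always_eventually allI)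
        fix h :: real
        show "norm ((eta p (0 + h) - eta p 0) / h) \<le> norm h * fact (p + 2)"
        proof (cases "h > 0")
          case True
          have "0 \<le> eta p h" using True by (simp add: eta_def)
          then show ?thesis using eta_le[OF True, of p] True
            by (simp add: eta_def[of p 0] field_simps power2_eq_square)
        qed (simp add: eta_def mult_nonpos_nonneg del: fact_Suc add_2_eq_Suc')
      qed
    qed (rule tendsto_ident_at)
    then show ?thesis using 3 by (simp add: DERIV_def) (simp add: eta_def)
  qed
qed

lemma Ck_eta_bump: "Ck m UNIV (\<lambda>x::'a::euclidean_space. eta p (1 - x \<bullet> x))"
proof (induction m arbitrary: p)
  case 0
  have "isCont (eta p) t" for t using DERIV_eta DERIV_isCont by blast
  then have "continuous_on UNIV (eta p)" by (simp add: continuous_at_imp_continuous_on)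
  then show ?case
    using continuous_on_compose2[of UNIV "eta p" UNIV "\<lambda>x. 1 - x \<bullet> x"] by (simp add: continuous_intros)
next
  case (Suc m)
  show ?case
  proof (rule Ck_SucI'[where f'="\<lambda>x h. (eta (p+2) (1 - x \<bullet> x) - of_nat p * eta (p+1) (1 - x \<bullet> x)) * (- 2 * (x \<bullet> h))"])
    fix x :: 'a
    have "((\<lambda>x. 1 - x \<bullet> x) has_derivative (\<lambda>h. - 2 * (x \<bullet> h))) (at x)"
      by (auto intro!: derivative_eq_intros simp: inner_commute)
    then show "((\<lambda>x. eta p (1 - x \<bullet> x)) has_derivative
        (\<lambda>h. (eta (p+2) (1 - x \<bullet> x) - of_nat p * eta (p+1) (1 - x \<bullet> x)) * (- 2 * (x \<bullet> h)))) (at x)"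
      using has_derivative_compose[OF _ DERIV_eta[unfolded has_field_derivative_def]] by blast
  next
    fix v :: 'a
    show "Ck m UNIV (\<lambda>x. (eta (p+2) (1 - x \<bullet> x) - of_nat p * eta (p+1) (1 - x \<bullet> x)) * (- 2 * (x \<bullet> v)))"
      using Suc.IH by (intro Ck_mult Ck_diff Ck_const Ck_linear[OF bounded_linear_inner_left]) auto
  qed simp
qed

definition bump :: "real^'n::finite \<Rightarrow> complex" where
  "bump x = of_real (eta 0 (1 - x \<bullet> x))"

lemma bump_support: "bump x \<noteq> 0 \<longleftrightarrow> norm x < 1"
  by (auto simp: bump_def eta_def dot_square_norm power_less_one_iff abs_square_less_1)

lemma tf_bump: "tf (bump :: real^'n::finite \<Rightarrow> complex)"
proof -
  have "{x::real^'n. bump x \<noteq> 0} = ball 0 1"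
    by (auto simp: bump_support)
  moreover have "smooth_on UNIV (bump :: real^'n \<Rightarrow> complex)"
    unfolding smooth_on_def bump_def[abs_def]
    using Ck_bounded_linear[OF bounded_linear_of_real open_UNIV Ck_eta_bump] by blast
  ultimately show ?thesis
    unfolding tf_iff by simp
qed

subsection \<open>Integration\<close>

lemma nn_integral_lborel_affine:
  fixes f :: "'a::euclidean_space \<Rightarrow> ennreal"
  assumes "f \<in> borel_measurable borel" "c \<noteq> 0"
  shows "(\<integral>\<^sup>+x. f x \<partial>lborel) = ennreal (\<bar>c\<bar> ^ DIM('a)) * (\<integral>\<^sup>+x. f (t + c *\<^sub>R x) \<partial>lborel)"
  using assms(1)
  by (subst lborel_affine[OF assms(2), of t])
     (simp add: nn_integral_density nn_integral_distr nn_integral_cmult)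

lemma integrable_lborel_affine:
  fixes f :: "'a::euclidean_space \<Rightarrow> 'b::{banach,second_countable_topology}"
  assumes f: "integrable lborel f" and c: "c \<noteq> 0"
  shows "integrable lborel (\<lambda>x. f (t + c *\<^sub>R x))"
proof (rule integrableI_bounded)
  have [measurable]: "f \<in> borel_measurable borel" using f by auto
  show "(\<lambda>x. f (t + c *\<^sub>R x)) \<in> borel_measurable lborel" by measurable
  have "ennreal (\<bar>c\<bar> ^ DIM('a)) * (\<integral>\<^sup>+x. norm (f (t + c *\<^sub>R x)) \<partial>lborel) < \<infinity>"
    using f c by (subst nn_integral_lborel_affine[symmetric]) (auto simp: integrable_iff_bounded)
  then show "(\<integral>\<^sup>+x. norm (f (t + c *\<^sub>R x)) \<partial>lborel) < \<infinity>"
    using c by (auto simp: ennreal_mult_less_top)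
qed

lemma integral_lborel_affine:
  fixes f :: "'a::euclidean_space \<Rightarrow> 'b::{banach,second_countable_topology}"
  assumes [measurable]: "f \<in> borel_measurable borel" and c: "c \<noteq> 0"
  shows "(\<integral>x. f x \<partial>lborel) = (\<bar>c\<bar> ^ DIM('a)) *\<^sub>R (\<integral>x. f (t + c *\<^sub>R x) \<partial>lborel)"
  by (subst lborel_affine[OF c, of t])
     (simp add: integral_density integral_distr)

lemma integral_lborel_reflect:
  fixes f :: "'a::euclidean_space \<Rightarrow> 'b::{banach,second_countable_topology}"
  assumes "f \<in> borel_measurable borel"
  shows "(\<integral>y. f (x - y) \<partial>lborel) = (\<integral>y. f y \<partial>lborel)"
  using integral_lborel_affine[OF assms, of "-1" x] by simp

text \<open>Differentiation under the integral by dominated convergence. The bound on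
  \<open>f'\<close> is uniform in \<open>x\<close>, hence \<open>f\<close> is Lipschitz in
  \<open>x\<close> with constant \<open>g \<omega>\<close>, and \<open>2 * g\<close> dominates the
  normalised remainder.\<close>

lemma has_derivative_integral:
  fixes f :: "'a::euclidean_space \<Rightarrow> 'b \<Rightarrow> 'c::{banach,second_countable_topology}"
  assumes int: "\<And>x. integrable M (f x)"
    and der: "\<And>x \<omega>. ((\<lambda>x. f x \<omega>) has_derivative f' x \<omega>) (at x)"
    and bd: "\<And>x \<omega> h. norm (f' x \<omega> h) \<le> g \<omega> * norm h"
    and g: "integrable M g"
    and meas: "\<And>x h. (\<lambda>\<omega>. f' x \<omega> h) \<in> borel_measurable M"
  shows "((\<lambda>x. \<integral>\<omega>. f x \<omega> \<partial>M) has_derivative (\<lambda>h. \<integral>\<omega>. f' x \<omega> h \<partial>M)) (at x)"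
proof -
  have lin: "linear (f' x \<omega>)" for x \<omega> using der has_derivative_linear by blast
  have int': "integrable M (\<lambda>\<omega>. f' x \<omega> h)" for x h
    by (rule Bochner_Integration.integrable_bound[OF integrable_mult_left[OF g, of "norm h"] meas])
       (use bd in \<open>auto intro: order_trans[OF bd] abs_ge_self\<close>)
  have lip: "norm (f y \<omega> - f x \<omega>) \<le> g \<omega> * norm (y - x)" for x y \<omega>
    by (rule differentiable_bound[where S=UNIV and f'="\<lambda>x. f' x \<omega>"])
       (use der bd in \<open>auto intro!: onorm_le\<close>)
  show ?thesis
    unfolding has_derivative_iff_norm
  proof
    show "bounded_linear (\<lambda>h. \<integral>\<omega>. f' x \<omega> h \<partial>M)"
    proof (rule bounded_linear_intro[where K="\<integral>\<omega>. g \<omega> \<partial>M"])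
      show "(\<integral>\<omega>. f' x \<omega> (h + k) \<partial>M) = (\<integral>\<omega>. f' x \<omega> h \<partial>M) + (\<integral>\<omega>. f' x \<omega> k \<partial>M)" for h k
        by (simp add: linear_add[OF lin] int')
      show "(\<integral>\<omega>. f' x \<omega> (r *\<^sub>R h) \<partial>M) = r *\<^sub>R (\<integral>\<omega>. f' x \<omega> h \<partial>M)" for r h
        by (simp add: linear_scale[OF lin])
      fix h
      have "norm (\<integral>\<omega>. f' x \<omega> h \<partial>M) \<le> (\<integral>\<omega>. g \<omega> * norm h \<partial>M)"
        by (intro order_trans[OF integral_norm_bound integral_mono] integrable_norm int' integrable_mult_left g bd)
      then show "norm (\<integral>\<omega>. f' x \<omega> h \<partial>M) \<le> norm h * (\<integral>\<omega>. g \<omega> \<partial>M)"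
        by (simp add: mult.commute)
    qed
    show "((\<lambda>y. norm ((\<integral>\<omega>. f y \<omega> \<partial>M) - (\<integral>\<omega>. f x \<omega> \<partial>M) - (\<integral>\<omega>. f' x \<omega> (y - x) \<partial>M)) / norm (y - x)) \<longlongrightarrow> 0) (at x)"
      unfolding tendsto_at_iff_sequentially comp_def
    proof (intro allI impI)
      fix Y :: "nat \<Rightarrow> 'a" assume Y: "\<forall>i. Y i \<in> UNIV - {x}" "Y \<longlonglongrightarrow> x"
      define q where "q i \<omega> = norm (f (Y i) \<omega> - f x \<omega> - f' x \<omega> (Y i - x)) / norm (Y i - x)" for i \<omega>
      have lim: "(\<lambda>i. \<integral>\<omega>. q i \<omega> \<partial>M) \<longlonglongrightarrow> (\<integral>\<omega>. 0 \<partial>M)"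
      proof (rule integral_dominated_convergence[where w="\<lambda>\<omega>. 2 * g \<omega>"])
        show "q i \<in> borel_measurable M" for i
          unfolding q_def using int[THEN borel_measurable_integrable] meas by measurable
        show "AE \<omega> in M. (\<lambda>i. q i \<omega>) \<longlonglongrightarrow> 0"
          using der[of _ x] Y unfolding q_def has_derivative_iff_norm tendsto_at_iff_sequentially comp_def
          by auto
        show "AE \<omega> in M. norm (q i \<omega>) \<le> 2 * g \<omega>" for i
        proof (rule AE_I2)
          fix \<omega>
          have "norm (f (Y i) \<omega> - f x \<omega> - f' x \<omega> (Y i - x)) \<le> g \<omega> * norm (Y i - x) + g \<omega> * norm (Y i - x)"
            by (rule norm_triangle_le_diff[OF add_mono[OF lip bd]])
          then show "norm (q i \<omega>) \<le> 2 * g \<omega>"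
            using Y(1)[rule_format, of i] by (simp add: q_def divide_le_eq)
        qed
      qed (use g in auto)
      show "(\<lambda>i. norm ((\<integral>\<omega>. f (Y i) \<omega> \<partial>M) - (\<integral>\<omega>. f x \<omega> \<partial>M) - (\<integral>\<omega>. f' x \<omega> (Y i - x) \<partial>M)) / norm (Y i - x)) \<longlonglongrightarrow> 0"
      proof (rule tendsto_sandwich[OF _ _ tendsto_const])
        show "(\<lambda>i. \<integral>\<omega>. q i \<omega> \<partial>M) \<longlonglongrightarrow> 0" using lim by simp
        show "\<forall>\<^sub>F i in sequentially. norm ((\<integral>\<omega>. f (Y i) \<omega> \<partial>M) - (\<integral>\<omega>. f x \<omega> \<partial>M) - (\<integral>\<omega>. f' x \<omega> (Y i - x) \<partial>M)) / norm (Y i - x)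
           \<le> (\<integral>\<omega>. q i \<omega> \<partial>M)"
        proof (intro always_eventually allI)
          fix i
          have "norm ((\<integral>\<omega>. f (Y i) \<omega> \<partial>M) - (\<integral>\<omega>. f x \<omega> \<partial>M) - (\<integral>\<omega>. f' x \<omega> (Y i - x) \<partial>M))
             = norm (\<integral>\<omega>. (f (Y i) \<omega> - f x \<omega> - f' x \<omega> (Y i - x)) \<partial>M)"
            by (simp add: int int')
          also have "\<dots> \<le> (\<integral>\<omega>. norm (f (Y i) \<omega> - f x \<omega> - f' x \<omega> (Y i - x)) \<partial>M)"
            by (rule integral_norm_bound)
          finally show "norm ((\<integral>\<omega>. f (Y i) \<omega> \<partial>M) - (\<integral>\<omega>. f x \<omega> \<partial>M) - (\<integral>\<omega>. f' x \<omega> (Y i - x) \<partial>M)) / norm (Y i - x)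
             \<le> (\<integral>\<omega>. q i \<omega> \<partial>M)"
            by (simp add: q_def divide_right_mono)
        qed
      qed (auto intro!: always_eventually)
    qed
  qed
qed

section \<open>Square integrable functions of bounded support\<close>

text \<open>Bounded support makes these functions integrable and their convolutions with test
  functions again test functions; Borel instead of Lebesgue measurability keeps translations,
  dilations and Fubini on \<open>lborel\<close> unproblematic.\<close>

definition L2c :: "(real^'n::finite \<Rightarrow> complex) \<Rightarrow> bool" where
  "L2c w \<longleftrightarrow> w \<in> borel_measurable borel \<and> integrable lborel (\<lambda>x. (norm (w x))\<^sup>2) \<and> bounded {x. w x \<noteq> 0}"

text \<open>The square of the norm: sums of derivatives then need no roots, at the price of the
  factors 2 in every triangle inequality.\<close>

definition L2sq :: "(real^'n::finite \<Rightarrow> complex) \<Rightarrow> real" where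
  "L2sq w = (\<integral>x. (norm (w x))\<^sup>2 \<partial>lborel)"

lemma L2cD [dest]:
  "L2c w \<Longrightarrow> w \<in> borel_measurable borel" "L2c w \<Longrightarrow> integrable lborel (\<lambda>x. (norm (w x))\<^sup>2)"
  "L2c w \<Longrightarrow> bounded {x. w x \<noteq> 0}"
  by (auto simp: L2c_def)

lemma L2sq_nonneg [simp]: "0 \<le> L2sq w"
  by (simp add: L2sq_def)

lemma norm_add_sq_le: "(norm (a + b :: 'a::real_normed_vector))\<^sup>2 \<le> 2 * (norm a)\<^sup>2 + 2 * (norm b)\<^sup>2"
proof -
  have "(norm (a + b))\<^sup>2 \<le> (norm a + norm b)\<^sup>2"
    by (intro power_mono norm_triangle_ineq) auto
  also have "\<dots> \<le> 2 * (norm a)\<^sup>2 + 2 * (norm b)\<^sup>2"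
    using sum_squares_bound[of "norm a" "norm b"] by (simp add: power2_sum)
  finally show ?thesis .
qed

lemma integrable_lborel_indicator_bounded:
  assumes "bounded (A :: 'a::euclidean_space set)" "A \<in> sets borel"
  shows "integrable lborel (indicator A :: 'a \<Rightarrow> real)"
  using assms emeasure_bounded_finite[OF assms(1)] by (intro integrable_real_indicator) auto

lemma L2c_support:
  assumes "L2c w" obtains R where "R > 0" "{x. w x \<noteq> 0} \<subseteq> cball 0 R"
  using bounded_subset_ballD[OF L2cD(3)[OF assms], of 0] that ball_subset_cball by (metis subset_trans)

lemma tf_support:
  assumes "tf w" obtains R where "R > 0" "{x. w x \<noteq> 0} \<subseteq> cball 0 R"
  using bounded_subset_ballD[of "{x. w x \<noteq> 0}" 0] assms that ball_subset_cball unfolding tf_iff by (metis subset_trans)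

lemma L2c_integrable:
  assumes "L2c w" shows "integrable lborel w"
proof -
  obtain R where R: "{x. w x \<noteq> 0} \<subseteq> cball 0 R"
    using L2c_support[OF assms] by metis
  \<comment> \<open>On the support, |w| is at most 1 + |w|^2.\<close>
  have "integrable lborel (\<lambda>x. indicator (cball 0 R) x + (norm (w x))\<^sup>2)"
    using assms by (intro Bochner_Integration.integrable_add integrable_lborel_indicator_bounded) auto
  then show ?thesis
  proof (rule Bochner_Integration.integrable_bound)
    show "AE x in lborel. norm (w x) \<le> norm (indicator (cball 0 R) x + (norm (w x))\<^sup>2)"
    proof (rule AE_I2)
      fix x
      have "norm (w x) \<le> 1 + (norm (w x))\<^sup>2"
        using sum_squares_bound[of 1 "norm (w x)"] norm_ge_zero[of "w x"]
        by (simp add: power2_eq_square del: norm_ge_zero)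
      then show "norm (w x) \<le> norm (indicator (cball 0 R) x + (norm (w x))\<^sup>2)"
        using R by (cases "w x = 0") (auto simp: indicator_def)
    qed
  qed (use assms in auto)
qed

lemma L2c_mult:
  assumes "L2c w" "g \<in> borel_measurable borel" "\<And>x. norm (g x) \<le> B"
  shows "L2c (\<lambda>x. g x * w x)" "L2sq (\<lambda>x. g x * w x) \<le> B\<^sup>2 * L2sq w"
proof -
  have B: "(norm (g x * w x))\<^sup>2 \<le> B\<^sup>2 * (norm (w x))\<^sup>2" for x
    unfolding norm_mult power_mult_distrib using assms(3)[of x] by (intro mult_right_mono power_mono) auto
  have i: "integrable lborel (\<lambda>x. B\<^sup>2 * (norm (w x))\<^sup>2)" using assms by auto
  have i2: "integrable lborel (\<lambda>x. (norm (g x * w x))\<^sup>2)"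
    using assms(1,2) B by (intro Bochner_Integration.integrable_bound[OF i]) (auto simp: L2c_def)
  have "bounded {x. g x * w x \<noteq> 0}"
    by (rule bounded_subset[OF L2cD(3)[OF assms(1)]]) auto
  then show "L2c (\<lambda>x. g x * w x)"
    using i2 assms(1,2) by (auto simp: L2c_def)
  have "L2sq (\<lambda>x. g x * w x) \<le> (\<integral>x. B\<^sup>2 * (norm (w x))\<^sup>2 \<partial>lborel)"
    unfolding L2sq_def using i i2 B by (intro integral_mono)
  then show "L2sq (\<lambda>x. g x * w x) \<le> B\<^sup>2 * L2sq w" by (simp add: L2sq_def)
qed

lemma L2c_cmult: "L2c w \<Longrightarrow> L2c (\<lambda>x. c * w x)"
  by (rule L2c_mult(1)[where B="norm c"]) auto

lemma L2sq_cmult: "L2sq (\<lambda>x. c * w x) = (norm c)\<^sup>2 * L2sq w"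
  by (simp add: L2sq_def norm_mult power_mult_distrib)

lemma L2c_zero [simp]: "L2c (\<lambda>x. 0)"
  by (simp add: L2c_def)

lemma L2c_add:
  assumes "L2c f" "L2c g"
  shows "L2c (\<lambda>x. f x + g x)" "L2sq (\<lambda>x. f x + g x) \<le> 2 * L2sq f + 2 * L2sq g"
proof -
  have i: "integrable lborel (\<lambda>x. 2 * (norm (f x))\<^sup>2 + 2 * (norm (g x))\<^sup>2)"
    by (intro Bochner_Integration.integrable_add integrable_mult_right L2cD(2) assms)
  have i2: "integrable lborel (\<lambda>x. (norm (f x + g x))\<^sup>2)"
    using assms norm_add_sq_le by (intro Bochner_Integration.integrable_bound[OF i]) (auto simp: L2c_def)
  have "bounded {x. f x + g x \<noteq> 0}"
    by (rule bounded_subset[of "{x. f x \<noteq> 0} \<union> {x. g x \<noteq> 0}"]) (use assms in auto)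
  then show "L2c (\<lambda>x. f x + g x)" using i2 assms by (auto simp: L2c_def)
  have "L2sq (\<lambda>x. f x + g x) \<le> (\<integral>x. 2 * (norm (f x))\<^sup>2 + 2 * (norm (g x))\<^sup>2 \<partial>lborel)"
    unfolding L2sq_def using i i2 norm_add_sq_le by (intro integral_mono)
  also have "\<dots> = 2 * L2sq f + 2 * L2sq g"
    unfolding L2sq_def using L2cD(2)[OF assms(1)] L2cD(2)[OF assms(2)] by simp
  finally show "L2sq (\<lambda>x. f x + g x) \<le> 2 * L2sq f + 2 * L2sq g" .
qed

lemma L2c_diff:
  assumes "L2c f" "L2c g"
  shows "L2c (\<lambda>x. f x - g x)" "L2sq (\<lambda>x. f x - g x) \<le> 2 * L2sq f + 2 * L2sq g"
  using L2c_add[OF assms(1) L2c_cmult[OF assms(2), of "-1"]] L2sq_cmult[of "-1" g] by auto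

lemma L2c_bounded_support:
  fixes f :: "real^'n::finite \<Rightarrow> complex"
  assumes "f \<in> borel_measurable borel" "\<And>x. norm (f x) \<le> B" "{x. f x \<noteq> 0} \<subseteq> cball 0 R"
  shows "L2c f" "L2sq f \<le> B\<^sup>2 * measure lborel (cball (0::real^'n) R)"
proof -
  have i: "integrable lborel (\<lambda>x. B\<^sup>2 * indicator (cball (0::real^'n) R) x)"
    by (intro integrable_mult_right integrable_lborel_indicator_bounded) auto
  have le: "(norm (f x))\<^sup>2 \<le> B\<^sup>2 * indicator (cball 0 R) x" for x
    using assms(2)[of x] assms(3) by (cases "f x = 0") (auto simp: indicator_def intro!: power_mono)
  have i2: "integrable lborel (\<lambda>x. (norm (f x))\<^sup>2)"
    by (rule Bochner_Integration.integrable_bound[OF i]) (use assms(1) le in auto)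
  show "L2c f" unfolding L2c_def using assms i2 bounded_subset bounded_cball by blast
  have "L2sq f \<le> (\<integral>x. B\<^sup>2 * indicator (cball (0::real^'n) R) x \<partial>lborel)"
    unfolding L2sq_def using i i2 le by (intro integral_mono)
  then show "L2sq f \<le> B\<^sup>2 * measure lborel (cball (0::real^'n) R)" by simp
qed

lemma tf_L2c: assumes "tf f" shows "L2c f"
proof -
  obtain B where "\<And>x. norm (f x) \<le> B" using tf_bounded[OF assms] by metis
  moreover obtain R where "{x. f x \<noteq> 0} \<subseteq> cball 0 R"
    using tf_support[OF assms] by metis
  ultimately show ?thesis using L2c_bounded_support(1) tf_measurable[OF assms] by blast
qed

lemma tf_integrable: "tf f \<Longrightarrow> integrable lborel f"
  using tf_L2c L2c_integrable by blast

subsection \<open>Convolution\<close>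

definition conv :: "(real^'n::finite \<Rightarrow> complex) \<Rightarrow> (real^'n \<Rightarrow> complex) \<Rightarrow> real^'n \<Rightarrow> complex" where
  "conv k w x = (\<integral>y. k (x - y) * w y \<partial>lborel)"

lemma conv_integrable:
  assumes "tf k" "L2c w" shows "integrable lborel (\<lambda>y. k (x - y) * w y)"
proof -
  obtain B where "\<And>x. norm (k x) \<le> B" using tf_bounded[OF assms(1)] by metis
  moreover have "(\<lambda>y. k (x - y)) \<in> borel_measurable borel"
    using tf_measurable[OF assms(1)] by measurable
  ultimately show ?thesis using L2c_integrable[OF L2c_mult(1)[OF assms(2)]] by blast
qed

lemma conv_has_derivative:
  assumes k: "tf k" and w: "L2c w"
  shows "(conv k w has_derivative (\<lambda>h. \<Sum>i\<in>UNIV. h $ i *\<^sub>R conv (partial i k) w x)) (at x)"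
proof -
  obtain L where L: "L > 0" "\<And>x h. norm (frechet_derivative k (at x) h) \<le> L * norm h"
    using tf_frechet_bound[OF k] by metis
  have ik: "integrable lborel (\<lambda>y. partial i k (x - y) * w y)" for i x
    using conv_integrable[OF test_fun_partial[OF k] w] .
  have fs: "frechet_derivative k (at (x - y)) h * w y = (\<Sum>i\<in>UNIV. h $ i *\<^sub>R (partial i k (x - y) * w y))" for x y h
    unfolding frechet_partial_sum[OF tf_has_derivative[OF k]] by (simp add: sum_distrib_right)
  have "((\<lambda>x. \<integral>y. k (x - y) * w y \<partial>lborel) has_derivative
      (\<lambda>h. \<integral>y. frechet_derivative k (at (x - y)) h * w y \<partial>lborel)) (at x)"
  proof (rule has_derivative_integral[where g="\<lambda>y. L * norm (w y)"])
    fix x y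
    have "((\<lambda>x. k (-y + 1 *\<^sub>R x)) has_derivative (\<lambda>h. 1 *\<^sub>R frechet_derivative k (at (x - y)) h)) (at x)"
      using tf_has_derivative[OF k, of "-y + 1 *\<^sub>R x"] by (intro has_derivative_affine_comp) simp
    then show "((\<lambda>x. k (x - y) * w y) has_derivative (\<lambda>h. frechet_derivative k (at (x - y)) h * w y)) (at x)"
      by (intro has_derivative_mult_left) simp
    fix h
    show "norm (frechet_derivative k (at (x - y)) h * w y) \<le> L * norm (w y) * norm h"
      using mult_right_mono[OF L(2)[of "x - y" h], of "norm (w y)"] by (simp add: norm_mult mult_ac)
    show "(\<lambda>y. frechet_derivative k (at (x - y)) h * w y) \<in> borel_measurable lborel"
      unfolding fs by (intro borel_measurable_integrable Bochner_Integration.integrable_sum integrable_scaleR_right ik)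
  qed (use conv_integrable[OF k w] L2c_integrable[OF w] in auto)
  then show ?thesis
    unfolding fs by (subst (asm) Bochner_Integration.integral_sum) (auto simp: ik conv_def[abs_def])
qed

lemma partial_conv:
  assumes "tf k" "L2c w"
  shows "partial i (conv k w) = conv (partial i k) w"
proof
  fix x
  have "partial i (conv k w) x = (\<Sum>j\<in>UNIV. axis i 1 $ j *\<^sub>R conv (partial j k) w x)"
    by (rule partialI[OF conv_has_derivative[OF assms]])
  also have "\<dots> = (\<Sum>j\<in>UNIV. if j = i then conv (partial j k) w x else 0)"
    by (intro sum.cong) (auto simp: axis_def)
  finally show "partial i (conv k w) x = conv (partial i k) w x" by simp
qed

lemma Ck_conv: "tf k \<Longrightarrow> L2c w \<Longrightarrow> Ck m UNIV (conv k w)"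
proof (induction m arbitrary: k)
  case 0
  then show ?case
    by (auto intro!: continuous_at_imp_continuous_on has_derivative_continuous[OF conv_has_derivative])
next
  case (Suc m)
  have "Ck m UNIV (\<lambda>x. frechet_derivative (conv k w) (at x) v)" if v: "v \<in> Basis" for v
  proof -
    obtain i where "v = axis i 1" using v by (auto simp: Basis_vec_real)
    then have "(\<lambda>x. frechet_derivative (conv k w) (at x) v) = conv (partial i k) w"
      using partial_conv[OF Suc.prems, of i] by (simp add: partial_def[abs_def])
    then show ?thesis using Suc.IH[OF test_fun_partial[OF Suc.prems(1)] Suc.prems(2)] by simp
  qed
  moreover have "conv k w differentiable at x" for x
    by (rule differentiableI[OF conv_has_derivative[OF Suc.prems]])
  ultimately show ?case by simp
qed

lemma conv_support:
  assumes "conv k w x \<noteq> 0" shows "\<exists>y. k (x - y) \<noteq> 0 \<and> w y \<noteq> 0"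
proof (rule ccontr)
  assume "\<not> ?thesis"
  then have "(\<lambda>y. k (x - y) * w y) = (\<lambda>y. 0)" by auto
  then show False using assms by (simp add: conv_def)
qed

lemma tf_conv:
  assumes "tf k" "L2c w" shows "tf (conv k w)"
proof -
  obtain R1 where R1: "{x. k x \<noteq> 0} \<subseteq> cball 0 R1" using tf_support[OF assms(1)] by metis
  obtain R2 where R2: "{x. w x \<noteq> 0} \<subseteq> cball 0 R2" using L2c_support[OF assms(2)] by metis
  have "{x. conv k w x \<noteq> 0} \<subseteq> cball 0 (R1 + R2)"
  proof
    fix x assume "x \<in> {x. conv k w x \<noteq> 0}"
    then obtain y where "k (x - y) \<noteq> 0" "w y \<noteq> 0" using conv_support by blast
    then have "norm (x - y) \<le> R1" "norm y \<le> R2" using R1 R2 by auto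
    then show "x \<in> cball 0 (R1 + R2)" using norm_triangle_ineq[of "x - y" y] by simp
  qed
  then show ?thesis
    unfolding tf_iff smooth_on_def using Ck_conv[OF assms] bounded_subset bounded_cball by blast
qed

lemma conv_commute:
  assumes "tf k" "tf w" shows "conv k w = conv w k"
proof
  fix x
  have [measurable]: "k \<in> borel_measurable borel" "w \<in> borel_measurable borel"
    using assms tf_measurable by auto
  have "conv w k x = (\<integral>y. (\<lambda>y. k y * w (x - y)) (x - y) \<partial>lborel)"
    unfolding conv_def by (subst integral_lborel_reflect) (auto simp: mult.commute)
  then show "conv k w x = conv w k x" by (simp add: conv_def)
qed

lemma partial_conv_right:
  assumes "tf k" "tf w"
  shows "partial i (conv k w) = conv k (partial i w)"
  using assms by (simp add: conv_commute[of k] partial_conv tf_L2c test_fun_partial)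

lemma conv_add: "tf k \<Longrightarrow> L2c v \<Longrightarrow> L2c w \<Longrightarrow> conv k (\<lambda>x. v x + w x) x = conv k v x + conv k w x"
  using conv_integrable[of k v x] conv_integrable[of k w x] by (simp add: conv_def distrib_left)

lemma conv_diff: "tf k \<Longrightarrow> L2c v \<Longrightarrow> L2c w \<Longrightarrow> conv k (\<lambda>x. v x - w x) x = conv k v x - conv k w x"
  using conv_integrable[of k v x] conv_integrable[of k w x] by (simp add: conv_def right_diff_distrib)

text \<open>Schur's test: write the kernel as a product of two square roots, apply Cauchy-Schwarz
  and then Fubini. The function \<open>v\<close> is only dominated by a convolution, not equal to
  one, so that the lemma also covers commutators.\<close>

lemma schur_bound:
  fixes w v :: "real^'n::finite \<Rightarrow> complex"
  assumes [measurable]: "\<kappa> \<in> borel_measurable borel" and \<kappa>0: "\<And>z. 0 \<le> \<kappa> z"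
    and A: "(\<integral>\<^sup>+z. ennreal (\<kappa> z) \<partial>lborel) \<le> ennreal A" "A \<ge> 0"
    and w: "L2c w" and [measurable]: "v \<in> borel_measurable borel"
    and le: "\<And>x. ennreal (norm (v x)) \<le> (\<integral>\<^sup>+y. ennreal (\<kappa> (x - y) * norm (w y)) \<partial>lborel)"
  shows "integrable lborel (\<lambda>x. (norm (v x))\<^sup>2)" "L2sq v \<le> A\<^sup>2 * L2sq w"
proof -
  have [measurable]: "w \<in> borel_measurable borel" using w by auto
  have A': "(\<integral>\<^sup>+y. ennreal (\<kappa> (x - y)) \<partial>lborel) \<le> ennreal A"
    "(\<integral>\<^sup>+x. ennreal (\<kappa> (x - y)) \<partial>lborel) \<le> ennreal A" for x y
    using A nn_integral_lborel_affine[of "\<lambda>z. ennreal (\<kappa> z)" "-1" x] nn_integral_lborel_affine[of "\<lambda>z. ennreal (\<kappa> z)" 1 "-y"]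
    by simp_all
  have pt: "ennreal ((norm (v x))\<^sup>2) \<le> ennreal A * (\<integral>\<^sup>+y. ennreal (\<kappa> (x - y)) * ennreal ((norm (w y))\<^sup>2) \<partial>lborel)" for x
  proof -
    have "ennreal ((norm (v x))\<^sup>2) = (ennreal (norm (v x)))\<^sup>2" by (simp add: ennreal_power)
    also have "\<dots> \<le> (\<integral>\<^sup>+y. ennreal (\<kappa> (x - y) * norm (w y)) \<partial>lborel)\<^sup>2"
      by (intro power_mono le) auto
    also have "\<dots> = (\<integral>\<^sup>+y. ennreal (sqrt (\<kappa> (x - y))) * ennreal (sqrt (\<kappa> (x - y)) * norm (w y)) \<partial>lborel)\<^sup>2"
      using \<kappa>0 by (simp add: ennreal_mult''[symmetric] mult.assoc[symmetric])
    also have "\<dots> \<le> (\<integral>\<^sup>+y. (ennreal (sqrt (\<kappa> (x - y))))\<^sup>2 \<partial>lborel) * (\<integral>\<^sup>+y. (ennreal (sqrt (\<kappa> (x - y)) * norm (w y)))\<^sup>2 \<partial>lborel)"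
      by (rule Cauchy_Schwarz_nn_integral) auto
    also have "\<dots> = (\<integral>\<^sup>+y. ennreal (\<kappa> (x - y)) \<partial>lborel) * (\<integral>\<^sup>+y. ennreal (\<kappa> (x - y)) * ennreal ((norm (w y))\<^sup>2) \<partial>lborel)"
      using \<kappa>0 by (simp add: ennreal_power ennreal_mult'' power_mult_distrib)
    also have "\<dots> \<le> ennreal A * (\<integral>\<^sup>+y. ennreal (\<kappa> (x - y)) * ennreal ((norm (w y))\<^sup>2) \<partial>lborel)"
      by (intro mult_right_mono A') auto
    finally show ?thesis .
  qed
  have "(\<integral>\<^sup>+x. ennreal ((norm (v x))\<^sup>2) \<partial>lborel)
      \<le> (\<integral>\<^sup>+x. ennreal A * (\<integral>\<^sup>+y. ennreal (\<kappa> (x - y)) * ennreal ((norm (w y))\<^sup>2) \<partial>lborel) \<partial>lborel)"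
    by (intro nn_integral_mono pt)
  also have "\<dots> = ennreal A * (\<integral>\<^sup>+x. (\<integral>\<^sup>+y. ennreal (\<kappa> (x - y)) * ennreal ((norm (w y))\<^sup>2) \<partial>lborel) \<partial>lborel)"
    by (intro nn_integral_cmult) measurable
  also have "(\<integral>\<^sup>+x. (\<integral>\<^sup>+y. ennreal (\<kappa> (x - y)) * ennreal ((norm (w y))\<^sup>2) \<partial>lborel) \<partial>lborel)
     = (\<integral>\<^sup>+y. (\<integral>\<^sup>+x. ennreal (\<kappa> (x - y)) * ennreal ((norm (w y))\<^sup>2) \<partial>lborel) \<partial>lborel)"
    by (rule lborel_pair.Fubini'[symmetric]) measurable
  also have "\<dots> = (\<integral>\<^sup>+y. (\<integral>\<^sup>+x. ennreal (\<kappa> (x - y)) \<partial>lborel) * ennreal ((norm (w y))\<^sup>2) \<partial>lborel)"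
    by (intro nn_integral_cong nn_integral_multc) measurable
  also have "\<dots> \<le> (\<integral>\<^sup>+y. ennreal A * ennreal ((norm (w y))\<^sup>2) \<partial>lborel)"
    by (intro nn_integral_mono mult_right_mono A') auto
  also have "\<dots> = ennreal A * ennreal (L2sq w)"
    using w by (subst nn_integral_cmult) (auto simp: L2sq_def nn_integral_eq_integral)
  finally have *: "(\<integral>\<^sup>+x. ennreal ((norm (v x))\<^sup>2) \<partial>lborel) \<le> ennreal (A\<^sup>2 * L2sq w)"
    using A(2) by (simp add: mult_left_mono ennreal_mult[symmetric] power2_eq_square mult.assoc)
  then show i: "integrable lborel (\<lambda>x. (norm (v x))\<^sup>2)"
    by (intro integrableI_bounded) (auto intro: order.strict_trans1)
  then show "L2sq v \<le> A\<^sup>2 * L2sq w"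
    using * by (simp add: nn_integral_eq_integral L2sq_def)
qed

lemma L2sq_conv:
  assumes k: "tf k" and w: "L2c w"
  shows "L2sq (conv k w) \<le> (\<integral>z. norm (k z) \<partial>lborel)\<^sup>2 * L2sq w"
proof (rule schur_bound(2)[where \<kappa>="\<lambda>z. norm (k z)", OF _ _ _ _ w])
  show "(\<lambda>z. norm (k z)) \<in> borel_measurable borel" "conv k w \<in> borel_measurable borel"
    using tf_measurable[OF k] tf_measurable[OF tf_conv[OF k w]] by measurable
  show "(\<integral>\<^sup>+z. ennreal (norm (k z)) \<partial>lborel) \<le> ennreal (\<integral>z. norm (k z) \<partial>lborel)"
    using tf_integrable[OF k] by (simp add: nn_integral_eq_integral)
  show "ennreal (norm (conv k w x)) \<le> (\<integral>\<^sup>+y. ennreal (norm (k (x - y)) * norm (w y)) \<partial>lborel)" for x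
    unfolding conv_def using integral_norm_bound_ennreal[OF conv_integrable[OF k w]] by (simp add: norm_mult)
qed auto

subsection \<open>Integration by parts\<close>

text \<open>Convolving \<open>f\<close> with the indicator \<open>w\<close> of a large ball gives a
  function that is constantly the integral of \<open>f\<close> near 0; its derivative at 0 vanishes
  and equals the convolution of \<open>partial i f\<close> with \<open>w\<close>.\<close>

lemma integral_partial_eq_0:
  assumes f: "tf f" shows "(\<integral>x. partial i f x \<partial>lborel) = 0"
proof -
  obtain R where R: "{x. f x \<noteq> 0} \<subseteq> cball 0 R" using tf_support[OF f] by metis
  \<comment> \<open>The margin 1 in the radius keeps the whole support of \<open>f\<close> visible
    from every centre in the unit ball.\<close>
  define w :: "real^'a \<Rightarrow> complex" where "w = (\<lambda>x. of_real (indicator (cball 0 (R + 1)) x))"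
  have w: "L2c w" unfolding w_def
    by (rule L2c_bounded_support(1)[where B=1 and R="R + 1"], measurable) (auto simp: indicator_def)
  have c: "conv f w x = (\<integral>y. f y \<partial>lborel)" if "x \<in> ball 0 1" for x
  proof -
    have "f (x - y) * w y = f (x - y)" for y
    proof (cases "f (x - y) = 0")
      case False
      then have "norm (x - y) \<le> R" using R by auto
      then have "norm y \<le> R + 1" using that norm_triangle_ineq4[of x "x - y"] by simp
      then show ?thesis by (simp add: w_def)
    qed simp
    note eq = this
    show ?thesis unfolding conv_def eq by (rule integral_lborel_reflect[OF tf_measurable[OF f]])
  qed
  have p0: "partial i f (0 - y) * w y = partial i f (0 - y)" for y
  proof (cases "partial i f (0 - y) = 0")
    case False
    then have "0 - y \<in> closure {x. f x \<noteq> 0}" using support_partial by blast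
    then have "0 - y \<in> cball 0 R" using closure_minimal[OF R] by blast
    then show ?thesis by (simp add: w_def)
  qed simp
  have "partial i (conv f w) 0 = partial i (\<lambda>x. \<integral>y. f y \<partial>lborel) 0"
    by (rule partial_cong_open[of "ball 0 1"]) (auto simp: c)
  then have "conv (partial i f) w 0 = 0" using partial_conv[OF f w] by simp
  then have "(\<integral>y. partial i f (0 - y) \<partial>lborel) = 0" unfolding conv_def p0 .
  then show ?thesis
    using integral_lborel_reflect[OF tf_measurable[OF test_fun_partial[OF f]]] by metis
qed

lemma partial_mult_tf:
  "tf f \<Longrightarrow> tf g \<Longrightarrow> partial i (\<lambda>x. f x * g x) = (\<lambda>x. partial i f x * g x + f x * partial i g x)"
  by (rule ext, rule partial_mult) (auto intro: tf_differentiable)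

lemma partial_add_tf:
  "tf f \<Longrightarrow> tf g \<Longrightarrow> partial i (\<lambda>x. f x + g x) = (\<lambda>x. partial i f x + partial i g x)"
  by (rule ext, rule partial_add) (auto intro: tf_differentiable)

lemma partial_diff_tf:
  "tf f \<Longrightarrow> tf g \<Longrightarrow> partial i (\<lambda>x. f x - g x) = (\<lambda>x. partial i f x - partial i g x)"
  by (rule ext, rule partial_diff) (auto intro: tf_differentiable)

lemma partial_cmult_tf:
  "tf f \<Longrightarrow> partial i (\<lambda>x. c * f x) = (\<lambda>x. c * partial i f x)"
  by (rule ext, subst partial_mult) (auto intro: tf_differentiable)

lemma partial_sum_tf:
  "(\<And>j. j \<in> I \<Longrightarrow> tf (f j)) \<Longrightarrow> partial i (\<lambda>x. \<Sum>j\<in>I. f j x) = (\<lambda>x. \<Sum>j\<in>I. partial i (f j) x)"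
  by (rule ext, rule partial_sum) (auto intro: tf_differentiable)

lemma integral_by_parts:
  assumes f: "tf f" and g: "tf g"
  shows "(\<integral>x. partial i f x * g x \<partial>lborel) = - (\<integral>x. f x * partial i g x \<partial>lborel)"
proof -
  have 1: "integrable lborel (\<lambda>x. partial i f x * g x)" "integrable lborel (\<lambda>x. f x * partial i g x)"
    using f g by (auto intro!: tf_integrable test_fun_mult[where \<Omega>'=UNIV] test_fun_partial)
  have "(\<integral>x. partial i f x * g x + f x * partial i g x \<partial>lborel) = 0"
    using integral_partial_eq_0[OF test_fun_mult[OF f g], of i] by (simp add: partial_mult_tf[OF f g])
  then show ?thesis using 1 by (simp add: eq_neg_iff_add_eq_0)
qed

subsection \<open>The standard mollifier\<close>

definition bump_mass :: "'n::finite itself \<Rightarrow> real" where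
  "bump_mass _ = (\<integral>x. Re (bump (x::real^'n)) \<partial>lborel)"

definition moll :: "real \<Rightarrow> real^'n::finite \<Rightarrow> complex" where
  "moll e z = of_real (1 / (e ^ CARD('n) * bump_mass TYPE('n))) * bump ((1/e) *\<^sub>R z)"

lemma bump_real: "bump x = of_real (Re (bump x))" and bump_nonneg: "0 \<le> Re (bump x)"
  by (auto simp: bump_def eta_def)

lemma bump_mass_pos: "bump_mass TYPE('n::finite) > 0"
proof -
  have i: "integrable lborel (\<lambda>x::real^'n. Re (bump x))"
    using tf_integrable[OF tf_bump] by (rule integrable_Re)
  have "bump_mass TYPE('n) \<noteq> 0"
  proof
    assume "bump_mass TYPE('n) = 0"
    then have "AE x::real^'n in lborel. Re (bump x) = 0"
      unfolding bump_mass_def using integral_nonneg_eq_0_iff_AE[OF i] bump_nonneg by auto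
    moreover have "{x::real^'n. Re (bump x) \<noteq> 0} = ball 0 1"
    proof -
      have "Re (bump x) \<noteq> 0 \<longleftrightarrow> norm x < 1" for x :: "real^'n"
        using bump_support[of x] by (simp add: bump_def)
      note eq = this
      show ?thesis by (rule set_eqI) (simp only: mem_Collect_eq eq mem_ball_0)
    qed
    ultimately have "ball (0::real^'n) 1 \<in> null_sets lborel"
    proof -
      assume ae: "AE x::real^'n in lborel. Re (bump x) = 0" and eq: "{x::real^'n. Re (bump x) \<noteq> 0} = ball 0 1"
      have [measurable]: "bump \<in> borel_measurable (borel :: (real^'n) measure)" by (rule tf_measurable[OF tf_bump])
      have "{x \<in> space lborel. \<not> Re (bump (x::real^'n)) = 0} \<in> sets lborel" by measurable
      from AE_iff_null[OF this] ae show ?thesis by (simp add: eq)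
    qed
    then have "negligible (ball (0::real^'n) 1)"
      by (simp add: negligible_iff_null_sets null_sets_completionI)
    then show False using open_not_negligible[of "ball (0::real^'n) 1"] by simp
  qed
  moreover have "bump_mass TYPE('n) \<ge> 0"
    unfolding bump_mass_def using bump_nonneg by (intro integral_nonneg_AE) auto
  ultimately show ?thesis by simp
qed

lemma tf_moll: "e > 0 \<Longrightarrow> tf (moll e :: real^'n::finite \<Rightarrow> complex)"
  using test_fun_const_mult[OF tf_affine[OF tf_bump, of "1/e" 0],
      of "of_real (1 / (e ^ CARD('n) * bump_mass TYPE('n)))"]
  unfolding moll_def[abs_def] by (simp only: add_0) simp

lemma moll_support: "e > 0 \<Longrightarrow> moll e z \<noteq> 0 \<Longrightarrow> norm z < e"
  by (auto simp: moll_def bump_support)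

lemma moll_real_nonneg:
  fixes z :: "real^'n::finite"
  assumes "e > 0" shows "moll e z = of_real (norm (moll e z))"
proof -
  define r where "r = 1 / (e ^ CARD('n) * bump_mass TYPE('n)) * Re (bump ((1/e) *\<^sub>R z))"
  have "moll e z = of_real r"
    unfolding moll_def r_def of_real_mult bump_real[symmetric] ..
  moreover have "0 \<le> r"
    unfolding r_def using assms bump_mass_pos[where 'n='n] bump_nonneg by (intro mult_nonneg_nonneg) auto
  ultimately show ?thesis by simp
qed

lemma integral_moll:
  assumes e: "e > 0" shows "(\<integral>z. moll e (z::real^'n::finite) \<partial>lborel) = 1"
proof -
  have "(\<integral>z. bump (z::real^'n) \<partial>lborel) = (\<integral>z. of_real (Re (bump (z::real^'n))) \<partial>lborel)"
    by (rule Bochner_Integration.integral_cong) (auto simp: bump_real[symmetric])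
  also have "\<dots> = of_real (bump_mass TYPE('n))"
    unfolding bump_mass_def by (rule integral_of_real[OF integrable_Re[OF tf_integrable[OF tf_bump]]])
  finally have "(\<integral>z. bump (z::real^'n) \<partial>lborel) = of_real (bump_mass TYPE('n))" .
  moreover have "(\<integral>z. bump (z::real^'n) \<partial>lborel) = (1/e) ^ CARD('n) *\<^sub>R (\<integral>z. bump ((1/e) *\<^sub>R (z::real^'n)) \<partial>lborel)"
    using integral_lborel_affine[OF tf_measurable[OF tf_bump], of "1/e" 0] e by simp
  ultimately have "(\<integral>z. bump ((1/e) *\<^sub>R (z::real^'n)) \<partial>lborel) = of_real (e ^ CARD('n) * bump_mass TYPE('n))"
    using e by (simp add: scaleR_conv_of_real field_simps power_divide)
  then show ?thesis
    unfolding moll_def[abs_def] using e bump_mass_pos[where 'n='n] by simp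
qed

lemma integral_norm_moll:
  assumes e: "e > 0" shows "(\<integral>z. norm (moll e (z::real^'n::finite)) \<partial>lborel) = 1"
proof -
  have "complex_of_real (\<integral>z. norm (moll e (z::real^'n)) \<partial>lborel) = (\<integral>z. complex_of_real (norm (moll e (z::real^'n))) \<partial>lborel)"
    by (rule integral_of_real[OF integrable_norm[OF tf_integrable[OF tf_moll[OF e]]], symmetric])
  also have "\<dots> = (\<integral>z. moll e (z::real^'n) \<partial>lborel)"
    by (rule Bochner_Integration.integral_cong) (simp_all only: moll_real_nonneg[OF e, symmetric])
  finally have "complex_of_real (\<integral>z. norm (moll e (z::real^'n)) \<partial>lborel) = (\<integral>z. moll e (z::real^'n) \<partial>lborel)" .
  then show ?thesis using integral_moll[OF e, where 'n='n] by (metis of_real_eq_1_iff)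
qed

lemma moll_scale: "e > 0 \<Longrightarrow> moll e (z::real^'n::finite) = of_real ((1/e) ^ CARD('n)) * moll 1 (0 + (1/e) *\<^sub>R z)"
  by (simp add: moll_def power_divide)

lemma partial_moll:
  assumes e: "e > 0"
  shows "partial i (moll e) (z::real^'n::finite) = of_real ((1/e) ^ CARD('n) * (1/e)) * partial i (moll 1) ((1/e) *\<^sub>R z)"
proof -
  have "moll e = (\<lambda>z::real^'n. of_real ((1/e) ^ CARD('n)) * moll 1 (0 + (1/e) *\<^sub>R z))"
    using moll_scale[OF e] by (rule ext)
  then have "partial i (moll e) z = partial i (\<lambda>z. of_real ((1/e) ^ CARD('n)) * moll 1 (0 + (1/e) *\<^sub>R z)) z"
    by simp
  also have "\<dots> = of_real ((1/e) ^ CARD('n)) * partial i (\<lambda>z. moll 1 (0 + (1/e) *\<^sub>R z)) z"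
    by (rule fun_cong[OF partial_cmult_tf[OF tf_affine[OF tf_moll]]]) (use e in auto)
  also have "\<dots> = of_real ((1/e) ^ CARD('n)) * ((1/e) *\<^sub>R partial i (moll 1) (0 + (1/e) *\<^sub>R z))"
    by (subst partial_affine[OF tf_moll]) auto
  finally show ?thesis by (simp add: scaleR_conv_of_real[of _ "_::complex"])
qed

lemma integrable_norm_times_tf:
  assumes "tf f" shows "integrable lborel (\<lambda>z. norm z * norm (f z))"
proof -
  obtain R where R: "R > 0" "{x. f x \<noteq> 0} \<subseteq> cball 0 R" using tf_support[OF assms] by metis
  have [measurable]: "f \<in> borel_measurable borel" using tf_measurable[OF assms] .
  show ?thesis
  proof (rule Bochner_Integration.integrable_bound[where f="\<lambda>z. R * norm (f z)"])
    show "integrable lborel (\<lambda>z. R * norm (f z))" using tf_integrable[OF assms] by simp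
    show "AE z in lborel. norm (norm z * norm (f z)) \<le> norm (R * norm (f z))"
    proof (rule AE_I2)
      fix z show "norm (norm z * norm (f z)) \<le> norm (R * norm (f z))"
        using R by (cases "f z = 0") (auto simp: abs_mult intro!: mult_right_mono)
    qed
  qed measurable
qed

text \<open>The weight \<open>norm z\<close> compensates the factor 1/e produced by the derivative.
  This scale invariance is what makes the Friedrichs estimates uniform in the mollification
  width.\<close>

lemma integral_norm_partial_moll:
  assumes e: "e > 0"
  shows "(\<integral>z. norm z * norm (partial i (moll e) (z::real^'n::finite)) \<partial>lborel)
       = (\<integral>z. norm z * norm (partial i (moll 1) (z::real^'n)) \<partial>lborel)"
proof -
  have [measurable]: "partial i (moll 1) \<in> borel_measurable (borel :: (real^'n) measure)"
    by (rule tf_measurable[OF test_fun_partial[OF tf_moll]]) simp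
  have "norm z * norm (partial i (moll e) z)
     = (1/e) ^ CARD('n) *\<^sub>R (norm (0 + (1/e) *\<^sub>R z) * norm (partial i (moll 1) (0 + (1/e) *\<^sub>R z)))" for z :: "real^'n"
    using e by (subst partial_moll[OF e]) (simp add: norm_mult norm_divide norm_power power_divide)
  then show ?thesis
    using integral_lborel_affine[of "\<lambda>z. norm z * norm (partial i (moll 1) (z::real^'n))" "1/e" 0] e
    by simp
qed

subsection \<open>Mollification converges in the mean\<close>

lemma moll_continuous:
  fixes g :: "real^'n::finite \<Rightarrow> complex"
  assumes g: "continuous_on UNIV g" and R: "{x. g x \<noteq> 0} \<subseteq> cball 0 R" and \<eta>: "\<eta> > 0"
  shows "\<exists>\<delta>>0. \<forall>e. 0 < e \<longrightarrow> e < \<delta> \<longrightarrow> L2sq (\<lambda>x. conv (moll e) g x - g x) \<le> \<eta>"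
proof -
  have "bounded (g ` cball 0 R)"
    by (intro compact_imp_bounded compact_continuous_image continuous_on_subset[OF g]) auto
  then obtain B where B: "B > 0" "\<And>x. x \<in> cball 0 R \<Longrightarrow> norm (g x) \<le> B" unfolding bounded_pos by auto
  have gB: "norm (g x) \<le> B" for x using B R by (cases "g x = 0") auto
  have gm: "g \<in> borel_measurable borel" by (rule borel_measurable_continuous_onI[OF g])
  have gL: "L2c g" by (rule L2c_bounded_support(1)[OF gm gB R])
  define V where "V = measure lborel (cball (0::real^'n) (R + 1))"
  \<comment> \<open>The pointwise error \<open>q\<close> is chosen so that, squared and integrated
    over a ball of volume \<open>V\<close> containing all supports, it stays below
    \<open>\<eta>\<close>.\<close>
  define q where "q = sqrt (\<eta> / (V + 1))"
  have V: "V \<ge> 0" by (simp add: V_def)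
  have q: "q > 0" "q\<^sup>2 * V \<le> \<eta>"
    using V \<eta> by (auto simp: q_def field_simps)
  have "uniformly_continuous_on (cball 0 (R + 2)) g"
    by (intro compact_uniformly_continuous continuous_on_subset[OF g]) auto
  then obtain d where d: "d > 0" "\<And>x y. x \<in> cball 0 (R+2) \<Longrightarrow> y \<in> cball 0 (R+2) \<Longrightarrow> dist y x < d \<Longrightarrow> dist (g y) (g x) < q"
    unfolding uniformly_continuous_on_def using q(1) by metis
  show ?thesis
  proof (intro exI[of _ "min d 1"] conjI allI impI)
    fix e :: real assume e: "0 < e" "e < min d 1"
    have tm: "tf (moll e :: real^'n \<Rightarrow> complex)" using tf_moll e(1) .
    let ?h = "\<lambda>x. conv (moll e) g x - g x"
    have near: "norm (g y - g x) \<le> q" if "norm (x - y) < e" for x y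
    proof (cases "norm x \<le> R + 1")
      case True
      then have "norm y \<le> R + 2" using that e norm_triangle_ineq4[of x "x - y"] by simp
      then show ?thesis using d(2)[of x y] True that e by (auto simp: dist_norm norm_minus_commute less_imp_le)
    next
      case False
      then have "\<not> norm y \<le> R" using that e norm_triangle_ineq[of y "x - y"] by simp
      then have "g y = 0" "g x = 0" using R False by auto
      then show ?thesis using q by simp
    qed
    have le: "norm (?h x) \<le> q" for x
    proof -
      have i1: "integrable lborel (\<lambda>y. moll e (x - y))"
        using integrable_lborel_affine[OF tf_integrable[OF tm], of "-1" x] by simp
      have "(\<integral>y. moll e (x - y) * g x \<partial>lborel) = g x"
        using integral_moll[OF e(1), where 'n='n] integral_lborel_reflect[OF tf_measurable[OF tm]] by simp
      then have "?h x = (\<integral>y. moll e (x - y) * g y \<partial>lborel) - (\<integral>y. moll e (x - y) * g x \<partial>lborel)"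
        by (simp add: conv_def)
      also have "\<dots> = (\<integral>y. moll e (x - y) * (g y - g x) \<partial>lborel)"
        using i1 conv_integrable[OF tm gL] by (simp add: right_diff_distrib)
      finally have "norm (?h x) \<le> (\<integral>y. norm (moll e (x - y) * (g y - g x)) \<partial>lborel)"
        using integral_norm_bound by metis
      also have "\<dots> \<le> (\<integral>y. norm (moll e (x - y)) * q \<partial>lborel)"
      proof (rule integral_mono)
        show "integrable lborel (\<lambda>y. norm (moll e (x - y) * (g y - g x)))"
          using i1 conv_integrable[OF tm gL] by (simp add: right_diff_distrib)
        show "integrable lborel (\<lambda>y. norm (moll e (x - y)) * q)" using i1 by simp
        show "norm (moll e (x - y) * (g y - g x)) \<le> norm (moll e (x - y)) * q" for y
          using near[of x y] moll_support[OF e(1), of "x - y"]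
          by (cases "moll e (x - y) = 0") (auto simp: norm_mult intro!: mult_left_mono)
      qed
      also have "\<dots> = q"
        using integral_norm_moll[OF e(1), where 'n='n] integral_lborel_reflect[of "\<lambda>z. norm (moll e (z::real^'n))" x]
          tf_measurable[OF tm] by simp
      finally show ?thesis .
    qed
    have "L2sq ?h \<le> q\<^sup>2 * V"
      unfolding V_def
    proof (rule L2c_bounded_support(2)[OF _ le])
      show "?h \<in> borel_measurable borel"
        using gm tf_measurable[OF tf_conv[OF tm gL]] by measurable
      show "{x. ?h x \<noteq> 0} \<subseteq> cball 0 (R + 1)"
      proof
        fix x assume "x \<in> {x. ?h x \<noteq> 0}"
        then have "g x \<noteq> 0 \<or> conv (moll e) g x \<noteq> 0" by auto
        then consider "g x \<noteq> 0" | "conv (moll e) g x \<noteq> 0" by blast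
        then show "x \<in> cball 0 (R + 1)"
        proof cases
          case 1 then have "norm x \<le> R" using R by auto
          then show ?thesis by simp
        next
          case 2
          then obtain y where "moll e (x - y) \<noteq> 0" "g y \<noteq> 0" using conv_support by blast
          then have "norm (x - y) < e" "norm y \<le> R" using moll_support[OF e(1)] R by auto
          then show ?thesis using norm_triangle_ineq[of "x - y" y] e by simp
        qed
      qed
    qed
    then show "L2sq ?h \<le> \<eta>" using q(2) by simp
  qed (use d in auto)
qed

text \<open>Two dominated convergences: truncate the values of \<open>w\<close>, then replace
  \<open>w\<close> by continuous functions converging to it almost everywhere; truncation and a
  cutoff supply the dominating function.\<close>

lemma L2c_approx_continuous:
  fixes w :: "real^'n::finite \<Rightarrow> complex"
  assumes w: "L2c w" and \<eta>: "\<eta> > 0"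
  obtains g R where "continuous_on UNIV g" "{x. g x \<noteq> 0} \<subseteq> cball 0 R" "L2sq (\<lambda>x. g x - w x) \<le> \<eta>"
proof -
  have [measurable]: "w \<in> borel_measurable borel" using w by auto
  obtain R where R: "R > 0" "{x. w x \<noteq> 0} \<subseteq> cball 0 R" using L2c_support[OF w] by metis
  \<comment> \<open>Radial retraction of the complex plane onto the disc of radius \<open>C\<close>;
    it is continuous, so it may be composed with continuous approximants.\<close>
  define T where "T C z = of_real (C / max C (norm z)) * z" for C :: real and z :: complex
  have T_le: "norm (T C z) \<le> C" if "C > 0" for C z
    using that by (auto simp: T_def norm_mult norm_divide divide_le_eq max_def)
  have T_id: "T C z = z" if "C > 0" "norm z \<le> C" for C z
    using that by (auto simp: T_def max_def)
  have T_dist: "norm (T C z - z) \<le> norm z" if "C > 0" for C z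
  proof -
    have "T C z - z = of_real (C / max C (norm z) - 1) * z" by (simp add: T_def algebra_simps)
    moreover have "0 \<le> C / max C (norm z)" "C / max C (norm z) \<le> 1"
      using that by (auto simp: divide_le_eq max_def)
    then have "\<bar>C / max C (norm z) - 1\<bar> \<le> 1" by linarith
    ultimately show ?thesis by (metis norm_mult norm_of_real mult_left_le_one_le norm_ge_zero abs_ge_zero)
  qed
  have T_cont: "continuous_on UNIV (T C)" if "C > 0" for C
    unfolding T_def using that by (intro continuous_intros) auto
  have T_meas: "T C \<in> borel_measurable borel" if "C > 0" for C
    using borel_measurable_continuous_onI[OF T_cont[OF that]] .
  have "(\<lambda>i. \<integral>x. (norm (T (real (Suc i)) (w x) - w x))\<^sup>2 \<partial>lborel) \<longlonglongrightarrow> (\<integral>x. 0 \<partial>(lborel :: (real^'n) measure))"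
  proof (rule integral_dominated_convergence[where w="\<lambda>x. (norm (w x))\<^sup>2"])
    show "(\<lambda>x. (norm (T (real (Suc i)) (w x) - w x))\<^sup>2) \<in> borel_measurable lborel" for i
      using measurable_compose[OF _ T_meas[of "real (Suc i)"], of w lborel] by measurable
    show "AE x in lborel. norm ((norm (T (real (Suc i)) (w x) - w x))\<^sup>2) \<le> (norm (w x))\<^sup>2" for i
      by (rule AE_I2) (use T_dist[of "real (Suc i)"] in \<open>simp add: power_mono del: of_nat_Suc\<close>)
    show "AE x in lborel. (\<lambda>i. (norm (T (real (Suc i)) (w x) - w x))\<^sup>2) \<longlonglongrightarrow> 0"
    proof (rule AE_I2)
      fix x
      obtain N :: nat where N: "norm (w x) \<le> real N" using real_arch_simple by metis
      have "\<forall>\<^sub>F i in sequentially. (norm (T (real (Suc i)) (w x) - w x))\<^sup>2 = 0"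
        using eventually_ge_at_top[of N] by eventually_elim (use N T_id in auto)
      then show "(\<lambda>i. (norm (T (real (Suc i)) (w x) - w x))\<^sup>2) \<longlonglongrightarrow> 0" by (rule tendsto_eventually)
    qed
  qed (use w in auto)
  then have "\<forall>\<^sub>F i in sequentially. L2sq (\<lambda>x. T (real (Suc i)) (w x) - w x) < \<eta>/4"
    unfolding L2sq_def using \<eta> by (intro order_tendstoD) auto
  then obtain i where i: "L2sq (\<lambda>x. T (real (Suc i)) (w x) - w x) < \<eta>/4"
    using eventually_happens by force
  define C where "C = real (Suc i)"
  have C: "C > 0" by (simp add: C_def)
  have T0: "T C 0 = 0" by (simp add: T_def)
  define \<theta> where "\<theta> x = max 0 (min 1 (R + 1 - norm x))" for x :: "real^'n"
  have \<theta>: "0 \<le> \<theta> x" "\<theta> x \<le> 1" "norm x \<le> R \<Longrightarrow> \<theta> x = 1" "R + 1 < norm x \<Longrightarrow> \<theta> x = 0" for x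
    by (auto simp: \<theta>_def)
  have \<theta>c: "continuous_on UNIV \<theta>" unfolding \<theta>_def by (intro continuous_intros)
  \<comment> \<open>Lebesgue measurability is, by \<open>measurable_on\<close>, the existence of
    continuous functions converging off a negligible set.\<close>
  have "w \<in> borel_measurable lebesgue" by (simp add: measurable_completion)
  then have "w measurable_on UNIV"
    using measurable_on_iff_borel_measurable[of UNIV w] by (simp add: lebesgue_on_UNIV_eq)
  then obtain N g where N: "negligible N" and gc: "\<And>n. continuous_on UNIV (g n)"
    and gl: "\<And>x. x \<notin> N \<Longrightarrow> (\<lambda>n. g n x) \<longlonglongrightarrow> w x"
    unfolding measurable_on_def by auto
  define h where "h n x = of_real (\<theta> x) * T C (g n x)" for n x
  have hc: "continuous_on UNIV (h n)" for n
    unfolding h_def[abs_def]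
    by (intro continuous_intros continuous_on_of_real \<theta>c continuous_on_compose2[OF T_cont[OF C] gc]) auto
  have hm: "h n \<in> borel_measurable borel" for n by (rule borel_measurable_continuous_onI[OF hc])
  have hs: "{x. h n x \<noteq> 0} \<subseteq> cball 0 (R + 1)" for n
    using \<theta>(4) by (force simp: h_def)
  have hb: "norm (h n x) \<le> C" for n x
    using mult_mono[OF \<theta>(2)[of x] T_le[OF C, of "g n x"]] \<theta>(1)[of x] by (simp add: h_def norm_mult)
  have tw: "of_real (\<theta> x) * T C (w x) = T C (w x)" for x
    using R \<theta>(3)[of x] T0 by (cases "w x = 0") auto
  have AEN: "AE x in lborel. x \<notin> N"
    using AE_not_in[of N lebesgue] N by (simp add: negligible_iff_null_sets AE_completion_iff)
  have "(\<lambda>n. \<integral>x. (norm (h n x - T C (w x)))\<^sup>2 \<partial>lborel) \<longlonglongrightarrow> (\<integral>x. 0 \<partial>(lborel :: (real^'n) measure))"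
  proof (rule integral_dominated_convergence[where w="\<lambda>x. (2 * C)\<^sup>2 * indicator (cball 0 (R+1)) x"])
    have [measurable]: "(\<lambda>x. T C (w x)) \<in> borel_measurable borel" "\<And>n. h n \<in> borel_measurable borel"
      using measurable_compose[OF _ T_meas[OF C], of w borel] hm by auto
    show "(\<lambda>x. (norm (h n x - T C (w x)))\<^sup>2) \<in> borel_measurable lborel" for n by measurable
    show "integrable lborel (\<lambda>x. (2 * C)\<^sup>2 * indicator (cball (0::real^'n) (R+1)) x)"
      by (intro integrable_mult_right integrable_lborel_indicator_bounded) auto
    show "AE x in lborel. norm ((norm (h n x - T C (w x)))\<^sup>2) \<le> (2 * C)\<^sup>2 * indicator (cball 0 (R+1)) x" for n
    proof (rule AE_I2)
      fix x
      show "norm ((norm (h n x - T C (w x)))\<^sup>2) \<le> (2 * C)\<^sup>2 * indicator (cball 0 (R+1)) x"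
      proof (cases "norm x \<le> R + 1")
        case True
        have "norm (h n x - T C (w x)) \<le> 2 * C"
          using norm_triangle_le_diff[OF add_mono[OF hb T_le[OF C]]] by simp
        then have "(norm (h n x - T C (w x)))\<^sup>2 \<le> (2 * C)\<^sup>2" by (rule power_mono) simp
        then show ?thesis using True by simp
      next
        case False
        then have "w x = 0" "\<theta> x = 0" using R \<theta>(4) by auto
        then show ?thesis by (simp add: h_def T0)
      qed
    qed
    show "AE x in lborel. (\<lambda>n. (norm (h n x - T C (w x)))\<^sup>2) \<longlonglongrightarrow> 0"
      using AEN
    proof eventually_elim
      case (elim x)
      have "isCont (T C) (w x)" using T_cont[OF C] continuous_on_eq_continuous_at by blast
      then have "(\<lambda>n. T C (g n x)) \<longlonglongrightarrow> T C (w x)" using isCont_tendsto_compose gl[OF elim] by blast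
      then have "(\<lambda>n. h n x) \<longlonglongrightarrow> of_real (\<theta> x) * T C (w x)" unfolding h_def by (intro tendsto_intros)
      then have "(\<lambda>n. norm (h n x - T C (w x))) \<longlonglongrightarrow> 0" unfolding tw using LIM_zero tendsto_norm_zero by blast
      then show ?case using tendsto_power[of _ 0 _ 2] by fastforce
    qed
  qed auto
  then have "\<forall>\<^sub>F n in sequentially. L2sq (\<lambda>x. h n x - T C (w x)) < \<eta>/4"
    unfolding L2sq_def using \<eta> by (intro order_tendstoD) auto
  then obtain n where n: "L2sq (\<lambda>x. h n x - T C (w x)) < \<eta>/4" using eventually_happens by force
  have L: "L2c (h n)" by (rule L2c_bounded_support(1)[OF hm hb hs])
  have LT: "L2c (\<lambda>x. T C (w x))"
    by (rule L2c_bounded_support(1)[where B=C and R=R])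
       (use measurable_compose[OF _ T_meas[OF C], of w borel] T_le[OF C] R T0 in auto)
  have "L2sq (\<lambda>x. (h n x - T C (w x)) + (T C (w x) - w x)) \<le> 2 * L2sq (\<lambda>x. h n x - T C (w x)) + 2 * L2sq (\<lambda>x. T C (w x) - w x)"
    by (intro L2c_add L2c_diff L LT w)
  also have "\<dots> \<le> \<eta>" using n i by (simp add: C_def)
  finally have "L2sq (\<lambda>x. h n x - w x) \<le> \<eta>" by simp
  then show ?thesis using that hc hs by blast
qed

text \<open>Density argument: mollification does not increase the mean-square norm
  (\<open>L2sq_conv\<close> with a kernel of mass 1), so it suffices to treat a nearby continuous
  function.\<close>

lemma moll_L2:
  fixes w :: "real^'n::finite \<Rightarrow> complex"
  assumes w: "L2c w" and \<eta>: "\<eta> > 0"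
  shows "\<exists>\<delta>>0. \<forall>e. 0 < e \<longrightarrow> e < \<delta> \<longrightarrow> L2sq (\<lambda>x. conv (moll e) w x - w x) \<le> \<eta>"
proof -
  \<comment> \<open>Two applications of the factor-2 triangle inequality to three errors of size
    \<eta>/16 give 10\<eta>/16 in total.\<close>
  have "\<eta>/16 > 0" using \<eta> by simp
  from L2c_approx_continuous[OF w this] obtain g R where g: "continuous_on UNIV g"
    "{x. g x \<noteq> 0} \<subseteq> cball 0 R" "L2sq (\<lambda>x. g x - w x) \<le> \<eta>/16" by metis
  from moll_continuous[OF g(1,2) \<open>\<eta>/16 > 0\<close>] obtain \<delta> where \<delta>: "\<delta> > 0"
    "\<And>e. 0 < e \<Longrightarrow> e < \<delta> \<Longrightarrow> L2sq (\<lambda>x. conv (moll e) g x - g x) \<le> \<eta>/16" by metis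
  have "bounded (g ` cball 0 R)"
    by (intro compact_imp_bounded compact_continuous_image continuous_on_subset[OF g(1)]) auto
  then obtain B where B: "B > 0" "\<And>x. x \<in> cball 0 R \<Longrightarrow> norm (g x) \<le> B" unfolding bounded_pos by auto
  have gB: "norm (g x) \<le> B" for x using B g(2) by (cases "g x = 0") auto
  have gL: "L2c g"
    by (rule L2c_bounded_support(1)[OF borel_measurable_continuous_onI[OF g(1)] gB g(2)])
  show ?thesis
  proof (intro exI[of _ \<delta>] conjI allI impI)
    fix e :: real assume e: "0 < e" "e < \<delta>"
    have tm: "tf (moll e :: real^'n \<Rightarrow> complex)" using tf_moll e(1) .
    let ?v = "\<lambda>x. w x - g x"
    have vL: "L2c ?v" by (intro L2c_diff w gL)
    have 1: "L2sq (conv (moll e) ?v) \<le> \<eta>/16"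
    proof -
      have "L2sq (conv (moll e) ?v) \<le> L2sq ?v"
        using L2sq_conv[OF tm vL] integral_norm_moll[OF e(1), where 'n='n] by simp
      also have "\<dots> = L2sq (\<lambda>x. g x - w x)" by (simp add: L2sq_def norm_minus_commute)
      finally show ?thesis using g(3) by simp
    qed
    have 2: "L2sq (\<lambda>x. (conv (moll e) g x - g x) + (g x - w x)) \<le> 2 * (\<eta>/16) + 2 * (\<eta>/16)"
      by (rule order_trans[OF L2c_add(2)])
         (use \<delta>(2)[OF e] g(3) in \<open>auto intro!: L2c_diff tf_L2c[OF tf_conv[OF tm]] gL w\<close>)
    have eq: "(\<lambda>x. conv (moll e) w x - w x) = (\<lambda>x. conv (moll e) ?v x + ((conv (moll e) g x - g x) + (g x - w x)))"
      by (simp add: conv_diff[OF tm w gL])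
    have "L2sq (\<lambda>x. conv (moll e) w x - w x) \<le> 2 * L2sq (conv (moll e) ?v) + 2 * L2sq (\<lambda>x. (conv (moll e) g x - g x) + (g x - w x))"
      unfolding eq by (intro L2c_add(2) L2c_add(1) L2c_diff(1) tf_L2c[OF tf_conv[OF tm]] gL w vL)
    then show "L2sq (\<lambda>x. conv (moll e) w x - w x) \<le> \<eta>" using 1 2 \<eta> by simp
  qed (rule \<delta>)
qed

subsection \<open>Sobolev norms of test functions\<close>

text \<open>Squared Sobolev norm of order \<open>s\<close>, with derivatives counted with
  multiplicity. The recursion removes one derivative at a time, which is the shape of all later
  inductions.\<close>

fun sobn :: "nat \<Rightarrow> (real^'n::finite \<Rightarrow> complex) \<Rightarrow> real" where
  "sobn 0 v = L2sq v"
| "sobn (Suc s) v = L2sq v + (\<Sum>i\<in>UNIV. sobn s (partial i v))"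

lemma sobn_nonneg [simp]: "0 \<le> sobn s v"
  by (induction s arbitrary: v) (auto intro!: add_nonneg_nonneg sum_nonneg)

lemma L2sq_le_sobn: "L2sq v \<le> sobn s v"
  by (cases s) (auto intro: sum_nonneg)

lemma sobn_Suc_ge: "sobn s v \<le> sobn (Suc s) v"
proof (induction s arbitrary: v)
  case 0
  then show ?case using L2sq_le_sobn[of v "Suc 0"] by simp
next
  case (Suc s)
  have "(\<Sum>i\<in>UNIV. sobn s (partial i v)) \<le> (\<Sum>i\<in>UNIV. sobn (Suc s) (partial i v))"
    by (intro sum_mono Suc.IH)
  then show ?case by (simp only: sobn.simps add_le_cancel_left)
qed

lemma sobn_mono: "s \<le> t \<Longrightarrow> sobn s v \<le> sobn t v"
  using lift_Suc_mono_le[of "\<lambda>s. sobn s v", OF sobn_Suc_ge] .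

lemma sum_sobn_partial: "(\<Sum>i\<in>UNIV. sobn s (partial i v)) \<le> sobn (Suc s) v"
  by simp

lemma sobn_partial: "sobn s (partial i v) \<le> sobn (Suc s) v"
  using member_le_sum[of i UNIV "\<lambda>i. sobn s (partial i v)"] sum_sobn_partial[of s v]
  by (simp del: sobn.simps)

lemma sobn_add: "tf f \<Longrightarrow> tf g \<Longrightarrow> sobn s (\<lambda>x. f x + g x) \<le> 2 * sobn s f + 2 * sobn s g"
proof (induction s arbitrary: f g)
  case 0
  then show ?case by (simp add: L2c_add(2) tf_L2c)
next
  case (Suc s)
  have "(\<Sum>i\<in>UNIV. sobn s (partial i (\<lambda>x. f x + g x))) \<le> (\<Sum>i\<in>UNIV. 2 * sobn s (partial i f) + 2 * sobn s (partial i g))"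
    by (rule sum_mono) (simp add: partial_add_tf Suc test_fun_partial)
  then show ?case
    using L2c_add(2)[OF tf_L2c[OF Suc.prems(1)] tf_L2c[OF Suc.prems(2)]]
    by (simp add: sum.distrib sum_distrib_left[symmetric])
qed

lemma sobn_cmult: "tf f \<Longrightarrow> sobn s (\<lambda>x. c * f x) = (norm c)\<^sup>2 * sobn s f"
proof (induction s arbitrary: f)
  case 0
  then show ?case by (simp add: L2sq_cmult)
next
  case (Suc s)
  then show ?case
    by (simp add: partial_cmult_tf test_fun_partial L2sq_cmult distrib_left sum_distrib_left)
qed

lemma sobn_diff: "tf f \<Longrightarrow> tf g \<Longrightarrow> sobn s (\<lambda>x. f x - g x) \<le> 2 * sobn s f + 2 * sobn s g"
  using sobn_add[of f "\<lambda>x. -1 * g x" s] sobn_cmult[of g s "-1"] test_fun_const_mult[of UNIV g "-1"] by simp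

lemma sobn_zero [simp]: "sobn s (\<lambda>x. 0) = 0"
  using sobn_cmult[OF test_fun_zero, of s 0] by simp

lemma sobn_sum:
  assumes "finite I" "\<And>i. i \<in> I \<Longrightarrow> tf (f i)"
  shows "sobn s (\<lambda>x. \<Sum>i\<in>I. f i x) \<le> 2 ^ card I * (\<Sum>i\<in>I. sobn s (f i))"
  using assms
proof (induction I rule: finite_induct)
  case (insert a I)
  have "sobn s (\<lambda>x. f a x + (\<Sum>i\<in>I. f i x)) \<le> 2 * sobn s (f a) + 2 * sobn s (\<lambda>x. \<Sum>i\<in>I. f i x)"
    using insert.prems by (intro sobn_add test_fun_sum) auto
  also have "\<dots> \<le> 2 ^ Suc (card I) * sobn s (f a) + 2 * (2 ^ card I * (\<Sum>i\<in>I. sobn s (f i)))"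
    using insert by (intro add_mono mult_right_mono mult_left_mono) auto
  also have "\<dots> = 2 ^ Suc (card I) * (sobn s (f a) + (\<Sum>i\<in>I. sobn s (f i)))"
    by (simp add: distrib_left)
  finally show ?case using insert by simp
qed simp

text \<open>The common induction step for multiplication by a coefficient and for commutators: by a
  Leibniz rule, \<open>partial i V\<close> consists of a term with the derivative on the coefficient
  (constant \<open>D i\<close>) and one with the derivative on \<open>v\<close> (constant
  \<open>C\<close>).\<close>

lemma sobn_Suc_bound:
  fixes v V :: "real^'n::finite \<Rightarrow> complex"
  assumes "L2sq V \<le> C0 * L2sq v" "C0 \<ge> 0" "C \<ge> 0" "\<And>i. D i \<ge> 0"
    and "\<And>i. sobn s (partial i V) \<le> 2 * (D i * sobn s v) + 2 * (C * sobn s (partial i v))"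
  shows "sobn (Suc s) V \<le> (C0 + 2 * (\<Sum>i\<in>UNIV. D i) + 2 * C) * sobn (Suc s) v"
proof -
  let ?S = "sobn (Suc s) v"
  have "L2sq V \<le> C0 * ?S"
    using assms(1) mult_left_mono[OF L2sq_le_sobn[of v "Suc s"] assms(2)] by linarith
  moreover have "(\<Sum>i\<in>UNIV. sobn s (partial i V)) \<le> (\<Sum>i\<in>UNIV. 2 * (D i * sobn s v) + 2 * (C * sobn s (partial i v)))"
    by (intro sum_mono assms)
  moreover have "\<dots> = 2 * ((\<Sum>i\<in>UNIV. D i) * sobn s v) + 2 * (C * (\<Sum>i\<in>UNIV. sobn s (partial i v)))"
    by (simp add: sum.distrib sum_distrib_left sum_distrib_right)
  moreover have "(\<Sum>i\<in>UNIV. D i) * sobn s v \<le> (\<Sum>i\<in>UNIV. D i) * ?S"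
    by (intro mult_left_mono sobn_Suc_ge sum_nonneg assms)
  moreover have "C * (\<Sum>i\<in>UNIV. sobn s (partial i v)) \<le> C * ?S"
    by (intro mult_left_mono sum_sobn_partial assms)
  ultimately have "L2sq V + (\<Sum>i\<in>UNIV. sobn s (partial i V)) \<le> C0 * ?S + (2 * ((\<Sum>i\<in>UNIV. D i) * ?S) + 2 * (C * ?S))"
    by linarith
  then show ?thesis by (subst sobn.simps) (simp add: distrib_right del: sobn.simps)
qed

lemma L2c_tf_mult:
  assumes "tf a" "L2c w" shows "L2c (\<lambda>x. a x * w x)"
proof -
  obtain B where "\<And>x. norm (a x) \<le> B" using tf_bounded[OF assms(1)] by metis
  then show ?thesis using L2c_mult(1)[OF assms(2) tf_measurable[OF assms(1)]] by metis
qed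

lemma L2sq_tf_mult:
  assumes "tf a" obtains C where "C \<ge> 0" "\<And>w. L2c w \<Longrightarrow> L2sq (\<lambda>x. a x * w x) \<le> C * L2sq w"
proof -
  obtain B where "\<And>x. norm (a x) \<le> B" using tf_bounded[OF assms(1)] by metis
  then have "L2sq (\<lambda>x. a x * w x) \<le> B\<^sup>2 * L2sq w" if "L2c w" for w
    using L2c_mult(2)[OF that tf_measurable[OF assms(1)]] by metis
  then show ?thesis using that[of "B\<^sup>2"] by simp
qed

lemma sobn_mult: "tf a \<Longrightarrow> \<exists>C\<ge>0. \<forall>v. tf v \<longrightarrow> sobn s (\<lambda>x. a x * v x) \<le> C * sobn s v"
proof (induction s arbitrary: a)
  case 0
  obtain C where "C \<ge> 0" "\<And>w. L2c w \<Longrightarrow> L2sq (\<lambda>x. a x * w x) \<le> C * L2sq w"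
    using L2sq_tf_mult[OF 0] by metis
  then show ?case using tf_L2c by (intro exI[of _ C]) auto
next
  case (Suc s)
  obtain C0 where C0: "C0 \<ge> 0" "\<And>w. L2c w \<Longrightarrow> L2sq (\<lambda>x. a x * w x) \<le> C0 * L2sq w"
    using L2sq_tf_mult[OF Suc.prems] by metis
  obtain C where C: "C \<ge> 0" "\<And>v. tf v \<Longrightarrow> sobn s (\<lambda>x. a x * v x) \<le> C * sobn s v"
    using Suc.IH[OF Suc.prems] by metis
  have "\<forall>i. \<exists>D\<ge>0. \<forall>v. tf v \<longrightarrow> sobn s (\<lambda>x. partial i a x * v x) \<le> D * sobn s v"
    using Suc.IH[OF test_fun_partial[OF Suc.prems]] by blast
  then obtain D where D: "\<And>i. D i \<ge> 0" "\<And>i v. tf v \<Longrightarrow> sobn s (\<lambda>x. partial i a x * v x) \<le> D i * sobn s v"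
    by metis
  have "sobn (Suc s) (\<lambda>x. a x * v x) \<le> (C0 + 2 * (\<Sum>i\<in>UNIV. D i) + 2 * C) * sobn (Suc s) v" if v: "tf v" for v
  proof (rule sobn_Suc_bound)
    fix i
    have "sobn s (partial i (\<lambda>x. a x * v x)) \<le> 2 * sobn s (\<lambda>x. partial i a x * v x) + 2 * sobn s (\<lambda>x. a x * partial i v x)"
      unfolding partial_mult_tf[OF Suc.prems v]
      by (rule sobn_add) (auto intro!: test_fun_mult[where \<Omega>'=UNIV] test_fun_partial Suc.prems v)
    also have "\<dots> \<le> 2 * (D i * sobn s v) + 2 * (C * sobn s (partial i v))"
      using D(2)[OF v, of i] C(2)[OF test_fun_partial[OF v], of i] by simp
    finally show "sobn s (partial i (\<lambda>x. a x * v x)) \<le> 2 * (D i * sobn s v) + 2 * (C * sobn s (partial i v))" .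
  qed (use C0 C D tf_L2c[OF v] in auto)
  moreover have "C0 + 2 * (\<Sum>i\<in>UNIV. D i) + 2 * C \<ge> 0"
    using C0 C D by (intro add_nonneg_nonneg mult_nonneg_nonneg sum_nonneg) auto
  ultimately show ?case by blast
qed

lemma sobn_mult_partial_sum:
  fixes b :: "'n::finite \<Rightarrow> real^'n \<Rightarrow> complex"
  assumes "\<And>\<nu>. tf (b \<nu>)"
  shows "\<exists>D\<ge>0. \<forall>v. tf v \<longrightarrow> sobn s (\<lambda>x. \<Sum>\<nu>\<in>UNIV. b \<nu> x * partial \<nu> v x) \<le> D * sobn (Suc s) v"
proof -
  have "\<forall>\<nu>. \<exists>C\<ge>0. \<forall>v. tf v \<longrightarrow> sobn s (\<lambda>x. b \<nu> x * v x) \<le> C * sobn s v"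
    using sobn_mult[OF assms] by blast
  then obtain C where C: "\<And>\<nu>. C \<nu> \<ge> 0" "\<And>\<nu> v. tf v \<Longrightarrow> sobn s (\<lambda>x. b \<nu> x * v x) \<le> C \<nu> * sobn s v"
    by metis
  let ?D = "2 ^ CARD('n) * (\<Sum>\<nu>\<in>UNIV. C \<nu>)"
  have "sobn s (\<lambda>x. \<Sum>\<nu>\<in>UNIV. b \<nu> x * partial \<nu> v x) \<le> ?D * sobn (Suc s) v" if v: "tf v" for v
  proof -
    have "sobn s (\<lambda>x. \<Sum>\<nu>\<in>UNIV. b \<nu> x * partial \<nu> v x) \<le> 2 ^ CARD('n) * (\<Sum>\<nu>\<in>UNIV. sobn s (\<lambda>x. b \<nu> x * partial \<nu> v x))"
      by (rule sobn_sum) (auto intro!: test_fun_mult[where \<Omega>'=UNIV] test_fun_partial assms v)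
    also have "\<dots> \<le> 2 ^ CARD('n) * (\<Sum>\<nu>\<in>UNIV. C \<nu> * sobn (Suc s) v)"
    proof (intro mult_left_mono sum_mono)
      fix \<nu>
      have "sobn s (\<lambda>x. b \<nu> x * partial \<nu> v x) \<le> C \<nu> * sobn s (partial \<nu> v)"
        by (rule C(2)[OF test_fun_partial[OF v]])
      also have "\<dots> \<le> C \<nu> * sobn (Suc s) v" by (intro mult_left_mono sobn_partial C)
      finally show "sobn s (\<lambda>x. b \<nu> x * partial \<nu> v x) \<le> C \<nu> * sobn (Suc s) v" .
    qed simp
    also have "\<dots> = ?D * sobn (Suc s) v" by (simp add: sum_distrib_right mult.assoc del: sobn.simps)
    finally show ?thesis .
  qed
  moreover have "?D \<ge> 0" using C by (intro mult_nonneg_nonneg sum_nonneg) auto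
  ultimately show ?thesis by blast
qed

text \<open>All derivatives fall on \<open>k\<close>, so the constant blows up as a mollifier
  narrows. It serves only to dispose of errors that are small in the mean while \<open>k\<close> is
  fixed.\<close>

lemma sobn_conv_crude: "tf k \<Longrightarrow> \<exists>C\<ge>0. \<forall>w. L2c w \<longrightarrow> sobn s (conv k w) \<le> C * L2sq w"
proof (induction s arbitrary: k)
  case 0
  then show ?case using L2sq_conv by (intro exI[of _ "(\<integral>z. norm (k z) \<partial>lborel)\<^sup>2"]) auto
next
  case (Suc s)
  have "\<forall>i. \<exists>D\<ge>0. \<forall>w. L2c w \<longrightarrow> sobn s (conv (partial i k) w) \<le> D * L2sq w"
    using Suc.IH[OF test_fun_partial[OF Suc.prems]] by blast
  then obtain D where D: "\<And>i. D i \<ge> 0" "\<And>i w. L2c w \<Longrightarrow> sobn s (conv (partial i k) w) \<le> D i * L2sq w"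
    by metis
  let ?C0 = "(\<integral>z. norm (k z) \<partial>lborel)\<^sup>2"
  have "sobn (Suc s) (conv k w) \<le> (?C0 + (\<Sum>i\<in>UNIV. D i)) * L2sq w" if w: "L2c w" for w
  proof -
    have "(\<Sum>i\<in>UNIV. sobn s (partial i (conv k w))) \<le> (\<Sum>i\<in>UNIV. D i * L2sq w)"
      unfolding partial_conv[OF Suc.prems w] by (intro sum_mono D w)
    then show ?thesis using L2sq_conv[OF Suc.prems w] by (simp add: distrib_right sum_distrib_right)
  qed
  moreover have "?C0 + (\<Sum>i\<in>UNIV. D i) \<ge> 0" using D by (intro add_nonneg_nonneg sum_nonneg) auto
  ultimately show ?case by blast
qed

subsection \<open>Friedrichs commutators\<close>

text \<open>The commutator of multiplication by \<open>a\<close> with convolution by \<open>k\<close>, applied to the distributional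
  derivative \<open>\<partial>\<^sub>\<nu> w\<close>; the derivative is moved to \<open>k\<close> and \<open>a\<close> so that \<open>w\<close> may be merely square integrable.\<close>
definition Rcom :: "(real^'n::finite \<Rightarrow> complex) \<Rightarrow> (real^'n \<Rightarrow> complex) \<Rightarrow> 'n \<Rightarrow> (real^'n \<Rightarrow> complex) \<Rightarrow> real^'n \<Rightarrow> complex" where
  "Rcom k a \<nu> w x = (a x * conv (partial \<nu> k) w x - conv (partial \<nu> k) (\<lambda>y. a y * w y) x)
      + conv k (\<lambda>y. partial \<nu> a y * w y) x"

lemma tf_Rcom:
  assumes "tf k" "tf a" "L2c w" shows "tf (Rcom k a \<nu> w)"
  unfolding Rcom_def[abs_def]
  by (intro test_fun_add test_fun_diff test_fun_mult[where \<Omega>'=UNIV] tf_conv test_fun_partial L2c_tf_mult assms)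

lemma Rcom_add:
  assumes "tf k" "tf a" "L2c v" "L2c w"
  shows "Rcom k a \<nu> (\<lambda>x. v x + w x) x = Rcom k a \<nu> v x + Rcom k a \<nu> w x"
proof -
  have d: "(\<lambda>y. b y * (v y + w y)) = (\<lambda>y. b y * v y + b y * w y)" for b
    by (simp add: distrib_left)
  show ?thesis
    unfolding Rcom_def d
    by (simp only: conv_add assms test_fun_partial L2c_tf_mult) (simp only: algebra_simps)
qed

text \<open>The commutator has the kernel (a x - a y) \<partial>k(x - y) + k(x - y) \<partial>a(y).
  The Lipschitz bound on \<open>a\<close> turns the first part into |x - y| |\<partial>k(x - y)|,
  whose integral does not depend on \<open>e\<close>; Schur's test then gives the constant (L K +
  B)^2.\<close>

lemma friedrichs_L2:
  fixes a :: "real^'n::finite \<Rightarrow> complex"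
  assumes a: "tf a"
  shows "\<exists>C\<ge>0. \<forall>e>0. \<forall>w. L2c w \<longrightarrow> L2sq (Rcom (moll e) a \<nu> w) \<le> C * L2sq w"
proof -
  obtain L where L: "L > 0" "\<And>x y. norm (a x - a y) \<le> L * norm (x - y)" using tf_lipschitz[OF a] by metis
  obtain B where B: "B > 0" "\<And>x. norm (partial \<nu> a x) \<le> B" using tf_bounded[OF test_fun_partial[OF a]] by metis
  define K where "K = (\<integral>z. norm z * norm (partial \<nu> (moll 1) (z::real^'n)) \<partial>lborel)"
  define A where "A = L * K + B"
  have K: "K \<ge> 0" unfolding K_def by (intro integral_nonneg_AE) auto
  have A: "A \<ge> 0" using K L B by (simp add: A_def)
  have "L2sq (Rcom (moll e) a \<nu> w) \<le> A\<^sup>2 * L2sq w" if e: "e > 0" and w: "L2c w" for e w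
  proof -
    let ?k = "moll e :: real^'n \<Rightarrow> complex"
    let ?\<kappa> = "\<lambda>z. L * (norm z * norm (partial \<nu> ?k z)) + B * norm (?k z)"
    have k: "tf ?k" "tf (partial \<nu> ?k)" using tf_moll[OF e] test_fun_partial by blast+
    have ik: "integrable lborel (\<lambda>z. L * (norm z * norm (partial \<nu> ?k z)))" "integrable lborel (\<lambda>z. B * norm (?k z))"
      using integrable_norm_times_tf[OF k(2)] tf_integrable[OF k(1)] by auto
    have "(\<integral>z. ?\<kappa> z \<partial>lborel) = A"
      using ik integral_norm_partial_moll[OF e, of \<nu>] integral_norm_moll[OF e, where 'n='n] by (simp add: A_def K_def)
    then have nn: "(\<integral>\<^sup>+z. ennreal (?\<kappa> z) \<partial>lborel) \<le> ennreal A"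
      using ik L B by (subst nn_integral_eq_integral) auto
    show ?thesis
    proof (rule schur_bound(2)[where \<kappa>="?\<kappa>", OF _ _ nn A w])
      show "?\<kappa> \<in> borel_measurable borel"
        using tf_measurable[OF k(1)] tf_measurable[OF k(2)] by measurable
      show "0 \<le> ?\<kappa> z" for z using L B by auto
      show "Rcom ?k a \<nu> w \<in> borel_measurable borel" by (rule tf_measurable[OF tf_Rcom[OF k(1) a w]])
      fix x
      let ?g = "\<lambda>y. (a x * (partial \<nu> ?k (x - y) * w y) - partial \<nu> ?k (x - y) * (a y * w y)) + ?k (x - y) * (partial \<nu> a y * w y)"
      have i: "integrable lborel (\<lambda>y. a x * (partial \<nu> ?k (x - y) * w y))"
        "integrable lborel (\<lambda>y. partial \<nu> ?k (x - y) * (a y * w y))"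
        "integrable lborel (\<lambda>y. ?k (x - y) * (partial \<nu> a y * w y))"
        by (auto intro!: integrable_mult_right conv_integrable k w L2c_tf_mult a test_fun_partial)
      have Req: "Rcom ?k a \<nu> w x = (\<integral>y. ?g y \<partial>lborel)"
        unfolding Rcom_def conv_def
        by (simp only: Bochner_Integration.integral_add[OF Bochner_Integration.integrable_diff[OF i(1,2)] i(3)]
            Bochner_Integration.integral_diff[OF i(1,2)] integral_mult_right_zero)
      have "ennreal (norm (Rcom ?k a \<nu> w x)) \<le> (\<integral>\<^sup>+y. norm (?g y) \<partial>lborel)"
        unfolding Req
        by (intro integral_norm_bound_ennreal Bochner_Integration.integrable_add Bochner_Integration.integrable_diff i)
      also have "\<dots> \<le> (\<integral>\<^sup>+y. ennreal (?\<kappa> (x - y) * norm (w y)) \<partial>lborel)"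
      proof (intro nn_integral_mono ennreal_leI)
        fix y
        have "?g y = ((a x - a y) * partial \<nu> ?k (x - y) + ?k (x - y) * partial \<nu> a y) * w y"
          by (simp add: algebra_simps)
        then have "norm (?g y) = norm ((a x - a y) * partial \<nu> ?k (x - y) + ?k (x - y) * partial \<nu> a y) * norm (w y)"
          by (simp only: norm_mult)
        also have "\<dots> \<le> ?\<kappa> (x - y) * norm (w y)"
        proof (intro mult_right_mono norm_triangle_mono)
          show "norm ((a x - a y) * partial \<nu> ?k (x - y)) \<le> L * (norm (x - y) * norm (partial \<nu> ?k (x - y)))"
            using mult_right_mono[OF L(2)[of x y], of "norm (partial \<nu> ?k (x - y))"] by (simp add: norm_mult mult.assoc)
          show "norm (?k (x - y) * partial \<nu> a y) \<le> B * norm (?k (x - y))"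
            using mult_right_mono[OF B(2)[of y], of "norm (?k (x - y))"] by (simp add: norm_mult mult.commute)
        qed simp
        finally show "norm (?g y) \<le> ?\<kappa> (x - y) * norm (w y)" .
      qed
      finally show "ennreal (norm (Rcom ?k a \<nu> w x)) \<le> (\<integral>\<^sup>+y. ennreal (?\<kappa> (x - y) * norm (w y)) \<partial>lborel)" .
    qed
  qed
  then show ?thesis by (intro exI[of _ "A\<^sup>2"]) auto
qed

lemma partial_commute_fun: "tf f \<Longrightarrow> partial i (partial j f) = partial j (partial i f)"
  by (rule ext) (rule partial_commute)

text \<open>Since convolution lets a derivative pass to the right factor, \<open>Rcom\<close> obeys
  a Leibniz rule in \<open>a\<close> and \<open>w\<close>; hence the mean-square bound propagates to
  every order.\<close>

lemma partial_Rcom: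
  assumes k: "tf k" and a: "tf a" and w: "tf w"
  shows "partial i (Rcom k a \<nu> w) = (\<lambda>x. Rcom k (partial i a) \<nu> w x + Rcom k a \<nu> (partial i w) x)"
proof -
  have t: "tf (partial \<nu> k)" "tf (partial i w)" "tf (partial i a)" "tf (partial \<nu> a)" "tf (partial i (partial \<nu> a))"
    by (intro test_fun_partial k a w)+
  have p: "tf (\<lambda>y. a y * w y)" "tf (\<lambda>y. partial \<nu> a y * w y)"
    by (intro test_fun_mult[where \<Omega>'=UNIV] a w t)+
  have q: "L2c (\<lambda>y. partial i a y * w y)" "L2c (\<lambda>y. a y * partial i w y)" "L2c w"
    "L2c (\<lambda>y. partial i (partial \<nu> a) y * w y)" "L2c (\<lambda>y. partial \<nu> a y * partial i w y)"
    by (intro L2c_tf_mult tf_L2c a w t)+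
  have 1: "partial i (\<lambda>x. a x * conv (partial \<nu> k) w x)
     = (\<lambda>x. partial i a x * conv (partial \<nu> k) w x + a x * conv (partial \<nu> k) (partial i w) x)"
    by (subst partial_mult_tf[OF a tf_conv[OF t(1) tf_L2c[OF w]]]) (simp only: partial_conv_right[OF t(1) w])
  have 2: "partial i (conv (partial \<nu> k) (\<lambda>y. a y * w y))
     = (\<lambda>x. conv (partial \<nu> k) (\<lambda>y. partial i a y * w y) x + conv (partial \<nu> k) (\<lambda>y. a y * partial i w y) x)"
    by (subst partial_conv_right[OF t(1) p(1)], subst partial_mult_tf[OF a w], rule ext, rule conv_add[OF t(1) q(1,2)])
  have 3: "partial i (conv k (\<lambda>y. partial \<nu> a y * w y))
     = (\<lambda>x. conv k (\<lambda>y. partial \<nu> (partial i a) y * w y) x + conv k (\<lambda>y. partial \<nu> a y * partial i w y) x)"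
    unfolding partial_commute_fun[OF a, of \<nu> i]
    by (subst partial_conv_right[OF k p(2)], subst partial_mult_tf[OF t(4) w], rule ext, rule conv_add[OF k q(4,5)])
  have "partial i (Rcom k a \<nu> w) = (\<lambda>x. (partial i (\<lambda>x. a x * conv (partial \<nu> k) w x) x
      - partial i (conv (partial \<nu> k) (\<lambda>y. a y * w y)) x) + partial i (conv k (\<lambda>y. partial \<nu> a y * w y)) x)"
  proof -
    have A: "tf (\<lambda>x. a x * conv (partial \<nu> k) w x)" "tf (conv (partial \<nu> k) (\<lambda>y. a y * w y))" "tf (conv k (\<lambda>y. partial \<nu> a y * w y))"
      by (intro test_fun_mult[where \<Omega>'=UNIV] tf_conv a t k tf_L2c w p)+
    have B: "tf (\<lambda>x. a x * conv (partial \<nu> k) w x - conv (partial \<nu> k) (\<lambda>y. a y * w y) x)"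
      by (intro test_fun_diff A)
    show ?thesis
      unfolding Rcom_def[abs_def]
      by (subst partial_add_tf[OF B A(3)], subst partial_diff_tf[OF A(1,2)]) (rule refl)
  qed
  then show ?thesis unfolding 1 2 3 Rcom_def by (simp add: fun_eq_iff algebra_simps)
qed

lemma friedrichs_sobn:
  fixes a :: "real^'n::finite \<Rightarrow> complex"
  shows "tf a \<Longrightarrow> \<exists>C\<ge>0. \<forall>e>0. \<forall>w. tf w \<longrightarrow> sobn s (Rcom (moll e) a \<nu> w) \<le> C * sobn s w"
proof (induction s arbitrary: a)
  case 0
  obtain C where "C \<ge> 0" "\<And>e w. e > 0 \<Longrightarrow> L2c w \<Longrightarrow> L2sq (Rcom (moll e) a \<nu> w) \<le> C * L2sq w"
    using friedrichs_L2[OF 0, of \<nu>] by metis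
  then show ?case using tf_L2c by (intro exI[of _ C]) auto
next
  case (Suc s)
  obtain C0 where C0: "C0 \<ge> 0" "\<And>e w. e > 0 \<Longrightarrow> L2c w \<Longrightarrow> L2sq (Rcom (moll e) a \<nu> w) \<le> C0 * L2sq w"
    using friedrichs_L2[OF Suc.prems, of \<nu>] by metis
  obtain C where C: "C \<ge> 0" "\<And>e w. e > 0 \<Longrightarrow> tf w \<Longrightarrow> sobn s (Rcom (moll e) a \<nu> w) \<le> C * sobn s w"
    using Suc.IH[OF Suc.prems] by metis
  have "\<forall>i. \<exists>D\<ge>0. \<forall>e>0. \<forall>w. tf w \<longrightarrow> sobn s (Rcom (moll e) (partial i a) \<nu> w) \<le> D * sobn s w"
    using Suc.IH[OF test_fun_partial[OF Suc.prems]] by blast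
  then obtain D where D: "\<And>i. D i \<ge> 0"
    "\<And>i e w. e > 0 \<Longrightarrow> tf w \<Longrightarrow> sobn s (Rcom (moll e) (partial i a) \<nu> w) \<le> D i * sobn s w"
    by metis
  have "sobn (Suc s) (Rcom (moll e) a \<nu> w) \<le> (C0 + 2 * (\<Sum>i\<in>UNIV. D i) + 2 * C) * sobn (Suc s) w"
    if e: "e > 0" and w: "tf w" for e w
  proof (rule sobn_Suc_bound)
    fix i
    have m: "tf (moll e :: real^'n \<Rightarrow> complex)" by (rule tf_moll[OF e])
    have "sobn s (partial i (Rcom (moll e) a \<nu> w)) \<le> 2 * sobn s (Rcom (moll e) (partial i a) \<nu> w) + 2 * sobn s (Rcom (moll e) a \<nu> (partial i w))"
      unfolding partial_Rcom[OF m Suc.prems w]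
      by (intro sobn_add tf_Rcom m test_fun_partial Suc.prems tf_L2c w)
    also have "\<dots> \<le> 2 * (D i * sobn s w) + 2 * (C * sobn s (partial i w))"
      using D(2)[OF e w, of i] C(2)[OF e test_fun_partial[OF w], of i] by simp
    finally show "sobn s (partial i (Rcom (moll e) a \<nu> w)) \<le> 2 * (D i * sobn s w) + 2 * (C * sobn s (partial i w))" .
  qed (use C0 C D e tf_L2c[OF w] in auto)
  moreover have "C0 + 2 * (\<Sum>i\<in>UNIV. D i) + 2 * C \<ge> 0"
    using C0 C D by (intro add_nonneg_nonneg mult_nonneg_nonneg sum_nonneg) auto
  ultimately show ?case by blast
qed

text \<open>As with \<open>sobn_conv_crude\<close>: a bound by the mean-square norm alone, with a
  constant depending on \<open>k\<close>.\<close>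

lemma sobn_Rcom_crude:
  assumes k: "tf k" and a: "tf a"
  shows "\<exists>C\<ge>0. \<forall>w. L2c w \<longrightarrow> sobn s (Rcom k a \<nu> w) \<le> C * L2sq w"
proof -
  have t: "tf (partial \<nu> k)" "tf (partial \<nu> a)" using k a test_fun_partial by blast+
  obtain C1 where C1: "C1 \<ge> 0" "\<And>w. L2c w \<Longrightarrow> sobn s (conv (partial \<nu> k) w) \<le> C1 * L2sq w"
    using sobn_conv_crude[OF t(1)] by metis
  obtain C2 where C2: "C2 \<ge> 0" "\<And>w. L2c w \<Longrightarrow> sobn s (conv k w) \<le> C2 * L2sq w"
    using sobn_conv_crude[OF k] by metis
  obtain C3 where C3: "C3 \<ge> 0" "\<And>v. tf v \<Longrightarrow> sobn s (\<lambda>x. a x * v x) \<le> C3 * sobn s v"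
    using sobn_mult[OF a] by metis
  obtain A1 where A1: "A1 \<ge> 0" "\<And>w. L2c w \<Longrightarrow> L2sq (\<lambda>x. a x * w x) \<le> A1 * L2sq w"
    using L2sq_tf_mult[OF a] by metis
  obtain A2 where A2: "A2 \<ge> 0" "\<And>w. L2c w \<Longrightarrow> L2sq (\<lambda>x. partial \<nu> a x * w x) \<le> A2 * L2sq w"
    using L2sq_tf_mult[OF t(2)] by metis
  define C where "C = 2 * (2 * (C3 * C1) + 2 * (C1 * A1)) + 2 * (C2 * A2)"
  have "sobn s (Rcom k a \<nu> w) \<le> C * L2sq w" if w: "L2c w" for w
  proof -
    let ?X = "\<lambda>x. a x * conv (partial \<nu> k) w x" and ?Y = "conv (partial \<nu> k) (\<lambda>y. a y * w y)"
      and ?Z = "conv k (\<lambda>y. partial \<nu> a y * w y)"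
    have tX: "tf ?X" by (intro test_fun_mult[where \<Omega>'=UNIV] tf_conv t a w)
    have tY: "tf ?Y" "tf ?Z" by (intro tf_conv t k L2c_tf_mult a w)+
    have "sobn s (\<lambda>x. (?X x - ?Y x) + ?Z x) \<le> 2 * sobn s (\<lambda>x. ?X x - ?Y x) + 2 * sobn s ?Z"
      by (intro sobn_add test_fun_diff tX tY)
    also have "sobn s (\<lambda>x. ?X x - ?Y x) \<le> 2 * sobn s ?X + 2 * sobn s ?Y" by (intro sobn_diff tX tY)
    finally have 1: "sobn s (Rcom k a \<nu> w) \<le> 2 * (2 * sobn s ?X + 2 * sobn s ?Y) + 2 * sobn s ?Z"
      by (simp add: Rcom_def[abs_def])
    have X: "sobn s ?X \<le> (C3 * C1) * L2sq w"
      using order_trans[OF C3(2)[OF tf_conv[OF t(1) w]] mult_left_mono[OF C1(2)[OF w] C3(1)]] by (simp add: mult.assoc)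
    have Y: "sobn s ?Y \<le> (C1 * A1) * L2sq w"
      using order_trans[OF C1(2)[OF L2c_tf_mult[OF a w]] mult_left_mono[OF A1(2)[OF w] C1(1)]] by (simp add: mult.assoc)
    have Z: "sobn s ?Z \<le> (C2 * A2) * L2sq w"
      using order_trans[OF C2(2)[OF L2c_tf_mult[OF t(2) w]] mult_left_mono[OF A2(2)[OF w] C2(1)]] by (simp add: mult.assoc)
    have "C * L2sq w = 2 * (2 * ((C3 * C1) * L2sq w) + 2 * ((C1 * A1) * L2sq w)) + 2 * ((C2 * A2) * L2sq w)"
      by (simp add: C_def algebra_simps)
    moreover have "2 * (2 * sobn s ?X + 2 * sobn s ?Y) + 2 * sobn s ?Z
        \<le> 2 * (2 * ((C3 * C1) * L2sq w) + 2 * ((C1 * A1) * L2sq w)) + 2 * ((C2 * A2) * L2sq w)"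
      by (intro add_mono mult_left_mono X Y Z) auto
    ultimately show ?thesis using 1 by simp
  qed
  moreover have "C \<ge> 0" using C1 C2 C3 A1 A2 by (simp add: C_def)
  ultimately show ?thesis by blast
qed

text \<open>Transfers the estimate from test functions to \<open>w\<close> that are known only
  through bounds on their mollifications. Replace \<open>w\<close> by its mollification at a scale
  \<open>d\<close> chosen after \<open>e\<close>: the main part is bounded uniformly, the remainder
  is small in the mean and is handled by the crude bound.\<close>

lemma friedrichs_bounded:
  fixes a :: "real^'n::finite \<Rightarrow> complex"
  assumes a: "tf a"
  shows "\<exists>C\<ge>0. \<forall>w M \<delta> e. L2c w \<longrightarrow> \<delta> > 0 \<longrightarrow> (\<forall>d. 0 < d \<longrightarrow> d < \<delta> \<longrightarrow> sobn s (conv (moll d) w) \<le> M) \<longrightarrow>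
     e > 0 \<longrightarrow> sobn s (Rcom (moll e) a \<nu> w) \<le> C * M"
proof -
  obtain C where C: "C \<ge> 0" "\<And>e w. e > 0 \<Longrightarrow> tf w \<Longrightarrow> sobn s (Rcom (moll e) a \<nu> w) \<le> C * sobn s w"
    using friedrichs_sobn[OF a] by metis
  have "sobn s (Rcom (moll e) a \<nu> w) \<le> (2 * C) * M"
    if w: "L2c w" and \<delta>: "\<delta> > 0" and M: "\<And>d. 0 < d \<Longrightarrow> d < \<delta> \<Longrightarrow> sobn s (conv (moll d) w) \<le> M" and e: "e > 0" for w M \<delta> e
  proof (rule field_le_epsilon)
    fix \<eta> :: real assume \<eta>: "\<eta> > 0"
    have m: "tf (moll d :: real^'n \<Rightarrow> complex)" if "d > 0" for d by (rule tf_moll[OF that])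
    obtain C' where C': "C' \<ge> 0" "\<And>w. L2c w \<Longrightarrow> sobn s (Rcom (moll e) a \<nu> w) \<le> C' * L2sq w"
      using sobn_Rcom_crude[OF m[OF e] a] by metis
    \<comment> \<open>\<open>C'\<close> depends on \<open>e\<close>, which is fixed here; the
      tolerance is adapted to it so that the remainder contributes at most
      \<open>\<eta>\<close>.\<close>
    have "\<eta> / (2 * C' + 1) > 0" using \<eta> C' by simp
    from moll_L2[OF w this] obtain \<delta>' where \<delta>': "\<delta>' > 0"
      "\<And>d. 0 < d \<Longrightarrow> d < \<delta>' \<Longrightarrow> L2sq (\<lambda>x. conv (moll d) w x - w x) \<le> \<eta> / (2 * C' + 1)" by metis
    define d where "d = min \<delta> \<delta>' / 2"
    have d: "0 < d" "d < \<delta>" "d < \<delta>'" using \<delta> \<delta>'(1) by (auto simp: d_def)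
    let ?v = "conv (moll d) w" and ?r = "\<lambda>x. w x - conv (moll d) w x"
    have v: "tf ?v" by (rule tf_conv[OF m[OF d(1)] w])
    have r: "L2c ?r" by (intro L2c_diff w tf_L2c v)
    have "Rcom (moll e) a \<nu> (\<lambda>x. ?v x + ?r x) = (\<lambda>x. Rcom (moll e) a \<nu> ?v x + Rcom (moll e) a \<nu> ?r x)"
      by (rule ext) (rule Rcom_add[OF m[OF e] a tf_L2c[OF v] r])
    moreover have "(\<lambda>x. ?v x + ?r x) = w" by simp
    ultimately have Req: "Rcom (moll e) a \<nu> w = (\<lambda>x. Rcom (moll e) a \<nu> ?v x + Rcom (moll e) a \<nu> ?r x)"
      by (simp only:)
    have "sobn s (Rcom (moll e) a \<nu> w) \<le> 2 * sobn s (Rcom (moll e) a \<nu> ?v) + 2 * sobn s (Rcom (moll e) a \<nu> ?r)"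
      unfolding Req by (rule sobn_add[OF tf_Rcom[OF m[OF e] a tf_L2c[OF v]] tf_Rcom[OF m[OF e] a r]])
    moreover have "sobn s (Rcom (moll e) a \<nu> ?v) \<le> C * M"
      using C(2)[OF e v] mult_left_mono[OF M[OF d(1,2)] C(1)] by linarith
    moreover have "sobn s (Rcom (moll e) a \<nu> ?r) \<le> C' * (\<eta> / (2 * C' + 1))"
    proof -
      have "L2sq ?r = L2sq (\<lambda>x. conv (moll d) w x - w x)" by (simp add: L2sq_def norm_minus_commute)
      then show ?thesis using C'(2)[OF r] mult_left_mono[OF \<delta>'(2)[OF d(1,3)] C'(1)] by simp
    qed
    moreover have "2 * (C' * (\<eta> / (2 * C' + 1))) \<le> \<eta>"
      using C'(1) \<eta> by (simp add: field_simps)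
    ultimately show "sobn s (Rcom (moll e) a \<nu> w) \<le> (2 * C) * M + \<eta>" by linarith
  qed
  then show ?thesis using C(1) by (intro exI[of _ "2 * C"]) auto
qed

subsection \<open>The elliptic estimate for test functions\<close>

declare sobn.simps(2) [simp del]

text \<open>The weight \<open>t\<close> stays free: the energy estimate takes \<open>t = c\<close>
  to absorb the gradient, and optimising over \<open>t\<close> yields Cauchy-Schwarz.\<close>

lemma L2_pairing:
  assumes "L2c f" "L2c g" "t > 0"
  shows "norm (\<integral>x. f x * cnj (g x) \<partial>lborel) \<le> 1 / (2 * t) * L2sq f + t / 2 * L2sq g"
proof -
  have i: "integrable lborel (\<lambda>x. 1 / (2 * t) * (norm (f x))\<^sup>2 + t / 2 * (norm (g x))\<^sup>2)"
    by (intro Bochner_Integration.integrable_add integrable_mult_right L2cD(2) assms)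
  have le: "norm (f x * cnj (g x)) \<le> 1 / (2 * t) * (norm (f x))\<^sup>2 + t / 2 * (norm (g x))\<^sup>2" for x
  proof -
    have "0 \<le> (norm (f x) - t * norm (g x))\<^sup>2 / (2 * t)" using assms(3) by simp
    also have "\<dots> = 1 / (2 * t) * (norm (f x))\<^sup>2 + t / 2 * (norm (g x))\<^sup>2 - norm (f x) * norm (g x)"
      using assms(3) by (simp add: field_simps power2_eq_square)
    finally show ?thesis by (simp add: norm_mult)
  qed
  have "norm (\<integral>x. f x * cnj (g x) \<partial>lborel) \<le> (\<integral>x. 1 / (2 * t) * (norm (f x))\<^sup>2 + t / 2 * (norm (g x))\<^sup>2 \<partial>lborel)"
  proof (rule order_trans[OF integral_norm_bound])
    have [measurable]: "f \<in> borel_measurable borel" "g \<in> borel_measurable borel" using assms by auto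
    have [measurable]: "cnj \<in> borel_measurable borel"
      by (intro borel_measurable_continuous_onI continuous_on_cnj continuous_on_id)
    have "integrable lborel (\<lambda>x. f x * cnj (g x))"
    proof (rule Bochner_Integration.integrable_bound[OF i])
      show "(\<lambda>x. f x * cnj (g x)) \<in> borel_measurable lborel" by measurable
      show "AE x in lborel. norm (f x * cnj (g x)) \<le> norm (1 / (2 * t) * (norm (f x))\<^sup>2 + t / 2 * (norm (g x))\<^sup>2)"
        by (rule AE_I2) (rule order_trans[OF le], simp)
    qed
    then show "(\<integral>x. norm (f x * cnj (g x)) \<partial>lborel) \<le> (\<integral>x. 1 / (2 * t) * (norm (f x))\<^sup>2 + t / 2 * (norm (g x))\<^sup>2 \<partial>lborel)"
      by (intro integral_mono i le integrable_norm)
  qed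
  also have "\<dots> = 1 / (2 * t) * L2sq f + t / 2 * L2sq g"
    unfolding L2sq_def
    using Bochner_Integration.integral_add[OF integrable_mult_right[OF L2cD(2)[OF assms(1)], of "1 / (2 * t)"]
        integrable_mult_right[OF L2cD(2)[OF assms(2)], of "t / 2"]]
    by simp
  finally show ?thesis .
qed

text \<open>The coefficients are already cut off, hence global test functions; ellipticity then
  survives only on \<open>Om\<close>, which is enough for functions supported there.\<close>

locale elliptic =
  fixes a :: "'n::finite \<Rightarrow> 'n \<Rightarrow> real^'n \<Rightarrow> complex" and Om :: "(real^'n) set" and c :: real
  assumes tfa: "\<And>\<mu> \<nu>. tf (a \<mu> \<nu>)" and c_pos: "c > 0" and open_Om: "open Om"
    and ell: "\<And>x \<xi>. x \<in> Om \<Longrightarrow> c * (\<Sum>\<mu>\<in>UNIV. (cmod (\<xi> $ \<mu>))\<^sup>2)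
       \<le> Re (\<Sum>\<mu>\<in>UNIV. \<Sum>\<nu>\<in>UNIV. a \<mu> \<nu> x * cnj (\<xi> $ \<mu>) * \<xi> $ \<nu>)"
begin

definition flux :: "'n \<Rightarrow> (real^'n \<Rightarrow> complex) \<Rightarrow> real^'n \<Rightarrow> complex" where
  "flux \<mu> v x = (\<Sum>\<nu>\<in>UNIV. a \<mu> \<nu> x * partial \<nu> v x)"

lemma tf_flux: "tf v \<Longrightarrow> tf (flux \<mu> v)"
  unfolding flux_def[abs_def] by (intro test_fun_sum test_fun_mult[where \<Omega>'=UNIV] tfa test_fun_partial)

text \<open>For a second-order operator in divergence form coercivity is pointwise: insert the
  gradient of \<open>v\<close> as \<open>\<xi>\<close>. Outside \<open>Om\<close> the gradient
  vanishes. No lower-order error term arises.\<close>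

lemma garding:
  assumes v: "test_fun Om v"
  shows "c * (\<Sum>\<mu>\<in>UNIV. L2sq (partial \<mu> v)) \<le> Re (\<Sum>\<mu>\<in>UNIV. \<integral>x. flux \<mu> v x * cnj (partial \<mu> v x) \<partial>lborel)"
proof -
  have tv: "tf v" using v by (rule test_fun_tf)
  have i1: "integrable lborel (\<lambda>x. (norm (partial \<mu> v x))\<^sup>2)" for \<mu>
    by (rule L2cD(2)[OF tf_L2c[OF test_fun_partial[OF tv]]])
  have i2: "integrable lborel (\<lambda>x. flux \<mu> v x * cnj (partial \<mu> v x))" for \<mu>
    by (intro tf_integrable test_fun_mult[where \<Omega>'=UNIV] tf_flux tf_cnj test_fun_partial tv)
  have "c * (\<Sum>\<mu>\<in>UNIV. L2sq (partial \<mu> v)) = (\<integral>x. c * (\<Sum>\<mu>\<in>UNIV. (norm (partial \<mu> v x))\<^sup>2) \<partial>lborel)"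
    unfolding L2sq_def by (subst Bochner_Integration.integral_sum[symmetric]) (auto simp: i1)
  also have "\<dots> \<le> (\<integral>x. Re (\<Sum>\<mu>\<in>UNIV. flux \<mu> v x * cnj (partial \<mu> v x)) \<partial>lborel)"
  proof (rule integral_mono)
    show "integrable lborel (\<lambda>x. c * (\<Sum>\<mu>\<in>UNIV. (norm (partial \<mu> v x))\<^sup>2))"
      by (intro integrable_mult_right Bochner_Integration.integrable_sum i1)
    show "integrable lborel (\<lambda>x. Re (\<Sum>\<mu>\<in>UNIV. flux \<mu> v x * cnj (partial \<mu> v x)))"
      by (intro integrable_Re Bochner_Integration.integrable_sum i2)
    fix x
    show "c * (\<Sum>\<mu>\<in>UNIV. (norm (partial \<mu> v x))\<^sup>2) \<le> Re (\<Sum>\<mu>\<in>UNIV. flux \<mu> v x * cnj (partial \<mu> v x))"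
    proof (cases "x \<in> Om")
      case True
      have "(\<Sum>\<mu>\<in>UNIV. flux \<mu> v x * cnj (partial \<mu> v x))
          = (\<Sum>\<mu>\<in>UNIV. \<Sum>\<nu>\<in>UNIV. a \<mu> \<nu> x * cnj ((\<chi> \<mu>. partial \<mu> v x) $ \<mu>) * (\<chi> \<mu>. partial \<mu> v x) $ \<nu>)"
        unfolding flux_def sum_distrib_right by (intro sum.cong refl) (simp add: mult_ac)
      then show ?thesis using ell[OF True, of "\<chi> \<mu>. partial \<mu> v x"] by simp
    next
      case False
      then have "x \<notin> closure {x. v x \<noteq> 0}" using v unfolding test_fun_def by blast
      then have "partial \<mu> v x = 0" for \<mu> by (rule zero_outside_closure_support)
      then show ?thesis by simp
    qed
  qed
  also have "\<dots> = Re (\<integral>x. (\<Sum>\<mu>\<in>UNIV. flux \<mu> v x * cnj (partial \<mu> v x)) \<partial>lborel)"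
    by (rule integral_Re) (intro Bochner_Integration.integrable_sum i2)
  also have "(\<integral>x. (\<Sum>\<mu>\<in>UNIV. flux \<mu> v x * cnj (partial \<mu> v x)) \<partial>lborel) = (\<Sum>\<mu>\<in>UNIV. \<integral>x. flux \<mu> v x * cnj (partial \<mu> v x) \<partial>lborel)"
    by (rule Bochner_Integration.integral_sum[OF i2])
  finally show ?thesis .
qed

text \<open>Pair the equation with the conjugate of \<open>v\<close> and integrate by parts; the
  source \<open>\<partial>G\<close> then meets only the gradient of \<open>v\<close>, so
  \<open>G\<close> itself, without derivatives, enters the bound.\<close>

lemma energy_estimate:
  assumes v: "test_fun Om v" and G0: "tf G0" and G: "\<And>\<mu>. tf (G \<mu>)"
    and eq: "\<And>x. (\<Sum>\<mu>\<in>UNIV. partial \<mu> (flux \<mu> v) x) = G0 x + (\<Sum>\<mu>\<in>UNIV. partial \<mu> (G \<mu>) x)"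
  shows "sobn (Suc 0) v \<le> (1 + 1 / c + 1 / c\<^sup>2) * (L2sq G0 + (\<Sum>\<mu>\<in>UNIV. L2sq (G \<mu>)) + L2sq v)"
proof -
  have tv: "tf v" using v by (rule test_fun_tf)
  have tc: "tf (\<lambda>x. cnj (v x))" by (rule tf_cnj[OF tv])
  have parts: "(\<integral>x. h x * cnj (partial \<mu> v x) \<partial>lborel) = - (\<integral>x. partial \<mu> h x * cnj (v x) \<partial>lborel)" if "tf h" for h \<mu>
    using integral_by_parts[OF that tc, of \<mu>] by (simp add: partial_cnj[OF tv])
  have ig: "integrable lborel (\<lambda>x. partial \<mu> h x * cnj (v x))" "integrable lborel (\<lambda>x. h x * cnj (v x))" if "tf h" for h \<mu>
    by (intro tf_integrable test_fun_mult[where \<Omega>'=UNIV] test_fun_partial that tc)+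
  have "(\<Sum>\<mu>\<in>UNIV. \<integral>x. flux \<mu> v x * cnj (partial \<mu> v x) \<partial>lborel) = - (\<integral>x. (\<Sum>\<mu>\<in>UNIV. partial \<mu> (flux \<mu> v) x * cnj (v x)) \<partial>lborel)"
    by (subst Bochner_Integration.integral_sum[OF ig(1)[OF tf_flux[OF tv]]])
       (simp only: parts[OF tf_flux[OF tv]] sum_negf)
  also have "(\<integral>x. (\<Sum>\<mu>\<in>UNIV. partial \<mu> (flux \<mu> v) x * cnj (v x)) \<partial>lborel)
      = (\<integral>x. G0 x * cnj (v x) + (\<Sum>\<mu>\<in>UNIV. partial \<mu> (G \<mu>) x * cnj (v x)) \<partial>lborel)"
    by (simp only: sum_distrib_right[symmetric] eq distrib_right[symmetric])
  also have "\<dots> = (\<integral>x. G0 x * cnj (v x) \<partial>lborel) + (\<Sum>\<mu>\<in>UNIV. \<integral>x. partial \<mu> (G \<mu>) x * cnj (v x) \<partial>lborel)"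
    by (subst Bochner_Integration.integral_add[OF ig(2)[OF G0] Bochner_Integration.integrable_sum[OF ig(1)[OF G]]])
       (simp only: Bochner_Integration.integral_sum[OF ig(1)[OF G]])
  also have "- \<dots> = (\<Sum>\<mu>\<in>UNIV. \<integral>x. G \<mu> x * cnj (partial \<mu> v x) \<partial>lborel) - (\<integral>x. G0 x * cnj (v x) \<partial>lborel)"
    by (simp only: parts[OF G] sum_negf) simp
  finally have E: "(\<Sum>\<mu>\<in>UNIV. \<integral>x. flux \<mu> v x * cnj (partial \<mu> v x) \<partial>lborel)
     = (\<Sum>\<mu>\<in>UNIV. \<integral>x. G \<mu> x * cnj (partial \<mu> v x) \<partial>lborel) - (\<integral>x. G0 x * cnj (v x) \<partial>lborel)" .
  let ?P = "\<Sum>\<mu>\<in>UNIV. L2sq (partial \<mu> v)" and ?Q = "\<Sum>\<mu>\<in>UNIV. L2sq (G \<mu>)"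
  \<comment> \<open>With weight \<open>c\<close> half of the coercive term \<open>c * ?P\<close> is
    consumed; the other half remains on the left.\<close>
  have "norm (\<Sum>\<mu>\<in>UNIV. \<integral>x. G \<mu> x * cnj (partial \<mu> v x) \<partial>lborel) \<le> (\<Sum>\<mu>\<in>UNIV. 1 / (2 * c) * L2sq (G \<mu>) + c / 2 * L2sq (partial \<mu> v))"
    by (intro sum_norm_le L2_pairing tf_L2c test_fun_partial tv G c_pos)
  also have "\<dots> = 1 / (2 * c) * ?Q + c / 2 * ?P"
    by (simp only: sum.distrib sum_distrib_left)
  finally have 1: "norm (\<Sum>\<mu>\<in>UNIV. \<integral>x. G \<mu> x * cnj (partial \<mu> v x) \<partial>lborel) \<le> 1 / (2 * c) * ?Q + c / 2 * ?P" .
  have 2: "norm (\<integral>x. G0 x * cnj (v x) \<partial>lborel) \<le> 1 / (2 * 1) * L2sq G0 + 1 / 2 * L2sq v"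
    by (intro L2_pairing tf_L2c tv G0) simp
  have "c * ?P \<le> norm ((\<Sum>\<mu>\<in>UNIV. \<integral>x. G \<mu> x * cnj (partial \<mu> v x) \<partial>lborel) - (\<integral>x. G0 x * cnj (v x) \<partial>lborel))"
    using garding[OF v] complex_Re_le_cmod unfolding E by (rule order_trans)
  also have "\<dots> \<le> (1 / (2 * c) * ?Q + c / 2 * ?P) + (1 / (2 * 1) * L2sq G0 + 1 / 2 * L2sq v)"
    by (rule norm_triangle_le_diff[OF add_mono[OF 1 2]])
  finally have "c / 2 * ?P \<le> 1 / (2 * c) * ?Q + (1 / 2 * L2sq G0 + 1 / 2 * L2sq v)"
    by simp
  then have "2 / c * (c / 2 * ?P) \<le> 2 / c * (1 / (2 * c) * ?Q + (1 / 2 * L2sq G0 + 1 / 2 * L2sq v))"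
    using c_pos by (intro mult_left_mono) auto
  also have "2 / c * (c / 2 * ?P) = ?P" using c_pos by simp
  also have "2 / c * (1 / (2 * c) * ?Q + (1 / 2 * L2sq G0 + 1 / 2 * L2sq v)) = 1 / c\<^sup>2 * ?Q + 1 / c * (L2sq G0 + L2sq v)"
    using c_pos by (simp add: field_simps power2_eq_square)
  finally have "?P \<le> 1 / c\<^sup>2 * ?Q + 1 / c * (L2sq G0 + L2sq v)" .
  moreover have "0 \<le> ?Q" by (intro sum_nonneg) simp
  moreover have "0 \<le> 1 / c * ?Q" "0 \<le> 1 / c\<^sup>2 * (L2sq G0 + L2sq v)"
    using c_pos \<open>0 \<le> ?Q\<close> by (intro mult_nonneg_nonneg; simp)+
  ultimately have "L2sq v + ?P \<le> (1 + 1 / c + 1 / c\<^sup>2) * (L2sq G0 + ?Q + L2sq v)"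
  proof -
    assume *: "?P \<le> 1 / c\<^sup>2 * ?Q + 1 / c * (L2sq G0 + L2sq v)" "0 \<le> ?Q" "0 \<le> 1 / c * ?Q"
      "0 \<le> 1 / c\<^sup>2 * (L2sq G0 + L2sq v)"
    have "(1 + 1 / c + 1 / c\<^sup>2) * (L2sq G0 + ?Q + L2sq v) = (L2sq v + (1 / c\<^sup>2 * ?Q + 1 / c * (L2sq G0 + L2sq v)))
        + (L2sq G0 + ?Q + 1 / c * ?Q + 1 / c\<^sup>2 * (L2sq G0 + L2sq v))"
      by (simp add: distrib_left distrib_right)
    then show ?thesis using * L2sq_nonneg[of G0] by linarith
  qed
  then show ?thesis by (simp add: sobn.simps(2))
qed

lemma flux_partial:
  assumes v: "tf v"
  shows "partial i (flux \<mu> v) = (\<lambda>x. (\<Sum>\<nu>\<in>UNIV. partial i (a \<mu> \<nu>) x * partial \<nu> v x) + flux \<mu> (partial i v) x)"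
proof -
  have "partial i (flux \<mu> v) = (\<lambda>x. \<Sum>\<nu>\<in>UNIV. partial i (\<lambda>x. a \<mu> \<nu> x * partial \<nu> v x) x)"
    unfolding flux_def[abs_def]
    by (rule partial_sum_tf) (intro test_fun_mult[where \<Omega>'=UNIV] tfa test_fun_partial v)
  also have "\<dots> = (\<lambda>x. \<Sum>\<nu>\<in>UNIV. partial i (a \<mu> \<nu>) x * partial \<nu> v x + a \<mu> \<nu> x * partial \<nu> (partial i v) x)"
    by (simp only: partial_mult_tf[OF tfa test_fun_partial[OF v]] partial_commute[OF v])
  finally show ?thesis by (simp only: sum.distrib flux_def)
qed

text \<open>Sources of the form G0 + div G are measured with one order less on \<open>G0\<close>
  than on \<open>G\<close>. At \<open>s = 0\<close> the truncated \<open>s - 1\<close> is 0, so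
  \<open>G0\<close> is then measured in the mean. The constant works for all solutions at
  once.\<close>

definition elliptic_const :: "nat \<Rightarrow> real \<Rightarrow> bool" where
  "elliptic_const s C \<longleftrightarrow> C \<ge> 0 \<and> (\<forall>v G0 G. test_fun Om v \<longrightarrow> tf G0 \<longrightarrow> (\<forall>\<mu>. tf (G \<mu>)) \<longrightarrow>
     (\<forall>x. (\<Sum>\<mu>\<in>UNIV. partial \<mu> (flux \<mu> v) x) = G0 x + (\<Sum>\<mu>\<in>UNIV. partial \<mu> (G \<mu>) x)) \<longrightarrow>
     sobn (Suc s) v \<le> C * (sobn (s - 1) G0 + (\<Sum>\<mu>\<in>UNIV. sobn s (G \<mu>)) + L2sq v))"

text \<open>Induction by differentiating the equation: \<open>partial i v\<close> solves the same
  equation, with the terms containing derivatives of the coefficients moved into the divergence.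
  Those terms contain one derivative of \<open>v\<close> and are bounded by the previous
  order.\<close>

lemma elliptic_estimate: "\<exists>C. elliptic_const s C"
proof (induction s)
  case 0
  show ?case
    unfolding elliptic_const_def
  proof (intro exI[of _ "1 + 1 / c + 1 / c\<^sup>2"] conjI allI impI)
    show "0 \<le> 1 + 1 / c + 1 / c\<^sup>2" using c_pos by simp
  next
    fix v G0 and G :: "'n \<Rightarrow> real^'n \<Rightarrow> complex"
    assume "test_fun Om v" "tf G0" "\<forall>\<mu>. tf (G \<mu>)"
      "\<forall>x. (\<Sum>\<mu>\<in>UNIV. partial \<mu> (flux \<mu> v) x) = G0 x + (\<Sum>\<mu>\<in>UNIV. partial \<mu> (G \<mu>) x)"
    then show "sobn (Suc 0) v \<le> (1 + 1 / c + 1 / c\<^sup>2) * (sobn (0 - 1) G0 + (\<Sum>\<mu>\<in>UNIV. sobn 0 (G \<mu>)) + L2sq v)"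
      using energy_estimate[of v G0 G] by (simp only: sobn.simps(1) diff_0_eq_0)
  qed
next
  case (Suc s)
  obtain C where "elliptic_const s C" using Suc.IH by blast
  then have C1: "C \<ge> 0" and C2: "\<forall>v G0 G. test_fun Om v \<longrightarrow> tf G0 \<longrightarrow> (\<forall>\<mu>. tf (G \<mu>)) \<longrightarrow>
     (\<forall>x. (\<Sum>\<mu>\<in>UNIV. partial \<mu> (flux \<mu> v) x) = G0 x + (\<Sum>\<mu>\<in>UNIV. partial \<mu> (G \<mu>) x)) \<longrightarrow>
     sobn (Suc s) v \<le> C * (sobn (s - 1) G0 + (\<Sum>\<mu>\<in>UNIV. sobn s (G \<mu>)) + L2sq v)"
    unfolding elliptic_const_def by (rule conjunct1, rule conjunct2)
  note C = C1 C2[rule_format]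
  \<comment> \<open>Choosing the constants as a function of both indices at once lets them be summed
    later.\<close>
  define D where "D i \<mu> = (SOME D. D \<ge> 0 \<and> (\<forall>v. tf v \<longrightarrow>
      sobn s (\<lambda>x. \<Sum>\<nu>\<in>UNIV. partial i (a \<mu> \<nu>) x * partial \<nu> v x) \<le> D * sobn (Suc s) v))" for i \<mu>
  have DD: "D i \<mu> \<ge> 0 \<and> (\<forall>v. tf v \<longrightarrow>
      sobn s (\<lambda>x. \<Sum>\<nu>\<in>UNIV. partial i (a \<mu> \<nu>) x * partial \<nu> v x) \<le> D i \<mu> * sobn (Suc s) v)" for i \<mu>
    unfolding D_def by (rule someI_ex) (intro sobn_mult_partial_sum test_fun_partial tfa)
  note D = DD[THEN conjunct1] DD[THEN conjunct2, rule_format]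
  define E where "E i = C * ((2 * real CARD('n) + 4 + 4 * ((\<Sum>\<mu>\<in>UNIV. D i \<mu>) * C)) + C)" for i
  have E0: "E i \<ge> 0" for i
    unfolding E_def using C(1) D(1) by (intro mult_nonneg_nonneg add_nonneg_nonneg sum_nonneg) auto
  show ?case
    unfolding elliptic_const_def
  proof (intro exI[of _ "1 + (\<Sum>i\<in>UNIV. E i)"] conjI allI impI)
    show "0 \<le> 1 + (\<Sum>i\<in>UNIV. E i)" using E0 by (intro add_nonneg_nonneg sum_nonneg) auto
  next
    fix v G0 and G :: "'n \<Rightarrow> real^'n \<Rightarrow> complex"
    assume v: "test_fun Om v" and G0: "tf G0" and G': "\<forall>\<mu>. tf (G \<mu>)"
      and eq': "\<forall>x. (\<Sum>\<mu>\<in>UNIV. partial \<mu> (flux \<mu> v) x) = G0 x + (\<Sum>\<mu>\<in>UNIV. partial \<mu> (G \<mu>) x)"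
    have G: "tf (G \<mu>)" for \<mu> using G' by blast
    have eq: "(\<lambda>x. \<Sum>\<mu>\<in>UNIV. partial \<mu> (flux \<mu> v) x) = (\<lambda>x. G0 x + (\<Sum>\<mu>\<in>UNIV. partial \<mu> (G \<mu>) x))"
      using eq' by blast
    have tv: "tf v" using v by (rule test_fun_tf)
    let ?X = "sobn s G0 + (\<Sum>\<mu>\<in>UNIV. sobn (Suc s) (G \<mu>)) + L2sq v"
    have X0: "0 \<le> ?X" by (intro add_nonneg_nonneg sum_nonneg) auto
    have parts: "sobn s G0 \<le> ?X" "(\<Sum>\<mu>\<in>UNIV. sobn (Suc s) (G \<mu>)) \<le> ?X" "L2sq v \<le> ?X"
      using sum_nonneg[of UNIV "\<lambda>\<mu>. sobn (Suc s) (G \<mu>)"] sobn_nonneg[of s G0] L2sq_nonneg[of v]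
      by simp_all
    have vX: "sobn (Suc s) v \<le> C * ?X"
    proof -
      have "sobn (Suc s) v \<le> C * (sobn (s - 1) G0 + (\<Sum>\<mu>\<in>UNIV. sobn s (G \<mu>)) + L2sq v)"
        by (rule C(2)[OF v G0 G]) (use eq' in blast)
      also have "\<dots> \<le> C * ?X"
        by (intro mult_left_mono add_mono sum_mono sobn_mono sobn_Suc_ge C(1)) auto
      finally show ?thesis .
    qed
    have main: "sobn (Suc s) (partial i v) \<le> E i * ?X" for i
    proof -
      let ?K = "\<lambda>\<mu> x. \<Sum>\<nu>\<in>UNIV. partial i (a \<mu> \<nu>) x * partial \<nu> v x"
      \<comment> \<open>The derivative of \<open>G0\<close> is not taken as a new \<open>G0\<close>
        but written as the divergence of the field with \<open>G0\<close> in component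
        \<open>i\<close>; this keeps the cost at order \<open>s\<close> of
        \<open>G0\<close>.\<close>
      let ?H = "\<lambda>\<mu> x. if \<mu> = i then G0 x else 0"
      let ?G = "\<lambda>\<mu> x. ?H \<mu> x + (partial i (G \<mu>) x - ?K \<mu> x)"
      have tK: "tf (?K \<mu>)" for \<mu> by (intro test_fun_sum test_fun_mult[where \<Omega>'=UNIV] test_fun_partial tfa tv)
      have tH: "tf (?H \<mu>)" for \<mu> using G0 by (cases "\<mu> = i") auto
      have tpG: "tf (partial i (G \<mu>))" for \<mu> by (intro test_fun_partial G)
      have tG: "tf (?G \<mu>)" for \<mu> by (intro test_fun_add test_fun_diff tH tK tpG)
      have eqi: "(\<Sum>\<mu>\<in>UNIV. partial \<mu> (flux \<mu> (partial i v)) x) = 0 + (\<Sum>\<mu>\<in>UNIV. partial \<mu> (?G \<mu>) x)" for x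
      proof -
        have "partial i (\<lambda>x. \<Sum>\<mu>\<in>UNIV. partial \<mu> (flux \<mu> v) x) x = (\<Sum>\<mu>\<in>UNIV. partial i (partial \<mu> (flux \<mu> v)) x)"
          by (rule fun_cong[OF partial_sum_tf]) (intro test_fun_partial tf_flux tv)
        also have "\<dots> = (\<Sum>\<mu>\<in>UNIV. partial \<mu> (?K \<mu>) x + partial \<mu> (flux \<mu> (partial i v)) x)"
        proof (rule sum.cong[OF refl])
          fix \<mu>
          have "partial i (partial \<mu> (flux \<mu> v)) x = partial \<mu> (partial i (flux \<mu> v)) x"
            by (rule partial_commute[OF tf_flux[OF tv]])
          also have "\<dots> = partial \<mu> (?K \<mu>) x + partial \<mu> (flux \<mu> (partial i v)) x"
            unfolding flux_partial[OF tv]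
            by (rule fun_cong[OF partial_add_tf[OF tK tf_flux[OF test_fun_partial[OF tv]]]])
          finally show "partial i (partial \<mu> (flux \<mu> v)) x = partial \<mu> (?K \<mu>) x + partial \<mu> (flux \<mu> (partial i v)) x" .
        qed
        finally have L: "partial i (\<lambda>x. \<Sum>\<mu>\<in>UNIV. partial \<mu> (flux \<mu> v) x) x
          = (\<Sum>\<mu>\<in>UNIV. partial \<mu> (?K \<mu>) x) + (\<Sum>\<mu>\<in>UNIV. partial \<mu> (flux \<mu> (partial i v)) x)"
          by (simp only: sum.distrib)
        have "partial i (\<lambda>x. G0 x + (\<Sum>\<mu>\<in>UNIV. partial \<mu> (G \<mu>) x)) x
            = partial i G0 x + (\<Sum>\<mu>\<in>UNIV. partial i (partial \<mu> (G \<mu>)) x)"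
          by (subst partial_add_tf[OF G0 test_fun_sum[OF test_fun_partial[OF G]]])
             (simp only: partial_sum_tf[OF test_fun_partial[OF G]])
        also have "\<dots> = (\<Sum>\<mu>\<in>UNIV. partial \<mu> (?H \<mu>) x) + (\<Sum>\<mu>\<in>UNIV. partial \<mu> (partial i (G \<mu>)) x)"
        proof -
          have "partial \<mu> (?H \<mu>) x = (if \<mu> = i then partial i G0 x else 0)" for \<mu>
            by (cases "\<mu> = i") auto
          then have "(\<Sum>\<mu>\<in>UNIV. partial \<mu> (?H \<mu>) x) = partial i G0 x" by (simp only:) simp
          moreover have "(\<Sum>\<mu>\<in>UNIV. partial i (partial \<mu> (G \<mu>)) x) = (\<Sum>\<mu>\<in>UNIV. partial \<mu> (partial i (G \<mu>)) x)"
            by (rule sum.cong[OF refl]) (rule partial_commute[OF G])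
          ultimately show ?thesis by (simp only:)
        qed
        finally have R: "partial i (\<lambda>x. G0 x + (\<Sum>\<mu>\<in>UNIV. partial \<mu> (G \<mu>) x)) x
          = (\<Sum>\<mu>\<in>UNIV. partial \<mu> (?H \<mu>) x) + (\<Sum>\<mu>\<in>UNIV. partial \<mu> (partial i (G \<mu>)) x)" .
        have "(\<Sum>\<mu>\<in>UNIV. partial \<mu> (?G \<mu>) x) = (\<Sum>\<mu>\<in>UNIV. partial \<mu> (?H \<mu>) x + (partial \<mu> (partial i (G \<mu>)) x - partial \<mu> (?K \<mu>) x))"
          by (simp only: partial_add_tf[OF tH test_fun_diff[OF tpG tK]] partial_diff_tf[OF tpG tK])
        also have "\<dots> = (\<Sum>\<mu>\<in>UNIV. partial \<mu> (?H \<mu>) x) + ((\<Sum>\<mu>\<in>UNIV. partial \<mu> (partial i (G \<mu>)) x) - (\<Sum>\<mu>\<in>UNIV. partial \<mu> (?K \<mu>) x))"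
          by (simp only: sum.distrib sum_subtractf)
        finally have S: "(\<Sum>\<mu>\<in>UNIV. partial \<mu> (?G \<mu>) x) = \<dots>" .
        have alg: "f = h + (p - k)" if "k + f = h + p" for k f h p :: complex
          using that by (metis add_diff_cancel_left' add_diff_eq)
        show ?thesis
          unfolding S add_0 by (rule alg[OF trans[OF L[unfolded eq, symmetric] R]])
      qed
      have A1: "sobn (Suc s) (partial i v) \<le> C * (sobn (s - 1) (\<lambda>x::real^'n. 0) + (\<Sum>\<mu>\<in>UNIV. sobn s (?G \<mu>)) + L2sq (partial i v))"
        by (rule C2[rule_format, of "partial i v" "\<lambda>x. 0" "?G"])
           (rule test_fun_partial[OF v] test_fun_zero tG eqi)+
      have A2: "(\<Sum>\<mu>\<in>UNIV. sobn s (?G \<mu>)) \<le> (2 * real CARD('n) + 4 + 4 * ((\<Sum>\<mu>\<in>UNIV. D i \<mu>) * C)) * ?X"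
      proof -
        have "sobn s (?G \<mu>) \<le> 2 * sobn s G0 + 4 * sobn (Suc s) (G \<mu>) + 4 * (D i \<mu> * sobn (Suc s) v)" for \<mu>
        proof -
          have "sobn s (?G \<mu>) \<le> 2 * sobn s (?H \<mu>) + 2 * sobn s (\<lambda>x. partial i (G \<mu>) x - ?K \<mu> x)"
            by (intro sobn_add tH test_fun_diff tpG tK)
          moreover have "sobn s (\<lambda>x. partial i (G \<mu>) x - ?K \<mu> x) \<le> 2 * sobn s (partial i (G \<mu>)) + 2 * sobn s (?K \<mu>)"
            by (intro sobn_diff tpG tK)
          moreover have "sobn s (?H \<mu>) \<le> sobn s G0" by (cases "\<mu> = i") auto
          moreover have "sobn s (partial i (G \<mu>)) \<le> sobn (Suc s) (G \<mu>)" by (rule sobn_partial)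
          moreover have "sobn s (?K \<mu>) \<le> D i \<mu> * sobn (Suc s) v" by (rule D(2)[OF tv])
          ultimately show ?thesis by linarith
        qed
        then have "(\<Sum>\<mu>\<in>UNIV. sobn s (?G \<mu>)) \<le> (\<Sum>\<mu>\<in>UNIV. 2 * sobn s G0 + 4 * sobn (Suc s) (G \<mu>) + 4 * (D i \<mu> * sobn (Suc s) v))"
          by (intro sum_mono)
        also have "\<dots> = 2 * real CARD('n) * sobn s G0 + 4 * (\<Sum>\<mu>\<in>UNIV. sobn (Suc s) (G \<mu>)) + 4 * ((\<Sum>\<mu>\<in>UNIV. D i \<mu>) * sobn (Suc s) v)"
          by (simp add: sum.distrib sum_distrib_left sum_distrib_right)
        also have "\<dots> \<le> 2 * real CARD('n) * ?X + 4 * ?X + 4 * ((\<Sum>\<mu>\<in>UNIV. D i \<mu>) * (C * ?X))"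
          by (intro add_mono mult_left_mono parts vX sum_nonneg D) auto
        also have "\<dots> = (2 * real CARD('n) + 4 + 4 * ((\<Sum>\<mu>\<in>UNIV. D i \<mu>) * C)) * ?X"
          by (simp only: distrib_right mult.assoc)
        finally show ?thesis .
      qed
      have A3: "L2sq (partial i v) \<le> C * ?X"
        using L2sq_le_sobn[of "partial i v" s] sobn_partial[of s i v] vX by linarith
      have "sobn (Suc s) (partial i v) \<le> C * (0 + (2 * real CARD('n) + 4 + 4 * ((\<Sum>\<mu>\<in>UNIV. D i \<mu>) * C)) * ?X + C * ?X)"
        by (rule order_trans[OF A1]) (intro mult_left_mono add_mono C(1) A2 A3, simp)
      then show ?thesis unfolding E_def by (simp only: distrib_right mult.assoc add_0)
    qed
    have "(\<Sum>i\<in>UNIV. sobn (Suc s) (partial i v)) \<le> (\<Sum>i\<in>UNIV. E i * ?X)"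
      by (intro sum_mono main)
    then have "L2sq v + (\<Sum>i\<in>UNIV. sobn (Suc s) (partial i v)) \<le> 1 * ?X + (\<Sum>i\<in>UNIV. E i) * ?X"
      using parts(3) unfolding sum_distrib_right mult_1 by (rule add_mono[rotated])
    then show "sobn (Suc (Suc s)) v \<le> (1 + (\<Sum>i\<in>UNIV. E i)) * (sobn (Suc s - 1) G0 + (\<Sum>\<mu>\<in>UNIV. sobn (Suc s) (G \<mu>)) + L2sq v)"
      by (simp only: sobn.simps(2)[of "Suc s"] distrib_right[symmetric] diff_Suc_1)
  qed
qed

end

subsection \<open>Interior regularity\<close>

text \<open>Membership in the Sobolev space of order \<open>s\<close>, uniformly for a family \<open>w\<close>, is expressed through
  bounds on mollifications; no weak derivatives are needed.\<close>
definition Hb :: "nat \<Rightarrow> ('i \<Rightarrow> real^'n::finite \<Rightarrow> complex) \<Rightarrow> bool" where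
  "Hb s w \<longleftrightarrow> (\<exists>M \<delta>. \<delta> > 0 \<and> (\<forall>n e. 0 < e \<longrightarrow> e < \<delta> \<longrightarrow> sobn s (conv (moll e) (w n)) \<le> M))"

definition Hbloc :: "(real^'n::finite) set \<Rightarrow> nat \<Rightarrow> ('i \<Rightarrow> real^'n \<Rightarrow> complex) \<Rightarrow> bool" where
  "Hbloc Om s u \<longleftrightarrow> (\<forall>\<psi>. test_fun Om \<psi> \<longrightarrow> Hb s (\<lambda>n x. \<psi> x * u n x))"

lemma HbE:
  assumes "Hb s w"
  obtains M \<delta> where "\<delta> > 0" "\<And>n e. 0 < e \<Longrightarrow> e < \<delta> \<Longrightarrow> sobn s (conv (moll e) (w n)) \<le> M"
  using assms unfolding Hb_def by auto

lemma Hb_mono: "s \<le> t \<Longrightarrow> Hb t w \<Longrightarrow> Hb s w"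
  unfolding Hb_def using sobn_mono order_trans by meson

lemma Hbloc_mono: "s \<le> t \<Longrightarrow> Hbloc Om t u \<Longrightarrow> Hbloc Om s u"
  unfolding Hbloc_def using Hb_mono by blast

lemma Hb_uniform:
  fixes W :: "'k::finite \<Rightarrow> 'i \<Rightarrow> real^'n::finite \<Rightarrow> complex"
  assumes "\<And>\<mu>. Hb s (W \<mu>)"
  obtains M \<delta> where "\<delta> > 0" "\<And>\<mu> n e. 0 < e \<Longrightarrow> e < \<delta> \<Longrightarrow> sobn s (conv (moll e) (W \<mu> n)) \<le> M"
proof -
  have "\<forall>\<mu>. \<exists>M \<delta>. \<delta> > 0 \<and> (\<forall>n e. 0 < e \<longrightarrow> e < \<delta> \<longrightarrow> sobn s (conv (moll e) (W \<mu> n)) \<le> M)"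
    using assms unfolding Hb_def by blast
  then obtain M \<delta> where M: "\<And>\<mu>. \<delta> \<mu> > 0" "\<And>\<mu> n e. 0 < e \<Longrightarrow> e < \<delta> \<mu> \<Longrightarrow> sobn s (conv (moll e) (W \<mu> n)) \<le> M \<mu>"
    by metis
  show ?thesis
  proof (rule that[of "Min (range \<delta>)" "Max (range M)"])
    show "Min (range \<delta>) > 0" using M(1) by (subst Min_gr_iff) auto
    fix \<mu> n and e :: real assume e: "0 < e" "e < Min (range \<delta>)"
    then have "e < \<delta> \<mu>" using Min_le[of "range \<delta>" "\<delta> \<mu>"] by simp
    from M(2)[OF e(1) this] show "sobn s (conv (moll e) (W \<mu> n)) \<le> Max (range M)"
      using Max_ge[of "range M" "M \<mu>"] by (meson finite finite_imageI order_trans rangeI)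
  qed
qed

lemma L2c_tf_integrable: "tf f \<Longrightarrow> L2c w \<Longrightarrow> integrable lborel (\<lambda>x. w x * f x)"
  using L2c_integrable[OF L2c_tf_mult] by (simp add: mult.commute)

text \<open>The admissible width depends on \<open>\<psi>\<close> only, hence is uniform over a
  whole family of \<open>u\<close>. It is a distance from the support of \<open>\<psi>\<close>
  within which one stays in \<open>Om\<close>.\<close>

lemma test_fun_conv:
  assumes \<psi>: "test_fun Om \<psi>" and Om: "open Om"
  shows "\<exists>\<delta>>0. \<forall>e. 0 < e \<longrightarrow> e < \<delta> \<longrightarrow> (\<forall>u. L2c (\<lambda>x. \<psi> x * u x) \<longrightarrow> test_fun Om (conv (moll e) (\<lambda>x. \<psi> x * u x)))"
proof -
  let ?K = "closure {x. \<psi> x \<noteq> 0}"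
  have K: "compact ?K" "?K \<subseteq> Om" using \<psi> by (auto simp: test_fun_def)
  from compact_subset_open_imp_ball_epsilon_subset[OF K(1) Om K(2)]
  obtain \<delta> where \<delta>: "\<delta> > 0" "(\<Union>x\<in>?K. ball x \<delta>) \<subseteq> Om" by auto
  show ?thesis
  proof (intro exI[of _ \<delta>] conjI allI impI)
    fix e :: real and u :: "real^'a \<Rightarrow> complex"
    assume e: "0 < e" "e < \<delta>" and u: "L2c (\<lambda>x. \<psi> x * u x)"
    let ?v = "conv (moll e) (\<lambda>x. \<psi> x * u x)"
    let ?C = "{x + y |x y. x \<in> ?K \<and> y \<in> cball 0 e}"
    have C: "compact ?C" by (intro compact_sums K compact_cball)
    show "test_fun Om ?v"
    proof (rule test_funI[where C="?C"])
      show "smooth_on UNIV ?v" by (rule tf_smooth[OF tf_conv[OF tf_moll[OF e(1)] u]])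
      show "{x. ?v x \<noteq> 0} \<subseteq> ?C"
      proof
        fix x assume "x \<in> {x. ?v x \<noteq> 0}"
        then obtain y where y: "moll e (x - y) \<noteq> 0" "\<psi> y * u y \<noteq> 0" using conv_support by blast
        then have "norm (x - y) < e" "y \<in> ?K"
          using moll_support[OF e(1)] closure_supportI[of \<psi> y] by auto
        then have "x = y + (x - y)" "y \<in> ?K" "x - y \<in> cball 0 e" by auto
        then show "x \<in> ?C" by blast
      qed
      show "closed ?C" "bounded ?C" using C compact_imp_closed compact_imp_bounded by blast+
      show "?C \<subseteq> Om"
      proof
        fix z assume "z \<in> ?C"
        then obtain x y where "z = x + y" "x \<in> ?K" "y \<in> cball 0 e" by blast
        then have "z \<in> ball x \<delta>" "x \<in> ?K" using e by (auto simp: dist_norm)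
        then show "z \<in> Om" using \<delta>(2) by blast
      qed
    qed
  qed (rule \<delta>)
qed

context elliptic
begin

text \<open>The transpose of the divergence part alone. The factor \<open>b\<close> of Lbar is
  absorbed by testing with \<open>\<beta> * \<phi>\<close>, where \<open>\<beta>\<close> is 1/b on
  the ball under consideration.\<close>

definition At :: "(real^'n \<Rightarrow> complex) \<Rightarrow> real^'n \<Rightarrow> complex" where
  "At \<phi> x = (\<Sum>\<nu>\<in>UNIV. \<Sum>\<mu>\<in>UNIV. partial \<nu> (\<lambda>y. a \<mu> \<nu> y * partial \<mu> \<phi> y) x)"

text \<open>Coefficients of the first-order part of the commutator of \<open>At\<close> with
  multiplication by \<open>\<psi>\<close>: either of the two derivatives in \<open>At\<close> may
  hit \<open>\<psi>\<close>, which yields both index orders of \<open>a\<close>.\<close>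

definition dd :: "(real^'n \<Rightarrow> complex) \<Rightarrow> 'n \<Rightarrow> real^'n \<Rightarrow> complex" where
  "dd \<psi> \<mu> x = (\<Sum>\<nu>\<in>UNIV. (a \<nu> \<mu> x + a \<mu> \<nu> x) * partial \<nu> \<psi> x)"

lemma tf_ap: "tf \<phi> \<Longrightarrow> tf (\<lambda>y. a \<mu> \<nu> y * partial \<rho> \<phi> y)"
  by (intro test_fun_mult[where \<Omega>'=UNIV] tfa test_fun_partial)

lemma test_fun_At: assumes "test_fun \<Omega> \<phi>" shows "test_fun \<Omega> (At \<phi>)"
  unfolding At_def[abs_def]
  by (intro test_fun_sum test_fun_partial test_fun_mult_right[where f="partial \<mu> \<phi>" for \<mu>] assms tf_smooth[OF tfa])

lemma test_fun_dd: assumes "test_fun \<Omega> \<psi>" shows "test_fun \<Omega> (dd \<psi> \<mu>)"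
  unfolding dd_def[abs_def]
  by (intro test_fun_sum test_fun_mult_right[where f="partial \<nu> \<psi>" for \<nu>] test_fun_partial assms
      tf_smooth test_fun_add tfa)

lemma At_product:
  assumes \<psi>: "tf \<psi>" and \<phi>: "tf \<phi>"
  shows "\<psi> x * At \<phi> x = At (\<lambda>x. \<psi> x * \<phi> x) x - At \<psi> x * \<phi> x - (\<Sum>\<mu>\<in>UNIV. dd \<psi> \<mu> x * partial \<mu> \<phi> x)"
proof -
  have summand: "partial \<nu> (\<lambda>y. a \<mu> \<nu> y * partial \<mu> (\<lambda>x. \<psi> x * \<phi> x) y) x
     = (partial \<nu> (\<lambda>y. a \<mu> \<nu> y * partial \<mu> \<psi> y) x * \<phi> x + a \<mu> \<nu> x * partial \<mu> \<psi> x * partial \<nu> \<phi> x)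
     + (a \<mu> \<nu> x * partial \<nu> \<psi> x * partial \<mu> \<phi> x + \<psi> x * partial \<nu> (\<lambda>y. a \<mu> \<nu> y * partial \<mu> \<phi> y) x)" for \<mu> \<nu>
  proof -
    let ?A = "\<lambda>y. a \<mu> \<nu> y * partial \<mu> \<psi> y" and ?B = "\<lambda>y. a \<mu> \<nu> y * partial \<mu> \<phi> y"
    have eq: "(\<lambda>y. a \<mu> \<nu> y * partial \<mu> (\<lambda>x. \<psi> x * \<phi> x) y) = (\<lambda>y. ?A y * \<phi> y + \<psi> y * ?B y)"
      unfolding partial_mult_tf[OF \<psi> \<phi>] by (simp add: algebra_simps)
    have t: "tf (\<lambda>y. ?A y * \<phi> y)" "tf (\<lambda>y. \<psi> y * ?B y)"
      by (intro test_fun_mult[where \<Omega>'=UNIV] tf_ap \<psi> \<phi>)+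
    have "partial \<nu> (\<lambda>y. ?A y * \<phi> y + \<psi> y * ?B y) x = (partial \<nu> ?A x * \<phi> x + ?A x * partial \<nu> \<phi> x) + (partial \<nu> \<psi> x * ?B x + \<psi> x * partial \<nu> ?B x)"
      by (simp only: partial_add_tf[OF t] partial_mult_tf[OF tf_ap[OF \<psi>] \<phi>] partial_mult_tf[OF \<psi> tf_ap[OF \<phi>]])
    then show ?thesis unfolding eq by (simp add: mult_ac)
  qed
  have 1: "At (\<lambda>x. \<psi> x * \<phi> x) x = (At \<psi> x * \<phi> x + (\<Sum>\<nu>\<in>UNIV. \<Sum>\<mu>\<in>UNIV. a \<mu> \<nu> x * partial \<mu> \<psi> x * partial \<nu> \<phi> x))
     + ((\<Sum>\<nu>\<in>UNIV. \<Sum>\<mu>\<in>UNIV. a \<mu> \<nu> x * partial \<nu> \<psi> x * partial \<mu> \<phi> x) + \<psi> x * At \<phi> x)"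
    unfolding At_def summand by (simp only: sum.distrib sum_distrib_left sum_distrib_right)
  have "(\<Sum>\<mu>\<in>UNIV. dd \<psi> \<mu> x * partial \<mu> \<phi> x)
     = (\<Sum>\<nu>\<in>UNIV. \<Sum>\<mu>\<in>UNIV. a \<mu> \<nu> x * partial \<mu> \<psi> x * partial \<nu> \<phi> x)
     + (\<Sum>\<mu>\<in>UNIV. \<Sum>\<nu>\<in>UNIV. a \<mu> \<nu> x * partial \<nu> \<psi> x * partial \<mu> \<phi> x)"
    by (simp only: dd_def distrib_right sum.distrib sum_distrib_right)
  also have "(\<Sum>\<mu>\<in>UNIV. \<Sum>\<nu>\<in>UNIV. a \<mu> \<nu> x * partial \<nu> \<psi> x * partial \<mu> \<phi> x)
     = (\<Sum>\<nu>\<in>UNIV. \<Sum>\<mu>\<in>UNIV. a \<mu> \<nu> x * partial \<nu> \<psi> x * partial \<mu> \<phi> x)"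
    by (rule sum.swap)
  finally show ?thesis using 1 by simp
qed

text \<open>After multiplication by \<open>\<psi>\<close> the weak equation may be tested with every
  \<open>\<phi>\<close>, because \<open>\<psi> * \<phi>\<close> is supported in \<open>Om\<close>.
  The first-order commutator keeps its derivative on \<open>\<phi>\<close>: it is a divergence, and
  \<open>u\<close> is not differentiated.\<close>

lemma localized_equation:
  assumes \<psi>: "test_fun Om \<psi>" and \<phi>: "tf \<phi>" and \<beta>: "tf \<beta>" and u: "L2c u" and g: "L2c g"
    and weak: "\<And>\<phi>. test_fun Om \<phi> \<Longrightarrow> (\<integral>x. g x * (\<beta> x * \<phi> x) \<partial>lborel) = (\<integral>x. u x * At \<phi> x \<partial>lborel)"
  shows "(\<integral>x. (\<psi> x * u x) * At \<phi> x \<partial>lborel)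
     = (\<integral>x. ((\<psi> x * \<beta> x) * g x - At \<psi> x * u x) * \<phi> x \<partial>lborel) - (\<Sum>\<mu>\<in>UNIV. \<integral>x. (dd \<psi> \<mu> x * u x) * partial \<mu> \<phi> x \<partial>lborel)"
proof -
  have tc: "tf \<psi>" by (rule test_fun_tf[OF \<psi>])
  have i1: "integrable lborel (\<lambda>x. u x * At (\<lambda>x. \<psi> x * \<phi> x) x)"
    by (intro L2c_tf_integrable test_fun_At test_fun_mult[where \<Omega>'=UNIV] tc \<phi> u)
  have i2: "integrable lborel (\<lambda>x. u x * (At \<psi> x * \<phi> x))"
    by (intro L2c_tf_integrable test_fun_mult[where \<Omega>'=UNIV] test_fun_At tc \<phi> u)
  have i3: "integrable lborel (\<lambda>x. u x * (dd \<psi> \<mu> x * partial \<mu> \<phi> x))" for \<mu>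
    by (intro L2c_tf_integrable test_fun_mult[where \<Omega>'=UNIV] test_fun_dd test_fun_partial tc \<phi> u)
  have i4: "integrable lborel (\<lambda>x. g x * (\<beta> x * (\<psi> x * \<phi> x)))"
    by (intro L2c_tf_integrable test_fun_mult[where \<Omega>'=UNIV] tc \<phi> \<beta> g)
  have pt: "(\<psi> x * u x) * At \<phi> x = (u x * At (\<lambda>x. \<psi> x * \<phi> x) x - u x * (At \<psi> x * \<phi> x)) - (\<Sum>\<mu>\<in>UNIV. u x * (dd \<psi> \<mu> x * partial \<mu> \<phi> x))" for x
  proof -
    have "(\<psi> x * u x) * At \<phi> x = u x * (\<psi> x * At \<phi> x)" by (simp add: mult_ac)
    also have "\<dots> = (u x * At (\<lambda>x. \<psi> x * \<phi> x) x - u x * (At \<psi> x * \<phi> x)) - (\<Sum>\<mu>\<in>UNIV. u x * (dd \<psi> \<mu> x * partial \<mu> \<phi> x))"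
      unfolding At_product[OF tc \<phi>] by (simp only: right_diff_distrib sum_distrib_left)
    finally show ?thesis .
  qed
  have "(\<integral>x. (\<psi> x * u x) * At \<phi> x \<partial>lborel) = ((\<integral>x. u x * At (\<lambda>x. \<psi> x * \<phi> x) x \<partial>lborel) - (\<integral>x. u x * (At \<psi> x * \<phi> x) \<partial>lborel))
      - (\<Sum>\<mu>\<in>UNIV. \<integral>x. u x * (dd \<psi> \<mu> x * partial \<mu> \<phi> x) \<partial>lborel)"
    unfolding pt
    by (simp only: Bochner_Integration.integral_diff[OF Bochner_Integration.integrable_diff[OF i1 i2] Bochner_Integration.integrable_sum[OF i3]]
        Bochner_Integration.integral_diff[OF i1 i2] Bochner_Integration.integral_sum[OF i3])
  also have "(\<integral>x. u x * At (\<lambda>x. \<psi> x * \<phi> x) x \<partial>lborel) = (\<integral>x. g x * (\<beta> x * (\<psi> x * \<phi> x)) \<partial>lborel)"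
    by (rule weak[symmetric]) (intro test_fun_mult[where \<Omega>'=UNIV] \<psi> \<phi>)
  also have "(\<integral>x. g x * (\<beta> x * (\<psi> x * \<phi> x)) \<partial>lborel) - (\<integral>x. u x * (At \<psi> x * \<phi> x) \<partial>lborel)
      = (\<integral>x. ((\<psi> x * \<beta> x) * g x - At \<psi> x * u x) * \<phi> x \<partial>lborel)"
    by (subst Bochner_Integration.integral_diff[OF i4 i2, symmetric]) (simp add: algebra_simps)
  finally show ?thesis by (simp add: mult_ac)
qed

text \<open>Testing with the reflected and translated kernel turns the weak equation into a
  pointwise one for \<open>conv k w\<close>. The price is the commutators \<open>Rcom\<close>, which
  appear inside the divergence.\<close>

lemma mollified_equation:
  assumes k: "tf k" and w: "L2c w" and g0: "L2c g0" and gm: "\<And>\<mu>. L2c (gm \<mu>)"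
    and weak: "\<And>\<phi>. tf \<phi> \<Longrightarrow> (\<integral>x. w x * At \<phi> x \<partial>lborel)
       = (\<integral>x. g0 x * \<phi> x \<partial>lborel) - (\<Sum>\<mu>\<in>UNIV. \<integral>x. gm \<mu> x * partial \<mu> \<phi> x \<partial>lborel)"
  shows "(\<Sum>\<mu>\<in>UNIV. partial \<mu> (flux \<mu> (conv k w)) x)
     = conv k g0 x + (\<Sum>\<mu>\<in>UNIV. partial \<mu> (\<lambda>y. conv k (gm \<mu>) y + (\<Sum>\<nu>\<in>UNIV. Rcom k (a \<mu> \<nu>) \<nu> w y)) x)"
proof -
  have tk: "tf (partial \<mu> k)" "tf (partial \<mu> (partial \<nu> k))" for \<mu> \<nu> by (intro test_fun_partial k)+
  have aw: "L2c (\<lambda>y. a \<mu> \<nu> y * w y)" "L2c (\<lambda>y. partial \<nu> (a \<mu> \<nu>) y * w y)" for \<mu> \<nu>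
    by (intro L2c_tf_mult tfa test_fun_partial w)+
  let ?R = "\<lambda>\<mu> y. \<Sum>\<nu>\<in>UNIV. Rcom k (a \<mu> \<nu>) \<nu> w y"
  \<comment> \<open>\<open>?T\<close> is what mollifying the flux a \<partial>w would give, with the
    derivative moved off \<open>w\<close>; \<open>?R\<close> is its difference from the flux of the
    mollification.\<close>
  let ?T = "\<lambda>\<mu> \<nu> y. conv (partial \<nu> k) (\<lambda>y. a \<mu> \<nu> y * w y) y - conv k (\<lambda>y. partial \<nu> (a \<mu> \<nu>) y * w y) y"
  have tR: "tf (?R \<mu>)" for \<mu> by (intro test_fun_sum tf_Rcom k tfa w)
  have tT: "tf (?T \<mu> \<nu>)" for \<mu> \<nu> by (intro test_fun_diff tf_conv tk k aw)
  have fl: "flux \<mu> (conv k w) = (\<lambda>y. ?R \<mu> y + (\<Sum>\<nu>\<in>UNIV. ?T \<mu> \<nu> y))" for \<mu>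
    unfolding flux_def[abs_def] partial_conv[OF k w] Rcom_def sum.distrib[symmetric]
    by (intro ext sum.cong refl) simp
  have pT: "partial \<mu> (?T \<mu> \<nu>) x = conv (partial \<mu> (partial \<nu> k)) (\<lambda>y. a \<mu> \<nu> y * w y) x - conv (partial \<mu> k) (\<lambda>y. partial \<nu> (a \<mu> \<nu>) y * w y) x" for \<mu> \<nu>
    by (subst fun_cong[OF partial_diff_tf[OF tf_conv[OF tk(1) aw(1)] tf_conv[OF k aw(2)]]])
       (simp only: partial_conv[OF tk(1) aw(1)] partial_conv[OF k aw(2)])
  have L: "partial \<mu> (flux \<mu> (conv k w)) x = partial \<mu> (?R \<mu>) x + (\<Sum>\<nu>\<in>UNIV. partial \<mu> (?T \<mu> \<nu>) x)" for \<mu>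
    unfolding fl
    by (subst fun_cong[OF partial_add_tf[OF tR test_fun_sum[OF tT]]]) (simp only: partial_sum_tf[OF tT])
  have R: "partial \<mu> (\<lambda>y. conv k (gm \<mu>) y + ?R \<mu> y) x = conv (partial \<mu> k) (gm \<mu>) x + partial \<mu> (?R \<mu>) x" for \<mu>
    by (subst fun_cong[OF partial_add_tf[OF tf_conv[OF k gm] tR]]) (simp only: partial_conv[OF k gm])
  define \<phi> where "\<phi> y = k (x + (-1) *\<^sub>R y)" for y
  have t\<phi>: "tf \<phi>" unfolding \<phi>_def[abs_def] by (rule tf_affine[OF k]) simp
  have p\<phi>: "partial \<mu> \<phi> = (\<lambda>y. - 1 * partial \<mu> k (x + (-1) *\<^sub>R y))" for \<mu>
    unfolding \<phi>_def[abs_def] by (rule ext, subst partial_affine[OF k]) simp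
  have pp\<phi>: "partial \<nu> (partial \<mu> \<phi>) y = partial \<nu> (partial \<mu> k) (x - y)" for \<mu> \<nu> y
    unfolding p\<phi>
    by (subst fun_cong[OF partial_cmult_tf[OF tf_affine[OF tk(1)]]], simp, subst partial_affine[OF tk(1)]) simp
  have At\<phi>: "w y * At \<phi> y = (\<Sum>\<nu>\<in>UNIV. \<Sum>\<mu>\<in>UNIV. partial \<nu> (partial \<mu> k) (x - y) * (a \<mu> \<nu> y * w y) - partial \<mu> k (x - y) * (partial \<nu> (a \<mu> \<nu>) y * w y))" for y
  proof -
    have "partial \<nu> (\<lambda>y. a \<mu> \<nu> y * partial \<mu> \<phi> y) y = a \<mu> \<nu> y * partial \<nu> (partial \<mu> k) (x - y) - partial \<nu> (a \<mu> \<nu>) y * partial \<mu> k (x - y)" for \<mu> \<nu>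
      unfolding fun_cong[OF partial_mult_tf[OF tfa test_fun_partial[OF t\<phi>]]] pp\<phi> by (simp add: p\<phi>)
    then have "w y * At \<phi> y = (\<Sum>\<nu>\<in>UNIV. \<Sum>\<mu>\<in>UNIV. w y * (a \<mu> \<nu> y * partial \<nu> (partial \<mu> k) (x - y) - partial \<nu> (a \<mu> \<nu>) y * partial \<mu> k (x - y)))"
      unfolding At_def by (simp only: sum_distrib_left)
    also have "\<dots> = (\<Sum>\<nu>\<in>UNIV. \<Sum>\<mu>\<in>UNIV. partial \<nu> (partial \<mu> k) (x - y) * (a \<mu> \<nu> y * w y) - partial \<mu> k (x - y) * (partial \<nu> (a \<mu> \<nu>) y * w y))"
      by (intro sum.cong refl) (simp add: algebra_simps)
    finally show ?thesis .
  qed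
  have i: "integrable lborel (\<lambda>y. partial \<nu> (partial \<mu> k) (x - y) * (a \<mu> \<nu> y * w y))"
    "integrable lborel (\<lambda>y. partial \<mu> k (x - y) * (partial \<nu> (a \<mu> \<nu>) y * w y))" for \<mu> \<nu>
    by (rule conv_integrable[OF tk(2) aw(1)], rule conv_integrable[OF tk(1) aw(2)])
  have "(\<integral>y. w y * At \<phi> y \<partial>lborel) = (\<Sum>\<nu>\<in>UNIV. \<Sum>\<mu>\<in>UNIV. conv (partial \<nu> (partial \<mu> k)) (\<lambda>y. a \<mu> \<nu> y * w y) x - conv (partial \<mu> k) (\<lambda>y. partial \<nu> (a \<mu> \<nu>) y * w y) x)"
    unfolding At\<phi> conv_def
    by (simp only: Bochner_Integration.integral_sum Bochner_Integration.integrable_sum Bochner_Integration.integrable_diff i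
        Bochner_Integration.integral_diff)
  also have "\<dots> = (\<Sum>\<mu>\<in>UNIV. \<Sum>\<nu>\<in>UNIV. partial \<mu> (?T \<mu> \<nu>) x)"
    unfolding pT by (subst sum.swap) (intro sum.cong refl arg_cong2[where f=minus] arg_cong[where f="\<lambda>k. conv k _ x"] partial_commute_fun k)
  finally have 1: "(\<integral>y. w y * At \<phi> y \<partial>lborel) = (\<Sum>\<mu>\<in>UNIV. \<Sum>\<nu>\<in>UNIV. partial \<mu> (?T \<mu> \<nu>) x)" .
  have "(\<integral>y. w y * At \<phi> y \<partial>lborel) = conv k g0 x + (\<Sum>\<mu>\<in>UNIV. conv (partial \<mu> k) (gm \<mu>) x)"
    unfolding weak[OF t\<phi>] conv_def p\<phi> by (simp add: \<phi>_def mult.commute sum_negf)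
  then have 2: "(\<Sum>\<mu>\<in>UNIV. \<Sum>\<nu>\<in>UNIV. partial \<mu> (?T \<mu> \<nu>) x) = conv k g0 x + (\<Sum>\<mu>\<in>UNIV. conv (partial \<mu> k) (gm \<mu>) x)"
    using 1 by simp
  show ?thesis unfolding L R sum.distrib 2 by simp
qed

text \<open>A gain of one order. The cutoff terms in \<open>u\<close> enter either undifferentiated
  (order \<open>s - 1\<close> suffices) or under a divergence (order \<open>s\<close> suffices), and
  the commutators are under a divergence too, bounded at order \<open>s\<close> by
  \<open>friedrichs_bounded\<close>.\<close>

lemma regularity_step:
  fixes u g :: "'i \<Rightarrow> real^'n \<Rightarrow> complex"
  assumes \<beta>: "tf \<beta>" and u: "\<And>n. L2c (u n)" and g: "\<And>n. L2c (g n)"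
    and weak: "\<And>n \<phi>. test_fun Om \<phi> \<Longrightarrow> (\<integral>x. g n x * (\<beta> x * \<phi> x) \<partial>lborel) = (\<integral>x. u n x * At \<phi> x \<partial>lborel)"
    and Hu: "Hbloc Om s u" and Hg: "Hbloc Om (s - 1) g"
  shows "Hbloc Om (Suc s) u"
  unfolding Hbloc_def
proof (intro allI impI)
  fix \<psi> assume \<psi>: "test_fun Om \<psi>"
  let ?w = "\<lambda>n x. \<psi> x * u n x"
  let ?h = "\<lambda>n x. (\<psi> x * \<beta> x) * g n x" and ?q = "\<lambda>n x. At \<psi> x * u n x"
  let ?g0 = "\<lambda>n x. ?h n x - ?q n x" and ?gm = "\<lambda>\<mu> n x. dd \<psi> \<mu> x * u n x"
  have t\<psi>: "test_fun Om (\<lambda>x. \<psi> x * \<beta> x)" by (rule test_fun_mult[OF \<psi> \<beta>])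
  have Lw: "L2c (?w n)" and Lh: "L2c (?h n)" and Lq: "L2c (?q n)" and Lm: "L2c (?gm \<mu> n)" for n \<mu>
    by (intro L2c_tf_mult test_fun_tf[OF \<psi>] test_fun_tf[OF t\<psi>] test_fun_tf[OF test_fun_At[OF \<psi>]]
        test_fun_tf[OF test_fun_dd[OF \<psi>]] u g)+
  have Lg0: "L2c (?g0 n)" for n by (intro L2c_diff Lh Lq)
  obtain \<delta>0 where \<delta>0: "\<delta>0 > 0" "\<And>e n. 0 < e \<Longrightarrow> e < \<delta>0 \<Longrightarrow> test_fun Om (conv (moll e) (?w n))"
    using test_fun_conv[OF \<psi> open_Om] Lw by metis
  obtain M1 \<delta>1 where 1: "\<delta>1 > 0" "\<And>n e. 0 < e \<Longrightarrow> e < \<delta>1 \<Longrightarrow> sobn s (conv (moll e) (?w n)) \<le> M1"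
    using HbE[OF Hu[unfolded Hbloc_def, rule_format, OF \<psi>]] by metis
  obtain M2 \<delta>2 where 2: "\<delta>2 > 0" "\<And>n e. 0 < e \<Longrightarrow> e < \<delta>2 \<Longrightarrow> sobn (s - 1) (conv (moll e) (?h n)) \<le> M2"
    using HbE[OF Hg[unfolded Hbloc_def, rule_format, OF t\<psi>]] by metis
  obtain M3 \<delta>3 where 3: "\<delta>3 > 0" "\<And>n e. 0 < e \<Longrightarrow> e < \<delta>3 \<Longrightarrow> sobn (s - 1) (conv (moll e) (?q n)) \<le> M3"
    using HbE[OF Hb_mono[OF diff_le_self Hu[unfolded Hbloc_def, rule_format, OF test_fun_At[OF \<psi>]], of 1]] by metis
  obtain M4 \<delta>4 where 4: "\<delta>4 > 0" "\<And>\<mu> n e. 0 < e \<Longrightarrow> e < \<delta>4 \<Longrightarrow> sobn s (conv (moll e) (?gm \<mu> n)) \<le> M4"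
    using Hb_uniform[where W="?gm", OF Hu[unfolded Hbloc_def, rule_format, OF test_fun_dd[OF \<psi>]]] by metis
  define P where "P C \<mu> \<nu> \<longleftrightarrow> C \<ge> 0 \<and> (\<forall>w M \<delta> e. L2c w \<longrightarrow> \<delta> > 0 \<longrightarrow> (\<forall>d. 0 < d \<longrightarrow> d < \<delta> \<longrightarrow> sobn s (conv (moll d) w) \<le> M) \<longrightarrow>
     e > 0 \<longrightarrow> sobn s (Rcom (moll e) (a \<mu> \<nu>) \<nu> w) \<le> C * M)" for C \<mu> \<nu>
  define D where "D \<mu> \<nu> = (SOME C. P C \<mu> \<nu>)" for \<mu> \<nu>
  have PD: "P (D \<mu> \<nu>) \<mu> \<nu>" for \<mu> \<nu>
    unfolding D_def by (rule someI_ex) (use friedrichs_bounded[OF tfa] in \<open>simp only: P_def\<close>)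
  have RD: "sobn s (Rcom (moll e) (a \<mu> \<nu>) \<nu> (?w n)) \<le> D \<mu> \<nu> * M1" if "e > 0" for e \<mu> \<nu> n
    \<comment> \<open>The commutators of \<open>?w\<close> are bounded by the bound
      \<open>M1\<close> on the mollifications of \<open>?w\<close> itself.\<close>
    using PD[of \<mu> \<nu>, unfolded P_def, THEN conjunct2, rule_format, OF Lw[of n] 1(1), of M1 e] 1(2) that by simp
  obtain C where C: "elliptic_const s C" using elliptic_estimate by blast
  define N where "N = (\<Sum>\<mu>\<in>UNIV. 2 * M4 + 2 * (2 ^ CARD('n) * (\<Sum>\<nu>\<in>UNIV. D \<mu> \<nu> * M1)))"
  have main: "sobn (Suc s) (conv (moll e) (?w n)) \<le> C * ((2 * M2 + 2 * M3) + N + M1)"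
    if e: "0 < e" "e < min (min \<delta>0 \<delta>1) (min \<delta>2 (min \<delta>3 \<delta>4))" for n e
  proof -
    let ?k = "moll e :: real^'n \<Rightarrow> complex"
    let ?G = "\<lambda>\<mu> y. conv ?k (?gm \<mu> n) y + (\<Sum>\<nu>\<in>UNIV. Rcom ?k (a \<mu> \<nu>) \<nu> (?w n) y)"
    have k: "tf ?k" by (rule tf_moll[OF e(1)])
    have tv: "test_fun Om (conv ?k (?w n))" using \<delta>0 e by simp
    have t0: "tf (conv ?k (?g0 n))" by (rule tf_conv[OF k Lg0])
    have tR: "tf (Rcom ?k (a \<mu> \<nu>) \<nu> (?w n))" for \<mu> \<nu> by (rule tf_Rcom[OF k tfa Lw])
    have tG: "tf (?G \<mu>)" for \<mu> by (intro test_fun_add tf_conv k Lm test_fun_sum tR)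
    have eq: "(\<Sum>\<mu>\<in>UNIV. partial \<mu> (flux \<mu> (conv ?k (?w n))) x) = conv ?k (?g0 n) x + (\<Sum>\<mu>\<in>UNIV. partial \<mu> (?G \<mu>) x)" for x
      by (rule mollified_equation[OF k Lw Lg0 Lm]) (rule localized_equation[OF \<psi> _ \<beta> u g weak])
    have "sobn (Suc s) (conv ?k (?w n)) \<le> C * (sobn (s - 1) (conv ?k (?g0 n)) + (\<Sum>\<mu>\<in>UNIV. sobn s (?G \<mu>)) + L2sq (conv ?k (?w n)))"
      by (rule C[unfolded elliptic_const_def, THEN conjunct2, rule_format, of "conv ?k (?w n)" "conv ?k (?g0 n)" ?G])
         (rule tv t0 tG eq)+
    also have "\<dots> \<le> C * ((2 * M2 + 2 * M3) + N + M1)"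
    proof (intro mult_left_mono add_mono)
      have "conv ?k (?g0 n) = (\<lambda>x. conv ?k (?h n) x - conv ?k (?q n) x)"
        by (rule ext) (rule conv_diff[OF k Lh Lq])
      then have "sobn (s - 1) (conv ?k (?g0 n)) \<le> 2 * sobn (s - 1) (conv ?k (?h n)) + 2 * sobn (s - 1) (conv ?k (?q n))"
        using sobn_diff[OF tf_conv[OF k Lh[of n]] tf_conv[OF k Lq[of n]], of "s - 1"] by (simp only:)
      also have "\<dots> \<le> 2 * M2 + 2 * M3" using 2(2)[OF e(1)] 3(2)[OF e(1)] e by (intro add_mono mult_left_mono) auto
      finally show "sobn (s - 1) (conv ?k (?g0 n)) \<le> 2 * M2 + 2 * M3" .
      show "(\<Sum>\<mu>\<in>UNIV. sobn s (?G \<mu>)) \<le> N"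
        unfolding N_def
      proof (rule sum_mono)
        fix \<mu>
        have "sobn s (?G \<mu>) \<le> 2 * sobn s (conv ?k (?gm \<mu> n)) + 2 * sobn s (\<lambda>y. \<Sum>\<nu>\<in>UNIV. Rcom ?k (a \<mu> \<nu>) \<nu> (?w n) y)"
          by (intro sobn_add tf_conv k Lm test_fun_sum tR)
        also have "\<dots> \<le> 2 * M4 + 2 * (2 ^ CARD('n) * (\<Sum>\<nu>\<in>UNIV. D \<mu> \<nu> * M1))"
        proof (intro add_mono mult_left_mono)
          show "sobn s (conv ?k (?gm \<mu> n)) \<le> M4" using 4(2)[OF e(1)] e by simp
          have "sobn s (\<lambda>y. \<Sum>\<nu>\<in>UNIV. Rcom ?k (a \<mu> \<nu>) \<nu> (?w n) y) \<le> 2 ^ CARD('n) * (\<Sum>\<nu>\<in>UNIV. sobn s (Rcom ?k (a \<mu> \<nu>) \<nu> (?w n)))"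
            by (rule sobn_sum) (auto intro: tR)
          also have "\<dots> \<le> 2 ^ CARD('n) * (\<Sum>\<nu>\<in>UNIV. D \<mu> \<nu> * M1)"
            by (intro mult_left_mono sum_mono RD e(1)) simp
          finally show "sobn s (\<lambda>y. \<Sum>\<nu>\<in>UNIV. Rcom ?k (a \<mu> \<nu>) \<nu> (?w n) y) \<le> 2 ^ CARD('n) * (\<Sum>\<nu>\<in>UNIV. D \<mu> \<nu> * M1)" .
        qed auto
        finally show "sobn s (?G \<mu>) \<le> 2 * M4 + 2 * (2 ^ CARD('n) * (\<Sum>\<nu>\<in>UNIV. D \<mu> \<nu> * M1))" .
      qed
      show "L2sq (conv ?k (?w n)) \<le> M1"
        using L2sq_le_sobn[of "conv ?k (?w n)" s] 1(2)[OF e(1), of n] e by simp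
      show "0 \<le> C" using C by (simp add: elliptic_const_def)
    qed
    finally show ?thesis .
  qed
  show "Hb (Suc s) ?w"
    unfolding Hb_def
    by (rule exI[of _ "C * ((2 * M2 + 2 * M3) + N + M1)"], rule exI[of _ "min (min \<delta>0 \<delta>1) (min \<delta>2 (min \<delta>3 \<delta>4))"])
       (use main \<delta>0(1) 1(1) 2(1) 3(1) 4(1) in simp)
qed

lemma Hbloc_0:
  fixes u :: "'i \<Rightarrow> real^'n \<Rightarrow> complex"
  assumes u: "\<And>n. L2c (u n)" and B: "\<And>n. L2sq (u n) \<le> B"
  shows "Hbloc Om 0 u"
  unfolding Hbloc_def
proof (intro allI impI)
  fix \<psi> assume \<psi>: "test_fun Om \<psi>"
  obtain C where C: "C \<ge> 0" "\<And>w. L2c w \<Longrightarrow> L2sq (\<lambda>x. \<psi> x * w x) \<le> C * L2sq w"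
    using L2sq_tf_mult[OF test_fun_tf[OF \<psi>]] by metis
  have "L2sq (conv (moll e) (\<lambda>x. \<psi> x * u n x)) \<le> C * B" if "0 < e" for n e
  proof -
    have "L2sq (conv (moll e) (\<lambda>x. \<psi> x * u n x)) \<le> L2sq (\<lambda>x. \<psi> x * u n x)"
      using L2sq_conv[OF tf_moll[OF that] L2c_tf_mult[OF test_fun_tf[OF \<psi>] u]]
        integral_norm_moll[OF that, where 'n='n] by simp
    also have "\<dots> \<le> C * B" using C(2)[OF u] mult_left_mono[OF B C(1)] order_trans by blast
    finally show ?thesis .
  qed
  then show "Hb 0 (\<lambda>n x. \<psi> x * u n x)" unfolding Hb_def by (intro exI[of _ "C * B"] exI[of _ 1]) simp
qed

text \<open>Descends from level \<open>k\<close>, where only mean-square bounds are available.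
  Knowing order \<open>2 * j\<close> of level \<open>l + 1\<close>, an inner induction raises level
  \<open>l\<close> one order at a time up to \<open>2 * j + 2\<close>.\<close>

lemma regularity_chain:
  fixes U :: "nat \<Rightarrow> 'i \<Rightarrow> real^'n \<Rightarrow> complex"
  assumes \<beta>: "tf \<beta>" and U: "\<And>l n. l \<le> k \<Longrightarrow> L2c (U l n)" and B: "\<And>l n. l \<le> k \<Longrightarrow> L2sq (U l n) \<le> B l"
    and weak: "\<And>l n \<phi>. l < k \<Longrightarrow> test_fun Om \<phi> \<Longrightarrow> (\<integral>x. U (Suc l) n x * (\<beta> x * \<phi> x) \<partial>lborel) = (\<integral>x. U l n x * At \<phi> x \<partial>lborel)"
  shows "j \<le> k \<Longrightarrow> Hbloc Om (2 * j) (U (k - j))"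
proof (induction j)
  case 0
  have "Hbloc Om 0 (U k)" by (rule Hbloc_0[where B="B k"]) (use U B in auto)
  then show ?case by simp
next
  case (Suc j)
  define l where "l = k - Suc j"
  have l: "Suc l = k - j" "l < k" using Suc.prems by (auto simp: l_def)
  have IH: "Hbloc Om (2 * j) (U (Suc l))" using Suc by (simp add: l)
  have "t \<le> 2 * Suc j \<Longrightarrow> Hbloc Om t (U l)" for t
  proof (induction t)
    case 0
    show ?case by (rule Hbloc_0[where B="B l"]) (use U B l in auto)
  next
    case (Suc t)
    show ?case
    proof (rule regularity_step[OF \<beta>])
      show "Hbloc Om t (U l)" using Suc by simp
      \<comment> \<open>The last admissible step is \<open>t = 2 * j + 1\<close>, which uses the
        full order \<open>2 * j\<close> of the next level.\<close>
      show "Hbloc Om (t - 1) (U (Suc l))" by (rule Hbloc_mono[OF _ IH]) (use Suc.prems in simp)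
    qed (use U l(2) weak in auto)
  qed
  then show ?case by (simp add: l_def)
qed

end

subsection \<open>Sobolev embedding\<close>

lemma L2_cauchy_schwarz:
  assumes "L2c f" "L2c g"
  shows "norm (\<integral>x. f x * cnj (g x) \<partial>lborel) \<le> sqrt (L2sq f) * sqrt (L2sq g)"
proof -
  let ?p = "sqrt (L2sq f)" and ?q = "sqrt (L2sq g)" and ?x = "norm (\<integral>x. f x * cnj (g x) \<partial>lborel)"
  have pq: "0 \<le> ?p" "0 \<le> ?q" "?p\<^sup>2 = L2sq f" "?q\<^sup>2 = L2sq g" by auto
  have le: "?x \<le> ?p * ?q + \<eta> * ((?p + ?q) / 2)" if "\<eta> > 0" for \<eta>
  proof -
    \<comment> \<open>The optimal weight would be p/q; adding \<open>\<eta>\<close> to both norms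
      keeps it positive and finite when one of them vanishes.\<close>
    define t where "t = (?p + \<eta>) / (?q + \<eta>)"
    have pos: "?p + \<eta> > 0" "?q + \<eta> > 0" using pq that by (auto intro: add_nonneg_pos)
    have t: "t > 0" using pos by (simp add: t_def)
    have "?x \<le> 1 / (2 * t) * ?p\<^sup>2 + t / 2 * ?q\<^sup>2" using L2_pairing[OF assms t] pq by simp
    also have "1 / (2 * t) * ?p\<^sup>2 = ?p * (?q + \<eta>) / 2 * (?p / (?p + \<eta>))"
      using pos by (simp add: t_def power2_eq_square field_simps)
    also have "\<dots> \<le> ?p * (?q + \<eta>) / 2 * 1"
      using pq(1,2) that pos by (intro mult_left_mono) (auto simp: divide_le_eq)
    also have "t / 2 * ?q\<^sup>2 = (?p + \<eta>) * ?q / 2 * (?q / (?q + \<eta>))"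
      using pos by (simp add: t_def power2_eq_square field_simps)
    also have "\<dots> \<le> (?p + \<eta>) * ?q / 2 * 1"
      using pq(1,2) that pos by (intro mult_left_mono) (auto simp: divide_le_eq)
    finally show ?thesis by (simp add: field_simps)
  qed
  show ?thesis
  proof (rule field_le_epsilon)
    fix e :: real assume "e > 0"
    define \<eta> where "\<eta> = e / ((?p + ?q) / 2 + 1)"
    have d: "(?p + ?q) / 2 + 1 > 0"
      using pq(1,2) by (intro add_nonneg_pos divide_nonneg_pos add_nonneg_nonneg) auto
    then have "\<eta> > 0" using \<open>e > 0\<close> by (simp add: \<eta>_def)
    moreover have "\<eta> * ((?p + ?q) / 2) \<le> \<eta> * ((?p + ?q) / 2 + 1)" using \<open>\<eta> > 0\<close> by (intro mult_left_mono) auto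
    moreover have "\<eta> * ((?p + ?q) / 2 + 1) = e" using d by (simp add: \<eta>_def)
    ultimately show "?x \<le> ?p * ?q + e" using le[of \<eta>] by linarith
  qed
qed

lemma L2sq_cnj: "L2sq (\<lambda>x. cnj (f x)) = L2sq f"
  by (simp add: L2sq_def)

text \<open>Average of \<open>v\<close> near \<open>x\<close> at scale \<open>t\<close> with profile
  \<open>\<psi>\<close>. If \<open>\<psi>\<close> has integral 1, then \<open>t = 0\<close> gives
  \<open>v x\<close>, while \<open>t > 0\<close> is controlled in the mean.\<close>

definition mean :: "(real^'n::finite \<Rightarrow> complex) \<Rightarrow> real \<Rightarrow> (real^'n \<Rightarrow> complex) \<Rightarrow> real^'n \<Rightarrow> complex" where
  "mean \<psi> t v x = (\<integral>h. \<psi> h * v (x + t *\<^sub>R h) \<partial>lborel)"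

lemma mean_integrable:
  assumes \<psi>: "L2c \<psi>" and v: "tf v"
  shows "integrable lborel (\<lambda>h. \<psi> h * v (x + t *\<^sub>R h))"
proof -
  obtain B where B: "\<And>x. norm (v x) \<le> B" using tf_bounded[OF v] by metis
  have "(\<lambda>h. v (x + t *\<^sub>R h)) \<in> borel_measurable borel" using tf_measurable[OF v] by measurable
  from L2c_integrable[OF L2c_mult(1)[OF \<psi> this B]] show ?thesis by (simp add: mult.commute)
qed

text \<open>Cauchy-Schwarz followed by the dilation h -> x + t h, whose Jacobian produces the
  exponent n/2.\<close>

lemma mean_L2_bound:
  fixes v \<psi> :: "real^'n::finite \<Rightarrow> complex"
  assumes \<psi>: "L2c \<psi>" and v: "tf v" and t: "t > 0"
  shows "norm (mean \<psi> t v x) \<le> sqrt (L2sq \<psi>) * (t powr (- (CARD('n) / 2)) * sqrt (L2sq v))"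
proof -
  let ?g = "\<lambda>h. cnj (v (x + t *\<^sub>R h))"
  have tg: "tf ?g" by (rule tf_cnj[OF tf_affine[OF v]]) (use t in simp)
  have [measurable]: "v \<in> borel_measurable borel" by (rule tf_measurable[OF v])
  have "L2sq v = t ^ CARD('n) * L2sq (\<lambda>h. v (x + t *\<^sub>R h))"
    unfolding L2sq_def using integral_lborel_affine[of "\<lambda>h. (norm (v h))\<^sup>2" t x] t by simp
  then have "L2sq (\<lambda>h. v (x + t *\<^sub>R h)) = t powr (- real CARD('n)) * L2sq v"
    using t by (simp add: powr_minus powr_realpow field_simps)
  also have "t powr (- real CARD('n)) = (t powr (- (CARD('n) / 2)))\<^sup>2"
    using t by (simp add: power2_eq_square powr_add[symmetric])
  finally have "sqrt (L2sq ?g) = t powr (- (CARD('n) / 2)) * sqrt (L2sq v)"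
    by (simp add: L2sq_cnj real_sqrt_mult)
  then show ?thesis
    using L2_cauchy_schwarz[OF \<psi> tf_L2c[OF tg]] by (simp add: mean_def)
qed

lemma L2c_coord:
  fixes \<psi> :: "real^'n::finite \<Rightarrow> complex"
  assumes \<psi>: "L2c \<psi>" shows "L2c (\<lambda>h. of_real (h $ i) * \<psi> h)"
proof -
  obtain R where R: "R > 0" "{x. \<psi> x \<noteq> 0} \<subseteq> cball 0 R" using L2c_support[OF \<psi>] by metis
  let ?g = "\<lambda>h. of_real (h $ i * indicator (cball 0 R) h) :: complex"
  have "L2c (\<lambda>h. ?g h * \<psi> h)"
  proof (rule L2c_mult(1)[OF \<psi>])
    have [measurable]: "(\<lambda>h. h $ i) \<in> borel_measurable borel"
      by (intro borel_measurable_continuous_onI continuous_intros)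
    have [measurable]: "cball (0::real^'n) R \<in> sets borel" by simp
    show "?g \<in> borel_measurable borel" by measurable
    show "norm (?g h) \<le> R" for h
      using R(1) component_le_norm_cart[of h i] by (auto simp: indicator_def)
  qed
  moreover have "(\<lambda>h. ?g h * \<psi> h) = (\<lambda>h. of_real (h $ i) * \<psi> h)"
  proof
    fix h show "?g h * \<psi> h = of_real (h $ i) * \<psi> h"
      using R(2) by (cases "\<psi> h = 0") auto
  qed
  ultimately show ?thesis by simp
qed

text \<open>Differentiation in the scale produces the factor \<open>h\<close>, which is absorbed
  into the profile. The result is a sum of means of first derivatives with profiles h_i \<psi>(h),
  so the lemma can be iterated.\<close>

lemma mean_has_vector_derivative:
  assumes \<psi>: "L2c \<psi>" and v: "tf v"
  shows "((\<lambda>t. mean \<psi> t v x) has_vector_derivative (\<Sum>i\<in>UNIV. mean (\<lambda>h. of_real (h $ i) * \<psi> h) t (partial i v) x)) (at t)"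
proof -
  obtain R where R: "R > 0" "{x. \<psi> x \<noteq> 0} \<subseteq> cball 0 R" using L2c_support[OF \<psi>] by metis
  obtain L where L: "L > 0" "\<And>x h. norm (frechet_derivative v (at x) h) \<le> L * norm h" using tf_frechet_bound[OF v] by metis
  let ?f' = "\<lambda>t h s. \<psi> h * (s *\<^sub>R frechet_derivative v (at (x + t *\<^sub>R h)) h)"
  let ?F = "\<lambda>t i h. of_real (h $ i) * \<psi> h * partial i v (x + t *\<^sub>R h)"
  have iF: "integrable lborel (?F t i)" for t i
    by (rule mean_integrable[OF L2c_coord[OF \<psi>] test_fun_partial[OF v]])
  have fs: "?f' t h s = s *\<^sub>R (\<Sum>i\<in>UNIV. ?F t i h)" for t h s
    unfolding frechet_partial_sum[OF tf_has_derivative[OF v]]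
    by (simp add: scaleR_conv_of_real sum_distrib_left mult_ac)
  have "((\<lambda>t. \<integral>h. \<psi> h * v (x + t *\<^sub>R h) \<partial>lborel) has_derivative (\<lambda>s. \<integral>h. ?f' t h s \<partial>lborel)) (at t)"
  proof (rule has_derivative_integral[where g="\<lambda>h. L * R * norm (\<psi> h)"])
    show "integrable lborel (\<lambda>h. \<psi> h * v (x + t *\<^sub>R h))" for t by (rule mean_integrable[OF \<psi> v])
    show "integrable lborel (\<lambda>h. L * R * norm (\<psi> h))" using L2c_integrable[OF \<psi>] by simp
    fix t h
    show "((\<lambda>t. \<psi> h * v (x + t *\<^sub>R h)) has_derivative ?f' t h) (at t)"
      using has_vector_derivative_line[where y=x and t=t and h=h, OF tf_has_derivative[OF v]]
      unfolding has_vector_derivative_def by (rule has_derivative_mult_right)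
    fix s
    show "norm (?f' t h s) \<le> L * R * norm (\<psi> h) * norm s"
    proof (cases "\<psi> h = 0")
      case False
      then have "norm h \<le> R" using R(2) by auto
      then have "norm (frechet_derivative v (at (x + t *\<^sub>R h)) h) \<le> L * R"
        using L(2)[of "x + t *\<^sub>R h" h] mult_left_mono[of "norm h" R L] L(1) by linarith
      then have "norm (\<psi> h) * norm s * norm (frechet_derivative v (at (x + t *\<^sub>R h)) h) \<le> norm (\<psi> h) * norm s * (L * R)"
        by (intro mult_left_mono) auto
      then show ?thesis by (simp add: norm_mult mult_ac)
    qed simp
    show "(\<lambda>h. ?f' t h s) \<in> borel_measurable lborel"
      unfolding fs by (intro borel_measurable_integrable integrable_scaleR_right Bochner_Integration.integrable_sum iF)
  qed
  then show ?thesis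
    unfolding fs has_vector_derivative_def mean_def by (simp add: Bochner_Integration.integral_sum iF)
qed

lemma powr_primitive:
  assumes "\<gamma>' \<noteq> 1" "x > 0"
  shows "((\<lambda>\<tau>. K * (\<tau> powr (1 - \<gamma>') / (1 - \<gamma>'))) has_vector_derivative K * x powr (- \<gamma>')) (at x)"
proof -
  have "((\<lambda>\<tau>. K * (\<tau> powr (1 - \<gamma>') / (1 - \<gamma>'))) has_real_derivative K * x powr (- \<gamma>')) (at x)"
    using DERIV_cmult[OF DERIV_cdivide[OF has_real_derivative_powr[OF assms(2), of "1 - \<gamma>'"], of "1 - \<gamma>'"], of K] assms(1)
    by simp
  then show ?thesis by (simp add: has_real_derivative_iff_has_vector_derivative)
qed

lemma mean_deriv_bound:
  fixes v :: "real^'n::finite \<Rightarrow> complex"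
  assumes C: "\<And>i v x t. tf v \<Longrightarrow> 0 < t \<Longrightarrow> t \<le> 1 \<Longrightarrow>
        norm (mean (\<lambda>h. of_real (h $ i) * \<psi> h) t v x) \<le> C i * t powr (- \<gamma>') * sqrt (sobn s v)"
    and C0: "\<And>i. C i \<ge> 0" and v: "tf v" and t: "0 < t" "t \<le> 1"
  shows "norm (\<Sum>i\<in>UNIV. mean (\<lambda>h. of_real (h $ i) * \<psi> h) t (partial i v) x)
     \<le> (\<Sum>i\<in>UNIV. C i) * sqrt (sobn (Suc s) v) * t powr (- \<gamma>')"
proof -
  have "norm (\<Sum>i\<in>UNIV. mean (\<lambda>h. of_real (h $ i) * \<psi> h) t (partial i v) x)
     \<le> (\<Sum>i\<in>UNIV. C i * t powr (- \<gamma>') * sqrt (sobn (Suc s) v))"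
  proof (rule sum_norm_le)
    fix i
    have "norm (mean (\<lambda>h. of_real (h $ i) * \<psi> h) t (partial i v) x) \<le> C i * t powr (- \<gamma>') * sqrt (sobn s (partial i v))"
      by (rule C[OF test_fun_partial[OF v] t])
    also have "\<dots> \<le> C i * t powr (- \<gamma>') * sqrt (sobn (Suc s) v)"
      using C0[of i] by (intro mult_left_mono real_sqrt_le_mono sobn_partial) auto
    finally show "norm (mean (\<lambda>h. of_real (h $ i) * \<psi> h) t (partial i v) x) \<le> C i * t powr (- \<gamma>') * sqrt (sobn (Suc s) v)" .
  qed
  also have "\<dots> = (\<Sum>i\<in>UNIV. C i) * sqrt (sobn (Suc s) v) * t powr (- \<gamma>')"
    unfolding sum_distrib_right by (intro sum.cong refl) (simp add: mult_ac)
  finally show ?thesis .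
qed

text \<open>Integrating the bound t^(-\<gamma>') for the derivative from \<open>t\<close> to 1
  lowers the exponent by one for each available derivative. The profile is generalised because
  differentiation changes it.\<close>

lemma mean_bound:
  fixes \<psi> :: "real^'n::finite \<Rightarrow> complex"
  shows "L2c \<psi> \<Longrightarrow> \<gamma> \<ge> 0 \<Longrightarrow> \<gamma> > real CARD('n) / 2 - real s \<Longrightarrow>
    \<exists>C\<ge>0. \<forall>v x t. tf v \<longrightarrow> 0 < t \<longrightarrow> t \<le> 1 \<longrightarrow> norm (mean \<psi> t v x) \<le> C * t powr (- \<gamma>) * sqrt (sobn s v)"
proof (induction s arbitrary: \<psi> \<gamma>)
  case 0
  show ?case
  proof (intro exI[of _ "sqrt (L2sq \<psi>)"] conjI allI impI)
    fix v :: "real^'n \<Rightarrow> complex" and x and t :: real assume v: "tf v" and t: "0 < t" "t \<le> 1"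
    have "t powr (- (CARD('n) / 2)) \<le> t powr (- \<gamma>)" using t 0 by (intro powr_mono') auto
    then have "sqrt (L2sq \<psi>) * (t powr (- (CARD('n) / 2)) * sqrt (L2sq v)) \<le> sqrt (L2sq \<psi>) * (t powr (- \<gamma>) * sqrt (L2sq v))"
      by (intro mult_left_mono mult_right_mono) auto
    then show "norm (mean \<psi> t v x) \<le> sqrt (L2sq \<psi>) * t powr (- \<gamma>) * sqrt (sobn 0 v)"
      using mean_L2_bound[OF 0(1) v t(1), of x] by (simp add: mult.assoc)
  qed simp
next
  case (Suc s)
  define b where "b = real CARD('n) / 2 - real s"
  \<comment> \<open>If \<gamma> > 0, integration turns \<gamma> + 1 into \<gamma>. If \<gamma> = 0,
    then \<open>b < 1\<close>, and the midpoint of \<open>b\<close> and 1 is an integrable exponent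
    above \<open>b\<close>. Neither case meets exponent 1, so no logarithm occurs.\<close>
  define \<gamma>' where "\<gamma>' = (if \<gamma> > 0 then \<gamma> + 1 else max 0 ((b + 1) / 2))"
  have \<gamma>': "\<gamma>' \<ge> 0" "\<gamma>' > b" "\<gamma>' \<noteq> 1" and \<gamma>'1: "\<gamma> = 0 \<Longrightarrow> \<gamma>' < 1"
    using Suc.prems(2,3) by (auto simp: \<gamma>'_def b_def max_def)
  have "\<forall>i. \<exists>C\<ge>0. \<forall>v x t. tf v \<longrightarrow> 0 < t \<longrightarrow> t \<le> 1 \<longrightarrow>
      norm (mean (\<lambda>h. of_real (h $ i) * \<psi> h) t v x) \<le> C * t powr (- \<gamma>') * sqrt (sobn s v)"
    using Suc.IH[OF L2c_coord[OF Suc.prems(1)] \<gamma>'(1) \<gamma>'(2)[unfolded b_def]] by blast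
  then obtain C where C: "\<And>i. C i \<ge> 0" "\<And>i v x t. tf v \<Longrightarrow> 0 < t \<Longrightarrow> t \<le> 1 \<Longrightarrow>
      norm (mean (\<lambda>h. of_real (h $ i) * \<psi> h) t v x) \<le> C i * t powr (- \<gamma>') * sqrt (sobn s v)"
    by metis
  define K where "K = (\<Sum>i\<in>UNIV. C i)"
  have K: "K \<ge> 0" unfolding K_def by (intro sum_nonneg C(1))
  define D where "D = 1 / \<bar>1 - \<gamma>'\<bar>"
  have D: "D \<ge> 0" "(1 - t powr (1 - \<gamma>')) / (1 - \<gamma>') \<le> D * t powr (- \<gamma>)" if t: "0 < t" "t \<le> 1" for t
  proof -
    show "D \<ge> 0" by (simp add: D_def)
    show "(1 - t powr (1 - \<gamma>')) / (1 - \<gamma>') \<le> D * t powr (- \<gamma>)"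
    proof (cases "\<gamma> > 0")
      case True
      then have e: "1 - \<gamma>' = - \<gamma>" by (simp add: \<gamma>'_def)
      show ?thesis unfolding D_def e using True by (simp add: field_simps)
    next
      case False
      then have g0: "\<gamma> = 0" using Suc.prems by simp
      have "1 - \<gamma>' > 0" using \<gamma>'1[OF g0] by simp
      then show ?thesis using g0 t by (simp add: D_def divide_right_mono)
    qed
  qed
  show ?case
  proof (intro exI[of _ "sqrt (L2sq \<psi>) + K * D"] conjI allI impI)
    show "0 \<le> sqrt (L2sq \<psi>) + K * D" using K D(1)[of 1] by simp
    fix v :: "real^'n \<Rightarrow> complex" and x and t :: real assume v: "tf v" and t: "0 < t" "t \<le> 1"
    let ?N = "sqrt (sobn (Suc s) v)"
    have d: "((\<lambda>t. mean \<psi> t v x) has_vector_derivative (\<Sum>i\<in>UNIV. mean (\<lambda>h. of_real (h $ i) * \<psi> h) t (partial i v) x)) (at t)" for t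
      by (rule mean_has_vector_derivative[OF Suc.prems(1) v])
    have t1: "1 \<le> t powr (- \<gamma>)" using powr_mono'[of "- \<gamma>" 0 t] t Suc.prems(2) by simp
    have one: "norm (mean \<psi> 1 v x) \<le> sqrt (L2sq \<psi>) * ?N"
    proof -
      have "norm (mean \<psi> 1 v x) \<le> sqrt (L2sq \<psi>) * sqrt (L2sq v)"
        using mean_L2_bound[OF Suc.prems(1) v, of 1 x] by simp
      also have "\<dots> \<le> sqrt (L2sq \<psi>) * ?N"
        by (intro mult_left_mono real_sqrt_le_mono L2sq_le_sobn) simp
      finally show ?thesis .
    qed
    have diff: "norm (mean \<psi> 1 v x - mean \<psi> t v x) \<le> K * ?N * (D * t powr (- \<gamma>))"
    proof (cases "t = 1")
      case True
      then show ?thesis using K D(1)[of 1] by simp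
    next
      case False
      then have t': "t < 1" using t by simp
      let ?\<Phi> = "\<lambda>\<tau>. (K * ?N) * (\<tau> powr (1 - \<gamma>') / (1 - \<gamma>'))"
      have "norm (mean \<psi> 1 v x - mean \<psi> t v x) \<le> ?\<Phi> 1 - ?\<Phi> t"
      proof (rule differentiable_bound_general[OF t', where f="\<lambda>t. mean \<psi> t v x"
            and f'="\<lambda>t. \<Sum>i\<in>UNIV. mean (\<lambda>h. of_real (h $ i) * \<psi> h) t (partial i v) x" and \<phi>="?\<Phi>"
            and \<phi>'="\<lambda>\<tau>. (K * ?N) * \<tau> powr (- \<gamma>')"])
        show "continuous_on {t..1} (\<lambda>t. mean \<psi> t v x)"
          by (intro continuous_at_imp_continuous_on ballI has_vector_derivative_continuous[OF d])
        show "continuous_on {t..1} ?\<Phi>"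
          by (intro continuous_at_imp_continuous_on ballI has_vector_derivative_continuous[OF powr_primitive[OF \<gamma>'(3)]])
             (use t in auto)
        fix \<tau> assume \<tau>: "t < \<tau>" "\<tau> < 1"
        show "(?\<Phi> has_vector_derivative (K * ?N) * \<tau> powr (- \<gamma>')) (at \<tau>)"
          by (rule powr_primitive[OF \<gamma>'(3)]) (use \<tau> t in simp)
        show "norm (\<Sum>i\<in>UNIV. mean (\<lambda>h. of_real (h $ i) * \<psi> h) \<tau> (partial i v) x) \<le> K * ?N * \<tau> powr (- \<gamma>')"
          unfolding K_def by (rule mean_deriv_bound[OF C(2) C(1) v]) (use \<tau> t in auto)
      qed (rule d)
      also have "\<dots> = K * ?N * ((1 - t powr (1 - \<gamma>')) / (1 - \<gamma>'))"
        by (simp add: right_diff_distrib diff_divide_distrib)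
      also have "\<dots> \<le> K * ?N * (D * t powr (- \<gamma>))"
        using K by (intro mult_left_mono D(2) t mult_nonneg_nonneg) auto
      finally show ?thesis .
    qed
    have "norm (mean \<psi> t v x) \<le> norm (mean \<psi> 1 v x) + norm (mean \<psi> 1 v x - mean \<psi> t v x)"
      using norm_triangle_ineq4[of "mean \<psi> 1 v x" "mean \<psi> 1 v x - mean \<psi> t v x"] by simp
    also have "\<dots> \<le> sqrt (L2sq \<psi>) * ?N * t powr (- \<gamma>) + K * ?N * (D * t powr (- \<gamma>))"
    proof (intro add_mono diff)
      have "sqrt (L2sq \<psi>) * ?N * 1 \<le> sqrt (L2sq \<psi>) * ?N * t powr (- \<gamma>)"
        using t1 by (intro mult_left_mono) auto
      then show "norm (mean \<psi> 1 v x) \<le> sqrt (L2sq \<psi>) * ?N * t powr (- \<gamma>)" using one by simp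
    qed
    also have "\<dots> = (sqrt (L2sq \<psi>) + K * D) * t powr (- \<gamma>) * ?N" by (simp add: algebra_simps)
    finally show "norm (mean \<psi> t v x) \<le> (sqrt (L2sq \<psi>) + K * D) * t powr (- \<gamma>) * ?N" .
  qed
qed

text \<open>Sobolev embedding in Ehrling's form. Integrate the scale derivative from 0 to
  \<open>t\<close>: as s > n/2, its exponent can be taken below 1, so this part is small for small
  \<open>t\<close>. The average at the fixed scale \<open>t\<close> is bounded in the mean.\<close>

lemma sobolev_ehrling:
  assumes s: "real s > real CARD('n::finite) / 2" and \<eta>: "\<eta> > 0"
  shows "\<exists>C\<ge>0. \<forall>(v::real^'n \<Rightarrow> complex) x. tf v \<longrightarrow> norm (v x) \<le> \<eta> * sqrt (sobn s v) + C * sqrt (L2sq v)"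
proof -
  obtain r where r: "s = Suc r" using s by (cases s) auto
  let ?\<psi> = "moll 1 :: real^'n \<Rightarrow> complex"
  have L\<psi>: "L2c ?\<psi>" by (intro tf_L2c tf_moll) simp
  define b where "b = real CARD('n) / 2 - real r"
  define \<gamma>' where "\<gamma>' = max 0 ((b + 1) / 2)"
  have \<gamma>': "\<gamma>' \<ge> 0" "\<gamma>' > b" "\<gamma>' < 1" using s by (auto simp: \<gamma>'_def b_def r max_def)
  have "\<forall>i. \<exists>C\<ge>0. \<forall>v x t. tf v \<longrightarrow> 0 < t \<longrightarrow> t \<le> 1 \<longrightarrow>
      norm (mean (\<lambda>h. of_real (h $ i) * ?\<psi> h) t v x) \<le> C * t powr (- \<gamma>') * sqrt (sobn r v)"
    using mean_bound[OF L2c_coord[OF L\<psi>] \<gamma>'(1) \<gamma>'(2)[unfolded b_def]] by blast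
  then obtain C where C: "\<And>i. C i \<ge> 0" "\<And>i v x t. tf v \<Longrightarrow> 0 < t \<Longrightarrow> t \<le> 1 \<Longrightarrow>
      norm (mean (\<lambda>h. of_real (h $ i) * ?\<psi> h) t v x) \<le> C i * t powr (- \<gamma>') * sqrt (sobn r v)"
    by metis
  define K where "K = (\<Sum>i\<in>UNIV. C i)"
  have K: "K \<ge> 0" unfolding K_def by (intro sum_nonneg C(1))
  have "((\<lambda>t::real. t powr (1 - \<gamma>')) \<longlongrightarrow> 0) (at_right 0)"
    by (rule tendsto_zero_powrI[OF tendsto_ident_at tendsto_const])
       (use \<gamma>' eventually_mono[OF eventually_at_right_less[of 0] less_imp_le] in auto)
  then have "((\<lambda>t. K * (t powr (1 - \<gamma>') / (1 - \<gamma>'))) \<longlongrightarrow> K * (0 / (1 - \<gamma>'))) (at_right 0)"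
    using \<gamma>' by (intro tendsto_mult tendsto_divide tendsto_const) auto
  then have "\<forall>\<^sub>F t in at_right 0. K * (t powr (1 - \<gamma>') / (1 - \<gamma>')) < \<eta>"
    using \<eta> by (intro order_tendstoD) auto
  moreover have "\<forall>\<^sub>F t in at_right (0::real). t < 1" by (rule eventually_at_right_real[of 0 1, simplified, THEN eventually_mono]) auto
  moreover have "\<forall>\<^sub>F t in at_right (0::real). 0 < t" by (rule eventually_at_right_less)
  ultimately have "\<forall>\<^sub>F t in at_right 0. K * (t powr (1 - \<gamma>') / (1 - \<gamma>')) < \<eta> \<and> t < 1 \<and> 0 < t"
    by eventually_elim auto
  from eventually_happens[OF this] obtain t where t: "K * (t powr (1 - \<gamma>') / (1 - \<gamma>')) < \<eta>" "t < 1" "0 < t"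
    by (auto simp: trivial_limit_at_right_real)
  define C1 where "C1 = sqrt (L2sq ?\<psi>) * t powr (- (CARD('n) / 2))"
  show ?thesis
  proof (intro exI[of _ C1] conjI allI impI)
    show "C1 \<ge> 0" by (simp add: C1_def)
    fix v :: "real^'n \<Rightarrow> complex" and x assume v: "tf v"
    let ?N = "sqrt (sobn s v)"
    let ?\<Phi> = "\<lambda>\<tau>. (K * ?N) * (\<tau> powr (1 - \<gamma>') / (1 - \<gamma>'))"
    have d: "((\<lambda>t. mean ?\<psi> t v x) has_vector_derivative (\<Sum>i\<in>UNIV. mean (\<lambda>h. of_real (h $ i) * ?\<psi> h) t (partial i v) x)) (at t)" for t
      by (rule mean_has_vector_derivative[OF L\<psi> v])
    have "norm (mean ?\<psi> t v x - mean ?\<psi> 0 v x) \<le> ?\<Phi> t - ?\<Phi> 0"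
    proof (rule differentiable_bound_general[OF t(3), where f="\<lambda>t. mean ?\<psi> t v x"
          and f'="\<lambda>t. \<Sum>i\<in>UNIV. mean (\<lambda>h. of_real (h $ i) * ?\<psi> h) t (partial i v) x" and \<phi>="?\<Phi>"
          and \<phi>'="\<lambda>\<tau>. (K * ?N) * \<tau> powr (- \<gamma>')"])
      show "continuous_on {0..t} (\<lambda>t. mean ?\<psi> t v x)"
        by (intro continuous_at_imp_continuous_on ballI has_vector_derivative_continuous[OF d])
      show "continuous_on {0..t} ?\<Phi>"
        using \<gamma>' by (intro continuous_on_mult continuous_on_divide continuous_on_const continuous_on_powr' continuous_on_id) auto
      fix \<tau> assume \<tau>: "0 < \<tau>" "\<tau> < t"
      show "(?\<Phi> has_vector_derivative (K * ?N) * \<tau> powr (- \<gamma>')) (at \<tau>)"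
        by (rule powr_primitive) (use \<tau> \<gamma>' in auto)
      show "norm (\<Sum>i\<in>UNIV. mean (\<lambda>h. of_real (h $ i) * ?\<psi> h) \<tau> (partial i v) x) \<le> K * ?N * \<tau> powr (- \<gamma>')"
        unfolding K_def r by (rule mean_deriv_bound[OF C(2) C(1) v]) (use \<tau> t in auto)
    qed (rule d)
    also have "\<dots> = K * (t powr (1 - \<gamma>') / (1 - \<gamma>')) * ?N" by simp
    also have "\<dots> \<le> \<eta> * ?N" using t(1) by (intro mult_right_mono) auto
    finally have 1: "norm (mean ?\<psi> t v x - mean ?\<psi> 0 v x) \<le> \<eta> * ?N" .
    have 2: "norm (mean ?\<psi> t v x) \<le> C1 * sqrt (L2sq v)"
      using mean_L2_bound[OF L\<psi> v t(3), of x] by (simp add: C1_def mult.assoc)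
    have "mean ?\<psi> 0 v x = v x"
      using integral_moll[of 1, where 'n='n] by (simp add: mean_def)
    then show "norm (v x) \<le> \<eta> * ?N + C1 * sqrt (L2sq v)"
      using 1 2 norm_triangle_ineq4[of "mean ?\<psi> t v x" "mean ?\<psi> t v x - mean ?\<psi> 0 v x"] by simp
  qed
qed

lemma sobolev_sup:
  assumes s: "real s > real CARD('n::finite) / 2"
  shows "\<exists>C\<ge>0. \<forall>(v::real^'n \<Rightarrow> complex) x. tf v \<longrightarrow> norm (v x) \<le> C * sqrt (sobn s v)"
proof -
  obtain C where C: "C \<ge> 0" "\<And>(v::real^'n \<Rightarrow> complex) x. tf v \<Longrightarrow> norm (v x) \<le> 1 * sqrt (sobn s v) + C * sqrt (L2sq v)"
    using sobolev_ehrling[OF s, of 1] by auto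
  have "norm (v x) \<le> (1 + C) * sqrt (sobn s v)" if "tf v" for v :: "real^'n \<Rightarrow> complex" and x
    using C(2)[OF that, of x] mult_left_mono[OF real_sqrt_le_mono[OF L2sq_le_sobn[of v s]] C(1)] by (simp add: distrib_right)
  then show ?thesis using C(1) by (intro exI[of _ "1 + C"]) auto
qed

text \<open>Integrate by parts once and apply Cauchy-Schwarz. It lets smallness in the mean pass to
  first derivatives when second derivatives are bounded.\<close>

lemma L2sq_interpolation:
  assumes v: "tf v"
  shows "L2sq (partial i v) \<le> sqrt (L2sq v) * sqrt (L2sq (partial i (partial i v)))"
proof -
  have t: "tf (partial i v)" "tf (partial i (partial i v))" by (intro test_fun_partial v)+
  have "of_real (L2sq (partial i v)) = (\<integral>x. of_real ((norm (partial i v x))\<^sup>2) \<partial>lborel :: complex)"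
    unfolding L2sq_def by (rule integral_of_real[symmetric, OF L2cD(2)[OF tf_L2c[OF t(1)]]])
  also have "\<dots> = (\<integral>x. partial i v x * cnj (partial i v x) \<partial>lborel)"
    by (simp only: complex_norm_square)
  also have "\<dots> = - (\<integral>x. v x * cnj (partial i (partial i v) x) \<partial>lborel)"
    using integral_by_parts[OF v tf_cnj[OF t(1)], of i] by (simp add: partial_cnj[OF t(1)])
  finally have "norm (complex_of_real (L2sq (partial i v))) = norm (\<integral>x. v x * cnj (partial i (partial i v) x) \<partial>lborel)"
    by simp
  then show ?thesis
    using L2_cauchy_schwarz[OF tf_L2c[OF v] tf_L2c[OF t(2)]] by simp
qed

subsection \<open>Uniform limits with bounded derivatives\<close>

text \<open>A quantitative \<open>Ck\<close>: one bound \<open>D\<close> for all derivatives up to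
  order \<open>m\<close>. Differentiability is taken at points of full space, so it is applied with
  open \<open>B\<close>.\<close>

fun CBon :: "nat \<Rightarrow> (real^'n::finite) set \<Rightarrow> real \<Rightarrow> (real^'n \<Rightarrow> complex) \<Rightarrow> bool" where
  "CBon 0 B D V = (continuous_on B V \<and> (\<forall>x\<in>B. norm (V x) \<le> D))"
| "CBon (Suc m) B D V = ((\<forall>x\<in>B. norm (V x) \<le> D) \<and> (\<forall>x\<in>B. V differentiable at x) \<and> (\<forall>i. CBon m B D (partial i V)))"

lemma CBon_bound: "CBon m B D V \<Longrightarrow> x \<in> B \<Longrightarrow> norm (V x) \<le> D"
  by (cases m) auto

lemma CBon_subset: "CBon m B D V \<Longrightarrow> B' \<subseteq> B \<Longrightarrow> CBon m B' D V"
  by (induction m arbitrary: V) (auto intro: continuous_on_subset)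

lemma CBon_lower: "CBon (Suc m) B D V \<Longrightarrow> CBon m B D V"
proof (induction m arbitrary: V)
  case 0
  then show ?case
    by (auto intro!: continuous_at_imp_continuous_on differentiable_imp_continuous_within)
next
  case (Suc m)
  have "CBon m B D (partial i V)" for i
    using Suc.IH[of "partial i V"] Suc.prems CBon.simps(2)[of "Suc m" B D V] by blast
  moreover have "\<forall>x\<in>B. norm (V x) \<le> D" "\<forall>x\<in>B. V differentiable at x"
    using Suc.prems CBon.simps(2)[of "Suc m" B D V] by blast+
  ultimately show ?case by simp
qed

lemma CBon_cong:
  assumes "open B" "\<And>x. x \<in> B \<Longrightarrow> V x = W x" "CBon m B D V"
  shows "CBon m B D W"
  using assms(2,3)
proof (induction m arbitrary: V W)
  case 0
  then show ?case by (simp cong: continuous_on_cong)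
next
  case (Suc m)
  have "W differentiable at x" if "x \<in> B" for x
  proof -
    have "(V has_derivative frechet_derivative V (at x)) (at x)"
      using Suc.prems(2) that by (simp add: frechet_derivative_works)
    from has_derivative_transform_within_open[OF this assms(1) that, of W] Suc.prems(1)
    show ?thesis unfolding differentiable_def by blast
  qed
  moreover have "CBon m B D (partial i W)" for i
  proof (rule Suc.IH)
    show "partial i V x = partial i W x" if "x \<in> B" for x
      using partial_cong_open[OF assms(1) that Suc.prems(1)] .
    show "CBon m B D (partial i V)" using Suc.prems(2) by simp
  qed
  ultimately show ?case using Suc.prems by simp
qed

lemma CBon_cmult:
  assumes "open B" "norm c \<le> c'"
  shows "CBon m B D V \<Longrightarrow> CBon m B (c' * D) (\<lambda>x. c * V x)"
proof (induction m arbitrary: V)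
  case 0
  then show ?case
    using assms(2) norm_ge_zero[of c]
    by (auto intro!: continuous_intros simp: norm_mult intro!: mult_mono intro: order_trans[OF norm_ge_zero])
next
  case (Suc m)
  have d: "V differentiable at x" if "x \<in> B" for x using Suc.prems that by simp
  have b: "norm (V x) \<le> D" if "x \<in> B" for x using Suc.prems that by simp
  have "norm (c * V x) \<le> c' * D" if "x \<in> B" for x
    unfolding norm_mult
    by (rule mult_mono) (use assms(2) b[OF that] norm_ge_zero[of c] in \<open>auto intro: order_trans[OF norm_ge_zero]\<close>)
  moreover have "(\<lambda>x. c * V x) differentiable at x" if "x \<in> B" for x
    using d[OF that] by (intro differentiable_mult) auto
  moreover have "CBon m B (c' * D) (partial i (\<lambda>x. c * V x))" for i
  proof (rule CBon_cong[OF assms(1)])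
    show "CBon m B (c' * D) (\<lambda>x. c * partial i V x)" using Suc.prems by (intro Suc.IH) simp
    show "c * partial i V x = partial i (\<lambda>x. c * V x) x" if "x \<in> B" for x
      using partial_mult[of "\<lambda>_. c" x V i] d[OF that] by simp
  qed
  ultimately show ?case by simp
qed

definition L2Cauchy :: "(nat \<Rightarrow> real^'n::finite \<Rightarrow> complex) \<Rightarrow> bool" where
  "L2Cauchy v \<longleftrightarrow> (\<forall>\<eta>>0. \<exists>N. \<forall>i\<ge>N. \<forall>j\<ge>N. L2sq (\<lambda>x. v i x - v j x) \<le> \<eta>)"

lemma sobn_diff_le:
  assumes "tf f" "tf g" "sobn s f \<le> M" "sobn s g \<le> M"
  shows "sqrt (sobn s (\<lambda>x. f x - g x)) \<le> 2 * sqrt M"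
proof -
  have "sobn s (\<lambda>x. f x - g x) \<le> 4 * M" using sobn_diff[OF assms(1,2), of s] assms(3,4) by simp
  then have "sqrt (sobn s (\<lambda>x. f x - g x)) \<le> sqrt (4 * M)" by (rule real_sqrt_le_mono)
  then show ?thesis by (simp add: real_sqrt_mult)
qed

lemma fraction_bounds:
  fixes e q :: real
  assumes "e > 0" "q \<ge> 0"
  shows "e / (4 * (q + 1)) > 0" "e / (4 * (q + 1)) * (2 * q) \<le> e / 2"
    "e / (2 * q + 1) > 0" "e / (2 * q + 1) * (2 * q) \<le> e"
  using assms by (simp_all add: field_simps add_nonneg_pos)

text \<open>Apply \<open>sobolev_ehrling\<close> to differences: the Sobolev part is bounded and
  carries a small factor, the mean-square part tends to 0.\<close>

lemma uniform_limit_of_L2Cauchy: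
  fixes v :: "nat \<Rightarrow> real^'n::finite \<Rightarrow> complex"
  assumes s: "real s > real CARD('n) / 2" and v: "\<And>j. tf (v j)" and M: "\<And>j. sobn s (v j) \<le> M" and C: "L2Cauchy v"
  obtains V where "uniform_limit UNIV v V sequentially"
proof -
  have M0: "M \<ge> 0" using M[of 0] sobn_nonneg[of s "v 0"] by linarith
  have "uniformly_Cauchy_on UNIV v"
    unfolding uniformly_Cauchy_on_def
  proof (intro allI impI)
    fix e :: real assume e: "e > 0"
    \<comment> \<open>The order of choice matters: \<open>\<eta>\<close> depends on
      \<open>M\<close>, then \<open>K\<close> on \<open>\<eta>\<close>, then \<open>\<theta>\<close>
      on \<open>K\<close>.\<close>
    define \<eta> where "\<eta> = e / (4 * (sqrt M + 1))"
    have \<eta>: "\<eta> > 0" "\<eta> * (2 * sqrt M) \<le> e / 2"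
      unfolding \<eta>_def using fraction_bounds(1,2)[OF e] M0 by simp_all
    obtain K where K: "K \<ge> 0" "\<And>(v::real^'n \<Rightarrow> complex) x. tf v \<Longrightarrow> norm (v x) \<le> \<eta> * sqrt (sobn s v) + K * sqrt (L2sq v)"
      using sobolev_ehrling[OF s \<eta>(1)] by blast
    define \<theta> where "\<theta> = e / (4 * (K + 1))"
    have "\<theta> > 0" unfolding \<theta>_def by (rule fraction_bounds(1)[OF e K(1)])
    moreover have "\<theta> * (2 * K) \<le> e / 2" unfolding \<theta>_def by (rule fraction_bounds(2)[OF e K(1)])
    ultimately have \<theta>: "\<theta> > 0" "K * \<theta> < e / 2" using e by (simp_all add: mult.commute)
    then obtain N where N: "\<And>i j. i \<ge> N \<Longrightarrow> j \<ge> N \<Longrightarrow> L2sq (\<lambda>x. v i x - v j x) \<le> \<theta>\<^sup>2"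
      using C unfolding L2Cauchy_def by (metis zero_less_power)
    show "\<exists>N. \<forall>x\<in>UNIV. \<forall>i\<ge>N. \<forall>j\<ge>N. dist (v i x) (v j x) < e"
    proof (intro exI[of _ N] ballI allI impI)
      fix x i j assume ij: "N \<le> i" "N \<le> j"
      have "norm (v i x - v j x) \<le> \<eta> * sqrt (sobn s (\<lambda>x. v i x - v j x)) + K * sqrt (L2sq (\<lambda>x. v i x - v j x))"
        by (rule K(2)) (intro test_fun_diff v)
      also have "\<dots> \<le> \<eta> * (2 * sqrt M) + K * \<theta>"
      proof (intro add_mono mult_left_mono sobn_diff_le v M K(1))
        show "sqrt (L2sq (\<lambda>x. v i x - v j x)) \<le> \<theta>"
          using real_sqrt_le_mono[OF N[OF ij]] \<theta>(1) by simp
      qed (use \<eta> in simp)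
      also have "\<dots> < e" using \<eta>(2) \<theta>(2) by linarith
      finally show "dist (v i x) (v j x) < e" by (simp add: dist_norm)
    qed
  qed
  then have "uniformly_convergent_on UNIV v" by (rule Cauchy_uniformly_convergent)
  then show ?thesis using that unfolding uniformly_convergent_on_def by blast
qed

lemma L2Cauchy_partial:
  fixes v :: "nat \<Rightarrow> real^'n::finite \<Rightarrow> complex"
  assumes v: "\<And>j. tf (v j)" and M: "\<And>j. sobn (Suc (Suc 0)) (v j) \<le> M" and C: "L2Cauchy v"
  shows "L2Cauchy (\<lambda>j. partial i (v j))"
  unfolding L2Cauchy_def
proof (intro allI impI)
  fix \<eta> :: real assume \<eta>: "\<eta> > 0"
  have M0: "M \<ge> 0" using M[of 0] sobn_nonneg[of "Suc (Suc 0)" "v 0"] by linarith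
  define \<theta> where "\<theta> = \<eta> / (2 * sqrt M + 1)"
  have \<theta>: "\<theta> > 0" "\<theta> * (2 * sqrt M) \<le> \<eta>" 
    unfolding \<theta>_def using fraction_bounds(3,4)[OF \<eta>] M0 by simp_all
  then obtain N where N: "\<And>k j. k \<ge> N \<Longrightarrow> j \<ge> N \<Longrightarrow> L2sq (\<lambda>x. v k x - v j x) \<le> \<theta>\<^sup>2"
    using C unfolding L2Cauchy_def by (metis zero_less_power)
  show "\<exists>N. \<forall>k\<ge>N. \<forall>j\<ge>N. L2sq (\<lambda>x. partial i (v k) x - partial i (v j) x) \<le> \<eta>"
  proof (intro exI[of _ N] allI impI)
    fix k j assume kj: "N \<le> k" "N \<le> j"
    let ?d = "\<lambda>x. v k x - v j x"
    have d: "tf ?d" by (intro test_fun_diff v)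
    have "L2sq (partial i ?d) \<le> sqrt (L2sq ?d) * sqrt (L2sq (partial i (partial i ?d)))" by (rule L2sq_interpolation[OF d])
    also have "\<dots> \<le> \<theta> * (2 * sqrt M)"
    proof (intro mult_mono)
      show "sqrt (L2sq ?d) \<le> \<theta>" using real_sqrt_le_mono[OF N[OF kj]] \<theta>(1) by simp
      have "L2sq (partial i (partial i ?d)) \<le> sobn (Suc (Suc 0)) ?d"
        using sobn_partial[of 0 i "partial i ?d"] sobn_partial[of "Suc 0" i ?d] by simp
      then show "sqrt (L2sq (partial i (partial i ?d))) \<le> 2 * sqrt M"
        using real_sqrt_le_mono sobn_diff_le[OF v v M M, of k j] order_trans by blast
    qed (use \<theta> in auto)
    also have "\<dots> \<le> \<eta>" by (rule \<theta>)
    finally show "L2sq (\<lambda>x. partial i (v k) x - partial i (v j) x) \<le> \<eta>"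
      by (simp add: partial_diff_tf[OF v v])
  qed
qed

text \<open>The hypotheses pass to first derivatives with \<open>m\<close> lowered by one, by
  interpolation; uniform convergence of the derivatives then identifies the derivative of the limit.
  The bound \<open>C * sqrt M\<close> depends on the sequence only through \<open>M\<close>.\<close>

lemma uniform_limit_CBon:
  assumes s: "real s > real CARD('n::finite) / 2"
    and C: "\<And>(v::real^'n \<Rightarrow> complex) x. tf v \<Longrightarrow> norm (v x) \<le> C * sqrt (sobn s v)" "C \<ge> 0"
  shows "(\<And>j. tf (v j)) \<Longrightarrow> (\<And>j. sobn (m + s) (v j) \<le> M) \<Longrightarrow> L2Cauchy v \<Longrightarrow>
     \<exists>V. uniform_limit UNIV v (V::real^'n \<Rightarrow> complex) sequentially \<and> CBon m UNIV (C * sqrt M) V"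
proof (induction m arbitrary: v)
  case (0 v)
  have M: "sobn s (v j) \<le> M" for j using 0(2)[of j] by simp
  obtain V where V: "uniform_limit UNIV v V sequentially"
    using uniform_limit_of_L2Cauchy[OF s 0(1) M 0(3)] by blast
  have "continuous_on UNIV V"
    by (rule uniform_limit_theorem[OF _ V]) (auto intro!: always_eventually tf_continuous_on 0(1))
  moreover have "norm (V x) \<le> C * sqrt M" for x
  proof (rule LIMSEQ_le_const2)
    show "(\<lambda>j. norm (v j x)) \<longlonglongrightarrow> norm (V x)" by (intro tendsto_norm tendsto_uniform_limitI[OF V]) simp
    show "\<exists>N. \<forall>j\<ge>N. norm (v j x) \<le> C * sqrt M"
      using order_trans[OF C(1)[OF 0(1)] mult_left_mono[OF real_sqrt_le_mono[OF M] C(2)]] by blast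
  qed
  ultimately show ?case using V by auto
next
  case (Suc m v)
  \<comment> \<open>Ensures that the order \<open>Suc m + s\<close> is at least 2, as interpolation
    requires.\<close>
  have s1: "s \<ge> 1" using s by (cases s) auto
  have M2: "sobn (Suc (Suc 0)) (v j) \<le> M" and Ms: "sobn s (v j) \<le> M" for j
    using sobn_mono[of "Suc (Suc 0)" "Suc m + s" "v j"] sobn_mono[of s "Suc m + s" "v j"] Suc.prems(2)[of j] s1 by auto
  obtain V where V: "uniform_limit UNIV v V sequentially"
    using uniform_limit_of_L2Cauchy[OF s Suc.prems(1) Ms Suc.prems(3)] by blast
  have bd: "norm (V x) \<le> C * sqrt M" for x
  proof (rule LIMSEQ_le_const2)
    show "(\<lambda>j. norm (v j x)) \<longlonglongrightarrow> norm (V x)" by (intro tendsto_norm tendsto_uniform_limitI[OF V]) simp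
    show "\<exists>N. \<forall>j\<ge>N. norm (v j x) \<le> C * sqrt M"
      using order_trans[OF C(1)[OF Suc.prems(1)] mult_left_mono[OF real_sqrt_le_mono[OF Ms] C(2)]] by blast
  qed
  have "\<exists>W. uniform_limit UNIV (\<lambda>j. partial i (v j)) W sequentially \<and> CBon m UNIV (C * sqrt M) W" for i
  proof (rule Suc.IH)
    show "tf (partial i (v j))" for j by (intro test_fun_partial Suc.prems)
    show "sobn (m + s) (partial i (v j)) \<le> M" for j
      using sobn_partial[of "m + s" i "v j"] Suc.prems(2)[of j] by simp
    show "L2Cauchy (\<lambda>j. partial i (v j))" by (rule L2Cauchy_partial[OF Suc.prems(1) M2 Suc.prems(3)])
  qed
  then obtain W where W: "\<And>i. uniform_limit UNIV (\<lambda>j. partial i (v j)) (W i) sequentially"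
    "\<And>i. CBon m UNIV (C * sqrt M) (W i)" by metis
  let ?g' = "\<lambda>x h. \<Sum>i\<in>UNIV. h $ i *\<^sub>R W i x"
  have L0: "(\<lambda>n. v n 0) \<longlonglongrightarrow> V 0" by (rule tendsto_uniform_limitI[OF V]) simp
  have "\<exists>g. \<forall>x\<in>UNIV. (\<lambda>n. v n x) \<longlonglongrightarrow> g x \<and> (g has_derivative ?g' x) (at x within UNIV)"
  proof (rule has_derivative_sequence[where S=UNIV and f=v and l="V 0" and ?x0.0=0
        and f'="\<lambda>n x. frechet_derivative (v n) (at x)", OF convex_UNIV])
    show "(0::real^'n) \<in> UNIV" by simp
    show "(\<lambda>n. v n 0) \<longlonglongrightarrow> V 0" by (rule L0)
    show "(v n has_derivative frechet_derivative (v n) (at x)) (at x within UNIV)" for n x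
      using tf_has_derivative[OF Suc.prems(1)] by simp
    fix e :: real assume e: "e > 0"
    have "\<forall>\<^sub>F n in sequentially. \<forall>i. \<forall>x\<in>UNIV. dist (partial i (v n) x) (W i x) < e / CARD('n)"
      by (rule eventually_all_finite) (use W(1) e in \<open>auto simp: uniform_limit_iff\<close>)
    then show "\<forall>\<^sub>F n in sequentially. \<forall>x\<in>UNIV. \<forall>h. norm (frechet_derivative (v n) (at x) h - ?g' x h) \<le> e * norm h"
    proof eventually_elim
      case (elim n)
      show ?case
      proof (intro ballI allI)
        fix x and h :: "real^'n"
        have "frechet_derivative (v n) (at x) h - ?g' x h = (\<Sum>i\<in>UNIV. h $ i *\<^sub>R (partial i (v n) x - W i x))"
          unfolding frechet_partial_sum[OF tf_has_derivative[OF Suc.prems(1)]]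
          by (simp add: sum_subtractf scaleR_diff_right)
        also have "norm \<dots> \<le> (\<Sum>i\<in>(UNIV::'n set). norm h * (e / CARD('n)))"
        proof (rule sum_norm_le)
          fix i
          have "norm (partial i (v n) x - W i x) \<le> e / CARD('n)"
            using elim by (simp add: dist_norm less_imp_le)
          then show "norm (h $ i *\<^sub>R (partial i (v n) x - W i x)) \<le> norm h * (e / CARD('n))"
            unfolding norm_scaleR by (intro mult_mono component_le_norm_cart) auto
        qed
        also have "\<dots> = e * norm h" by simp
        finally show "norm (frechet_derivative (v n) (at x) h - ?g' x h) \<le> e * norm h" .
      qed
    qed
  qed
  then obtain g where g: "\<And>x. (\<lambda>n. v n x) \<longlonglongrightarrow> g x" "\<And>x. (g has_derivative ?g' x) (at x)" by auto
  have "g = V"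
    by (rule ext, rule LIMSEQ_unique[OF g(1)], rule tendsto_uniform_limitI[OF V]) simp
  then have D: "(V has_derivative ?g' x) (at x)" for x using g(2) by simp
  have "partial i V = W i" for i
  proof
    fix x
    have "partial i V x = (\<Sum>j\<in>UNIV. axis i 1 $ j *\<^sub>R W j x)" by (rule partialI[OF D])
    also have "\<dots> = (\<Sum>j\<in>UNIV. if j = i then W j x else 0)"
      by (intro sum.cong) (auto simp: axis_def)
    finally show "partial i V x = W i x" by simp
  qed
  then show ?case using V bd W(2) D by (intro exI[of _ V]) (auto intro: differentiableI[OF D])
qed

lemma scale_cancel: "\<rho> > 0 \<Longrightarrow> complex_of_real (1 / \<rho> ^ j) * (of_real (\<rho> ^ j) * y) = y"
  unfolding mult.assoc[symmetric] of_real_mult[symmetric] by simp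

subsection \<open>Power series with coefficients in \<open>C\<^sup>m\<close>\<close>

lemma mult_power_bounded:
  assumes "0 < q" "q < (1::real)" shows "\<exists>c. \<forall>j. real (Suc j) * q ^ j \<le> c"
proof -
  have "(\<lambda>n. of_nat n * q ^ n) \<longlonglongrightarrow> 0" using assms by (intro powser_times_n_limit_0) auto
  then have "Bseq (\<lambda>n. of_nat n * q ^ n)" by (intro convergent_imp_Bseq convergentI)
  then obtain K where K: "\<And>n. norm (of_nat n * q ^ n) \<le> K" unfolding Bseq_def by blast
  have "real (Suc j) * q ^ j \<le> K / q" for j
    using K[of "Suc j"] assms by (simp add: field_simps)
  then show ?thesis by blast
qed

text \<open>Cauchy estimates for the coefficients, local in \<open>x\<close> and for every radius
  \<open>\<rho>\<close> below \<open>S\<close>. The freedom in \<open>\<rho>\<close> absorbs the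
  factors that differentiation in \<open>z\<close> produces.\<close>

definition series_bounded :: "real \<Rightarrow> (real^'n::finite) set \<Rightarrow> nat \<Rightarrow> (nat \<Rightarrow> real^'n \<Rightarrow> complex) \<Rightarrow> bool" where
  "series_bounded S \<Omega> m g \<longleftrightarrow> (\<forall>\<rho> x0. 0 < \<rho> \<longrightarrow> \<rho> < S \<longrightarrow> x0 \<in> \<Omega> \<longrightarrow>
     (\<exists>r D. r > 0 \<and> (\<forall>j. CBon m (ball x0 r) D (\<lambda>x. of_real (\<rho> ^ j) * g j x))))"

definition pow_sum :: "(nat \<Rightarrow> real^'n::finite \<Rightarrow> complex) \<Rightarrow> complex \<times> (real^'n) \<Rightarrow> complex" where
  "pow_sum g p = (\<Sum>j. fst p ^ j * g j (snd p))"

lemma series_bounded_lower: "series_bounded S \<Omega> (Suc m) g \<Longrightarrow> series_bounded S \<Omega> m g"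
  unfolding series_bounded_def using CBon_lower by meson

lemma series_bounded_partial:
  assumes "series_bounded S \<Omega> (Suc m) g" shows "series_bounded S \<Omega> m (\<lambda>j. partial i (g j))"
  unfolding series_bounded_def
proof (intro allI impI)
  fix \<rho> x0 assume *: "0 < \<rho>" "\<rho> < S" "x0 \<in> \<Omega>"
  then obtain r D where r: "r > 0" "\<And>j. CBon (Suc m) (ball x0 r) D (\<lambda>x. of_real (\<rho> ^ j) * g j x)"
    using assms unfolding series_bounded_def by blast
  have "CBon m (ball x0 r) D (\<lambda>x. of_real (\<rho> ^ j) * partial i (g j) x)" for j
  proof (rule CBon_cong)
    show "CBon m (ball x0 r) D (partial i (\<lambda>x. of_real (\<rho> ^ j) * g j x))" using r(2)[of j] by simp
    fix x assume x: "x \<in> ball x0 r"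
    have "(\<lambda>x. of_real (\<rho> ^ j) * g j x) differentiable at x"
      using r(2)[of j, unfolded CBon.simps(2), THEN conjunct2, THEN conjunct1] x by (rule bspec)
    then have "(\<lambda>x. of_real (1 / \<rho> ^ j) * (of_real (\<rho> ^ j) * g j x)) differentiable at x"
      by (rule differentiable_mult[OF differentiable_const])
    then have "g j differentiable at x" by (simp only: scale_cancel[OF *(1)])
    then show "partial i (\<lambda>x. of_real (\<rho> ^ j) * g j x) x = of_real (\<rho> ^ j) * partial i (g j) x"
      using partial_mult[of "\<lambda>_. of_real (\<rho> ^ j)" x "g j" i] by simp
  qed simp
  then show "\<exists>r D. r > 0 \<and> (\<forall>j. CBon m (ball x0 r) D (\<lambda>x. of_real (\<rho> ^ j) * partial i (g j) x))"
    using r(1) by blast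
qed

lemma series_bounded_shift:
  assumes "series_bounded S \<Omega> m g" shows "series_bounded S \<Omega> m (\<lambda>j x. of_nat (Suc j) * g (Suc j) x)"
  unfolding series_bounded_def
proof (intro allI impI)
  fix \<rho> x0 assume *: "0 < \<rho>" "\<rho> < S" "x0 \<in> \<Omega>"
  \<comment> \<open>Passing to a larger radius turns the factor \<open>Suc j\<close> into the
    bounded sequence (j + 1)(\<rho>/\<rho>')^j.\<close>
  define \<rho>' where "\<rho>' = (\<rho> + S) / 2"
  have \<rho>': "0 < \<rho>'" "\<rho> < \<rho>'" "\<rho>' < S" using * by (auto simp: \<rho>'_def)
  then obtain r D where r: "r > 0" "\<And>j. CBon m (ball x0 r) D (\<lambda>x. of_real (\<rho>' ^ j) * g j x)"
    using assms *(3) unfolding series_bounded_def by blast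
  have "0 < \<rho> / \<rho>'" "\<rho> / \<rho>' < 1" using * \<rho>' by auto
  then obtain c where c: "\<And>j. real (Suc j) * (\<rho> / \<rho>') ^ j \<le> c" using mult_power_bounded by blast
  have "CBon m (ball x0 r) (c / \<rho>' * D) (\<lambda>x. of_real (\<rho> ^ j) * (of_nat (Suc j) * g (Suc j) x))" for j
  proof -
    let ?c = "of_real (real (Suc j) * (\<rho> / \<rho>') ^ j / \<rho>') :: complex"
    have "norm ?c = real (Suc j) * (\<rho> / \<rho>') ^ j / \<rho>'" unfolding norm_of_real using * \<rho>' by (intro abs_of_nonneg) simp
    then have "norm ?c \<le> c / \<rho>'" using c[of j] \<rho>' by (simp add: divide_right_mono)
    from CBon_cmult[OF open_ball this r(2)[of "Suc j"]]
    have "CBon m (ball x0 r) (c / \<rho>' * D) (\<lambda>x. ?c * (of_real (\<rho>' ^ Suc j) * g (Suc j) x))" .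
    moreover have "?c * (of_real (\<rho>' ^ Suc j) * y) = of_real (\<rho> ^ j) * (of_nat (Suc j) * y)" for y
      using \<rho>' by (simp add: power_divide)
    ultimately show ?thesis by simp
  qed
  then show "\<exists>r D. r > 0 \<and> (\<forall>j. CBon m (ball x0 r) D (\<lambda>x. of_real (\<rho> ^ j) * (of_nat (Suc j) * g (Suc j) x)))"
    using r(1) by blast
qed

lemma series_majorant:
  assumes g: "series_bounded S \<Omega> m g" and z0: "norm z0 < S" and x0: "x0 \<in> \<Omega>"
  obtains \<rho> r q D where "norm z0 < \<rho>" "r > 0" "0 < q" "q < 1" "D \<ge> 0"
    "\<And>j z x. norm z < \<rho> \<Longrightarrow> x \<in> ball x0 r \<Longrightarrow> norm (z ^ j * g j x) \<le> D * q ^ j"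
proof -
  \<comment> \<open>Two intermediate radii: \<open>z\<close> ranges below \<open>\<rho>\<close>, the
    coefficients are bounded at \<open>\<rho>2\<close>, and the ratio is that of the geometric
    majorant.\<close>
  define \<rho> where "\<rho> = (2 * norm z0 + S) / 3"
  define \<rho>2 where "\<rho>2 = (norm z0 + 2 * S) / 3"
  have "0 \<le> norm z0" by simp
  then have \<rho>: "norm z0 < \<rho>" "\<rho> < \<rho>2" "\<rho>2 < S" "0 < \<rho>" "0 < \<rho>2"
    using z0 unfolding \<rho>_def \<rho>2_def by (simp_all, linarith+)
  obtain r D where r: "r > 0" "\<And>j. CBon m (ball x0 r) D (\<lambda>x. of_real (\<rho>2 ^ j) * g j x)"
    using g x0 \<rho> unfolding series_bounded_def by blast
  have D: "norm (of_real (\<rho>2 ^ j) * g j x) \<le> D" if "x \<in> ball x0 r" for j x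
    using CBon_bound[OF r(2) that] .
  have D0: "D \<ge> 0" using order_trans[OF norm_ge_zero D[of x0 0]] r(1) by simp
  have "norm (z ^ j * g j x) \<le> D * (\<rho> / \<rho>2) ^ j" if z: "norm z < \<rho>" and x: "x \<in> ball x0 r" for j z x
  proof -
    have "norm (g j x) * \<rho>2 ^ j \<le> D" using D[OF x, of j] \<rho> by (simp add: norm_mult norm_power mult.commute)
    then have "norm (g j x) \<le> D / \<rho>2 ^ j" using \<rho> by (simp add: pos_le_divide_eq)
    moreover have "norm z ^ j \<le> \<rho> ^ j" using z by (intro power_mono) auto
    ultimately have "norm z ^ j * norm (g j x) \<le> \<rho> ^ j * (D / \<rho>2 ^ j)" using \<rho> by (intro mult_mono) auto
    then show ?thesis by (simp add: norm_mult norm_power power_divide mult.commute)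
  qed
  then show ?thesis using that[of \<rho> r "\<rho> / \<rho>2" D] \<rho> r(1) D0 by auto
qed

lemma open_Times_ball: "open (ball (0::complex) \<rho> \<times> ball x0 r)"
  by (intro open_Times) auto

lemma pow_sum_continuous:
  assumes g: "series_bounded S \<Omega> m g"
  shows "continuous_on (ball 0 S \<times> \<Omega>) (pow_sum g)"
proof -
  have "Ck 0 (ball 0 S \<times> \<Omega>) (pow_sum g)"
  proof (rule Ck_local)
    fix p assume "p \<in> ball (0::complex) S \<times> \<Omega>"
    then have p: "norm (fst p) < S" "snd p \<in> \<Omega>" by auto
    obtain \<rho>1 r1 D1 where 1: "r1 > 0" "\<rho>1 > 0" "\<rho>1 < S" "\<And>j. CBon m (ball (snd p) r1) D1 (\<lambda>x. of_real (\<rho>1 ^ j) * g j x)"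
    proof -
      have "0 < S" by (rule le_less_trans[OF norm_ge_zero p(1)])
      then have "0 < (norm (fst p) + S) / 2" by (simp add: add_nonneg_pos)
      moreover have "(norm (fst p) + S) / 2 < S" using p(1) by (simp add: divide_less_eq)
      ultimately show ?thesis using that g p(2) unfolding series_bounded_def by blast
    qed
    obtain \<rho> r q D where m: "norm (fst p) < \<rho>" "r > 0" "0 < q" "q < 1"
      "\<And>j z x. norm z < \<rho> \<Longrightarrow> x \<in> ball (snd p) r \<Longrightarrow> norm (z ^ j * g j x) \<le> D * q ^ j"
      using series_majorant[OF g p] by metis
    let ?A = "ball (0::complex) \<rho> \<times> ball (snd p) (min r r1)"
    have u: "uniform_limit ?A (\<lambda>n p. \<Sum>j<n. fst p ^ j * g j (snd p)) (\<lambda>p. \<Sum>j. fst p ^ j * g j (snd p)) sequentially"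
    proof (rule Weierstrass_m_test)
      show "norm (fst p ^ j * g j (snd p)) \<le> D * q ^ j" if "p \<in> ?A" for j p
        using that by (intro m(5)) auto
      show "summable (\<lambda>j. D * q ^ j)" using m(3,4) by (intro summable_mult summable_geometric) simp
    qed
    have cg: "continuous_on (ball (snd p) r1) (g j)" for j
    proof -
      have "continuous_on (ball (snd p) r1) (\<lambda>x. of_real (\<rho>1 ^ j) * g j x)"
        using 1(4)[of j]
      proof (cases m)
        case (Suc m')
        then show ?thesis using 1(4)[of j]
          by (auto intro!: continuous_at_imp_continuous_on differentiable_imp_continuous_within)
      qed simp
      then have "continuous_on (ball (snd p) r1) (\<lambda>x. complex_of_real (1 / \<rho>1 ^ j) * (of_real (\<rho>1 ^ j) * g j x))"
        by (rule continuous_on_mult[OF continuous_on_const])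
      moreover have "(\<lambda>x. complex_of_real (1 / \<rho>1 ^ j) * (of_real (\<rho>1 ^ j) * g j x)) = g j"
        by (rule ext) (rule scale_cancel[OF 1(2)])
      ultimately show ?thesis by (simp only:)
    qed
    have "continuous_on ?A (pow_sum g)"
      unfolding pow_sum_def[abs_def]
    proof (rule uniform_limit_theorem[OF always_eventually u], intro allI continuous_on_sum continuous_on_mult)
      fix n j
      show "continuous_on ?A (\<lambda>p. fst p ^ j)" by (intro continuous_intros)
      show "continuous_on ?A (\<lambda>p. g j (snd p))"
        by (rule continuous_on_compose2[OF cg continuous_on_snd[OF continuous_on_id]]) auto
    qed simp
    then show "\<exists>V. open V \<and> p \<in> V \<and> Ck 0 V (pow_sum g)"
      using m 1(1) open_Times_ball[of \<rho> "snd p" "min r r1"]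
      by (intro exI[of _ ?A]) (auto simp: mem_Times_iff)
  qed
  then show ?thesis by simp
qed

text \<open>Termwise differentiation in both variables jointly. The derivative in \<open>z\<close>
  is the power series of the shifted coefficients, those in \<open>x\<close> are the series of the
  partial derivatives; both satisfy \<open>series_bounded\<close> at order \<open>m\<close>, so the
  induction applies to them.\<close>

lemma pow_sum_Ck:
  assumes "open \<Omega>"
  shows "series_bounded S \<Omega> m g \<Longrightarrow> Ck m (ball 0 S \<times> \<Omega>) (pow_sum g)"
proof (induction m arbitrary: g)
  case 0
  then show ?case using pow_sum_continuous by auto
next
  case (Suc m)
  let ?h = "\<lambda>j x. of_nat (Suc j) * g (Suc j) x"
  let ?H = "pow_sum ?h" and ?K = "\<lambda>i. pow_sum (\<lambda>j. partial i (g j))"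
  have sh: "series_bounded S \<Omega> m ?h" by (rule series_bounded_lower[OF series_bounded_shift[OF Suc.prems]])
  have sK: "series_bounded S \<Omega> m (\<lambda>j. partial i (g j))" for i by (rule series_bounded_partial[OF Suc.prems])
  let ?G' = "\<lambda>p d. fst d * ?H p + (\<Sum>i\<in>UNIV. snd d $ i *\<^sub>R ?K i p)"
  show ?case
  proof (rule Ck_SucI'[where f'="?G'"])
    show op: "open (ball (0::complex) S \<times> \<Omega>)" using assms by (intro open_Times) auto
    show "Ck m (ball 0 S \<times> \<Omega>) (\<lambda>p. fst d * ?H p + (\<Sum>i\<in>UNIV. snd d $ i *\<^sub>R ?K i p))" for d :: "complex \<times> (real^'a)"
      by (intro Ck_add[OF op] Ck_sum[OF op] Ck_bounded_linear[OF bounded_linear_mult_right op]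
          Ck_bounded_linear[OF bounded_linear_scaleR_right op] Suc.IH sh sK)
    fix p assume "p \<in> ball (0::complex) S \<times> \<Omega>"
    then have p: "norm (fst p) < S" "snd p \<in> \<Omega>" by auto
    obtain \<rho>g rg qg Dg where mg: "norm (fst p) < \<rho>g" "rg > 0" "0 < qg" "qg < 1"
      "\<And>j z x. norm z < \<rho>g \<Longrightarrow> x \<in> ball (snd p) rg \<Longrightarrow> norm (z ^ j * g j x) \<le> Dg * qg ^ j"
      using series_majorant[OF Suc.prems p] by metis
    obtain \<rho>h rh qh Dh where mh: "norm (fst p) < \<rho>h" "rh > 0" "0 < qh" "qh < 1" "Dh \<ge> 0"
      "\<And>j z x. norm z < \<rho>h \<Longrightarrow> x \<in> ball (snd p) rh \<Longrightarrow> norm (z ^ j * ?h j x) \<le> Dh * qh ^ j"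
      using series_majorant[OF sh p] by metis
    have "\<forall>i. \<exists>\<rho> r q D. norm (fst p) < \<rho> \<and> r > 0 \<and> 0 < q \<and> q < 1 \<and>
      (\<forall>j z x. norm z < \<rho> \<longrightarrow> x \<in> ball (snd p) r \<longrightarrow> norm (z ^ j * partial i (g j) x) \<le> D * q ^ j)"
      using series_majorant[OF sK p] by metis
    then obtain \<rho>k rk qk Dk where mk: "\<And>i. norm (fst p) < \<rho>k i" "\<And>i. rk i > 0" "\<And>i. 0 < qk i" "\<And>i. qk i < (1::real)"
      "\<And>i j z x. norm z < \<rho>k i \<Longrightarrow> x \<in> ball (snd p) (rk i) \<Longrightarrow> norm (z ^ j * partial i (g j) x) \<le> Dk i * qk i ^ j"
      by metis
    obtain \<rho>1 r1 D1 where d1: "r1 > 0" "\<rho>1 > 0" "\<rho>1 < S" "\<And>j. CBon (Suc m) (ball (snd p) r1) D1 (\<lambda>x. of_real (\<rho>1 ^ j) * g j x)"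
    proof -
      have "0 < S" by (rule le_less_trans[OF norm_ge_zero p(1)])
      then have "0 < (norm (fst p) + S) / 2" by (simp add: add_nonneg_pos)
      moreover have "(norm (fst p) + S) / 2 < S" using p(1) by (simp add: divide_less_eq)
      ultimately show ?thesis using that Suc.prems p(2) unfolding series_bounded_def by blast
    qed
    define \<rho> where "\<rho> = min (min \<rho>g \<rho>h) (Min (range \<rho>k))"
    define r where "r = min (min rg rh) (min r1 (Min (range rk)))"
    have \<rho>: "norm (fst p) < \<rho>" "\<rho> \<le> \<rho>g" "\<rho> \<le> \<rho>h" "\<And>i. \<rho> \<le> \<rho>k i"
      using mg(1) mh(1) mk(1) by (auto simp: \<rho>_def min.coboundedI2)
    have r: "r > 0" "r \<le> rg" "r \<le> rh" "r \<le> r1" "\<And>i. r \<le> rk i"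
      using mg(2) mh(2) mk(2) d1(1) by (auto simp: r_def min.coboundedI2)
    let ?A = "ball (0::complex) \<rho> \<times> ball (snd p) r"
    have Ad: "norm (fst p') < \<rho>" "snd p' \<in> ball (snd p) r" if "p' \<in> ?A" for p' using that by auto
    have pA: "p \<in> ?A" using \<rho>(1) r(1) by (auto simp: mem_Times_iff)
    have gd: "(g j has_derivative frechet_derivative (g j) (at x)) (at x)" if x: "x \<in> ball (snd p) r" for j x
    proof -
      have "x \<in> ball (snd p) r1" using x r(4) by auto
      with d1(4)[of j, unfolded CBon.simps(2), THEN conjunct2, THEN conjunct1]
      have "(\<lambda>x. of_real (\<rho>1 ^ j) * g j x) differentiable at x" by (rule bspec)
      then have "(\<lambda>x. of_real (1 / \<rho>1 ^ j) * (of_real (\<rho>1 ^ j) * g j x)) differentiable at x"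
        by (rule differentiable_mult[OF differentiable_const])
      then have "g j differentiable at x" by (simp only: scale_cancel[OF d1(2)])
      then show ?thesis by (simp add: frechet_derivative_works)
    qed
    let ?f = "\<lambda>j p. fst p ^ j * g j (snd p)"
    let ?P = "\<lambda>j p. of_nat j * fst p ^ (j - 1) * g j (snd p)"
    let ?f' = "\<lambda>j p d. fst d * ?P j p + (\<Sum>i\<in>UNIV. snd d $ i *\<^sub>R (fst p ^ j * partial i (g j) (snd p)))"
    have fd: "(?f j has_derivative ?f' j p') (at p')" if p': "p' \<in> ?A" for j p'
    proof -
      have a: "((\<lambda>p. fst p ^ j) has_derivative (\<lambda>d. of_nat j * fst d * fst p' ^ (j - 1))) (at p')"
        by (rule has_derivative_power[OF has_derivative_fst[OF has_derivative_ident]])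
      have b: "((\<lambda>p. g j (snd p)) has_derivative (\<lambda>d. frechet_derivative (g j) (at (snd p')) (snd d))) (at p')"
        by (rule has_derivative_compose[OF has_derivative_snd[OF has_derivative_ident] gd[OF Ad(2)[OF p']]])
      have "(\<lambda>d. fst p' ^ j * frechet_derivative (g j) (at (snd p')) (snd d) + of_nat j * fst d * fst p' ^ (j - 1) * g j (snd p')) = ?f' j p'"
        unfolding frechet_partial_sum[OF gd[OF Ad(2)[OF p']]]
        by (rule ext) (simp add: sum_distrib_left mult_ac add.commute)
      then show ?thesis using has_derivative_mult[OF a b] by simp
    qed
    have Pb: "norm (?P j p') \<le> Dh * qh ^ (j - 1)" if p': "p' \<in> ?A" for j p'
    proof (cases j)
      case 0
      then show ?thesis using mh by simp
    next
      case (Suc k)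
      have "norm (fst p' ^ k * ?h k (snd p')) \<le> Dh * qh ^ k"
        by (rule mh(6)) (use Ad[OF p'] \<rho>(3) r(3) in auto)
      then show ?thesis by (simp add: Suc mult_ac)
    qed
    have sum_shift: "summable (\<lambda>j. Dh * qh ^ (j - 1))"
    proof -
      have "summable (\<lambda>j. Dh * qh ^ (Suc j - 1))" using mh(3,4) by (simp add: summable_mult summable_geometric)
      then show ?thesis by (subst (asm) summable_Suc_iff)
    qed
    have uP: "uniform_limit ?A (\<lambda>n p. \<Sum>j<n. ?P j p) (\<lambda>p. \<Sum>j. ?P j p) sequentially"
      by (rule Weierstrass_m_test[OF Pb sum_shift])
    \<comment> \<open>The term \<open>j = 0\<close> of \<open>?P\<close> vanishes, whatever the
      truncated exponent, so dropping it gives the shifted series \<open>?H\<close>.\<close>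
    have PH: "(\<Sum>j. ?P j p') = ?H p'" if p': "p' \<in> ?A" for p'
    proof -
      have "summable (\<lambda>j. ?P j p')" by (rule summable_comparison_test'[OF sum_shift Pb[OF p']])
      from suminf_split_head[OF this] show ?thesis by (simp add: pow_sum_def mult_ac)
    qed
    have uK: "uniform_limit ?A (\<lambda>n p. \<Sum>j<n. fst p ^ j * partial i (g j) (snd p)) (?K i) sequentially" for i
      unfolding pow_sum_def[abs_def]
    proof (rule Weierstrass_m_test)
      show "norm (fst p' ^ j * partial i (g j) (snd p')) \<le> Dk i * qk i ^ j" if "p' \<in> ?A" for j p'
        by (rule mk(5)) (use Ad[OF that] \<rho>(4)[of i] r(5)[of i] in auto)
      show "summable (\<lambda>j. Dk i * qk i ^ j)" using mk(3,4)[of i] by (intro summable_mult summable_geometric) simp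
    qed
    have "\<exists>G. \<forall>p\<in>?A. (\<lambda>j. ?f j p) sums (G p) \<and> (G has_derivative ?G' p) (at p within ?A)"
    proof (rule has_derivative_series[where f'="?f'"])
      show "convex ?A" by (intro convex_Times convex_ball)
      show "(?f j has_derivative ?f' j p') (at p' within ?A)" if "p' \<in> ?A" for j p'
        by (rule has_derivative_at_withinI[OF fd[OF that]])
      show "p \<in> ?A" by (rule pA)
      have "summable (\<lambda>j. ?f j p)"
      proof (rule summable_comparison_test')
        show "summable (\<lambda>j. Dg * qg ^ j)" using mg(3,4) by (intro summable_mult summable_geometric) simp
        show "norm (?f j p) \<le> Dg * qg ^ j" for j by (rule mg(5)) (use \<rho> r pA in auto)
      qed
      then show "(\<lambda>j. ?f j p) sums (\<Sum>j. ?f j p)" by (rule summable_sums)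
      fix e :: real assume e: "e > 0"
      \<comment> \<open>One share of the error for the \<open>z\<close>-direction and one for each
        coordinate of \<open>x\<close>.\<close>
      define e' where "e' = e / (1 + CARD('a))"
      have n1: "1 + real CARD('a) > 0" by (simp add: add_pos_nonneg)
      have e': "e' > 0" "e' * (1 + real CARD('a)) = e" using e n1 by (simp_all add: e'_def)
      have "\<forall>\<^sub>F n in sequentially. \<forall>i. \<forall>p\<in>?A. dist (\<Sum>j<n. fst p ^ j * partial i (g j) (snd p)) (?K i p) < e'"
        by (rule eventually_all_finite) (use uK e'(1) in \<open>auto simp only: uniform_limit_iff\<close>)
      moreover have "\<forall>\<^sub>F n in sequentially. \<forall>p\<in>?A. dist (\<Sum>j<n. ?P j p) (\<Sum>j. ?P j p) < e'"
        using uP e'(1) by (simp only: uniform_limit_iff)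
      ultimately show "\<forall>\<^sub>F n in sequentially. \<forall>p\<in>?A. \<forall>d. norm ((\<Sum>j<n. ?f' j p d) - ?G' p d) \<le> e * norm d"
      proof eventually_elim
        case (elim n)
        show ?case
        proof (intro ballI allI)
          fix p' and d :: "complex \<times> (real^'a)" assume p': "p' \<in> ?A"
          have "(\<Sum>j<n. ?f' j p' d) = fst d * (\<Sum>j<n. ?P j p') + (\<Sum>i\<in>UNIV. snd d $ i *\<^sub>R (\<Sum>j<n. fst p' ^ j * partial i (g j) (snd p')))"
            unfolding sum.distrib sum_distrib_left scaleR_sum_right
            by (subst (2) sum.swap) (rule refl)
          then have "(\<Sum>j<n. ?f' j p' d) - ?G' p' d = fst d * ((\<Sum>j<n. ?P j p') - (\<Sum>j. ?P j p'))
             + (\<Sum>i\<in>UNIV. snd d $ i *\<^sub>R ((\<Sum>j<n. fst p' ^ j * partial i (g j) (snd p')) - ?K i p'))"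
            unfolding PH[OF p'] by (simp add: right_diff_distrib scaleR_diff_right sum_subtractf)
          also have "norm \<dots> \<le> norm d * e' + (\<Sum>i\<in>(UNIV::'a set). norm d * e')"
          proof (intro norm_triangle_mono sum_norm_le)
            show "norm (fst d * ((\<Sum>j<n. ?P j p') - (\<Sum>j. ?P j p'))) \<le> norm d * e'"
              unfolding norm_mult using elim(2) p' norm_fst_le[of "fst d" "snd d"]
              by (intro mult_mono) (auto simp: dist_norm less_imp_le)
            fix i
            have "norm (snd d $ i) \<le> norm d"
              using component_le_norm_cart[of "snd d" i] norm_snd_le[of "snd d" "fst d"] by (simp add: order_trans)
            then show "norm (snd d $ i *\<^sub>R ((\<Sum>j<n. fst p' ^ j * partial i (g j) (snd p')) - ?K i p')) \<le> norm d * e'"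
              unfolding norm_scaleR using elim(1) p'
              by (intro mult_mono) (auto simp: dist_norm less_imp_le)
          qed
          also have "\<dots> = (e' * (1 + real CARD('a))) * norm d" by (simp add: algebra_simps)
          also have "\<dots> = e * norm d" by (simp only: e'(2))
          finally show "norm ((\<Sum>j<n. ?f' j p' d) - ?G' p' d) \<le> e * norm d" .
        qed
      qed
    qed
    then obtain G where G: "\<And>p. p \<in> ?A \<Longrightarrow> (\<lambda>j. ?f j p) sums (G p)" "\<And>p. p \<in> ?A \<Longrightarrow> (G has_derivative ?G' p) (at p within ?A)"
      by blast
    have oA: "open ?A" by (rule open_Times_ball)
    have "(G has_derivative ?G' p) (at p)" using G(2)[OF pA] at_within_open[OF pA oA] by simp
    then show "(pow_sum g has_derivative ?G' p) (at p)"
    proof (rule has_derivative_transform_within_open[OF _ oA pA])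
      show "G p' = pow_sum g p'" if "p' \<in> ?A" for p'
        using sums_unique[OF G(1)[OF that]] by (simp add: pow_sum_def)
    qed
  qed
qed

lemma Ck_slice:
  fixes F :: "'a::euclidean_space \<times> 'b::euclidean_space \<Rightarrow> 'c::real_normed_vector"
  assumes "open B" "z \<in> A"
  shows "Ck m (A \<times> B) F \<Longrightarrow> Ck m B (\<lambda>x. F (z, x))"
proof (induction m arbitrary: F)
  case 0
  then have "continuous_on (A \<times> B) F" by simp
  moreover have "continuous_on B (\<lambda>x. (z, x))" by (intro continuous_intros)
  ultimately show ?case using continuous_on_compose2[of "A \<times> B" F B "\<lambda>x. (z, x)"] assms(2) by auto
next
  case (Suc m)
  show ?case
  proof (rule Ck_SucI'[OF assms(1), where f'="\<lambda>x h. frechet_derivative F (at (z, x)) (0, h)"])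
    fix x assume x: "x \<in> B"
    have "((\<lambda>x. (z, x)) has_derivative (\<lambda>h. (0, h))) (at x)"
      by (intro has_derivative_Pair has_derivative_const has_derivative_ident)
    from has_derivative_compose[OF this Ck_SucD[OF Suc.prems]] x assms(2)
    show "((\<lambda>x. F (z, x)) has_derivative (\<lambda>h. frechet_derivative F (at (z, x)) (0, h))) (at x)" by simp
  next
    fix v :: 'b assume v: "v \<in> Basis"
    then have "(0, v) \<in> (Basis :: ('a \<times> 'b) set)" by (simp add: Basis_prod_def)
    from Suc.IH[OF Ck_SucD_frechet[OF Suc.prems this]]
    show "Ck m B (\<lambda>x. frechet_derivative F (at (z, x)) (0, v))" by simp
  qed
qed

subsection \<open>Cutoff functions and representatives\<close>

text \<open>Mollify the indicator of the ball of radius \<open>2 * e\<close> at scale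
  \<open>e\<close>: the result is 1 within \<open>e\<close> of the centre and vanishes beyond
  \<open>3 * e\<close>.\<close>

lemma cutoff_exists:
  fixes x0 :: "real^'n::finite"
  assumes e: "e > 0"
  obtains \<eta> where "test_fun (ball x0 (4 * e)) \<eta>" "\<And>x. x \<in> ball x0 e \<Longrightarrow> \<eta> x = 1"
proof -
  define w :: "real^'n \<Rightarrow> complex" where "w y = of_real (indicator (cball x0 (2 * e)) y)" for y
  have w: "L2c w"
  proof (rule L2c_bounded_support(1)[where B=1 and R="norm x0 + 2 * e"])
    have [measurable]: "cball x0 (2 * e) \<in> sets borel" by simp
    show "w \<in> borel_measurable borel" unfolding w_def[abs_def] by measurable
    show "norm (w x) \<le> 1" for x by (simp add: w_def indicator_def)
    show "{x. w x \<noteq> 0} \<subseteq> cball 0 (norm x0 + 2 * e)"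
    proof
      fix x assume "x \<in> {x. w x \<noteq> 0}"
      then have "norm (x - x0) \<le> 2 * e" by (auto simp: w_def indicator_def dist_norm norm_minus_commute split: if_splits)
      then show "x \<in> cball 0 (norm x0 + 2 * e)" using norm_triangle_ineq[of x0 "x - x0"] by simp
    qed
  qed
  have m: "tf (moll e :: real^'n \<Rightarrow> complex)" by (rule tf_moll[OF e])
  let ?\<eta> = "conv (moll e) w"
  have "test_fun (ball x0 (4 * e)) ?\<eta>"
  proof (rule test_funI[where C="cball x0 (3 * e)"])
    show "smooth_on UNIV ?\<eta>" by (rule tf_smooth[OF tf_conv[OF m w]])
    show "{x. ?\<eta> x \<noteq> 0} \<subseteq> cball x0 (3 * e)"
    proof
      fix x assume "x \<in> {x. ?\<eta> x \<noteq> 0}"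
      then obtain y where y: "moll e (x - y) \<noteq> 0" "w y \<noteq> 0" using conv_support by blast
      then have "dist y x < e" "dist x0 y \<le> 2 * e"
        using moll_support[OF e, of "x - y"] by (auto simp: w_def indicator_def dist_norm norm_minus_commute split: if_splits)
      then show "x \<in> cball x0 (3 * e)" using dist_triangle[of x0 x y] by simp
    qed
  qed (use e in auto)
  moreover have "?\<eta> x = 1" if x: "x \<in> ball x0 e" for x
  proof -
    have "moll e (x - y) * w y = moll e (x - y)" for y
    proof (cases "moll e (x - y) = 0")
      case False
      then have "dist x y < e" using moll_support[OF e] by (simp add: dist_norm)
      then have "dist x0 y \<le> 2 * e" using x dist_triangle[of x0 y x] by simp
      then show ?thesis by (simp add: w_def)
    qed simp
    then have "?\<eta> x = (\<integral>y. moll e (x - y) \<partial>lborel)" unfolding conv_def by (simp only:)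
    also have "\<dots> = 1" using integral_lborel_reflect[OF tf_measurable[OF m]] integral_moll[OF e, where 'n='n] by simp
    finally show ?thesis .
  qed
  ultimately show ?thesis using that by blast
qed

lemma test_fun_mono: "test_fun A f \<Longrightarrow> A \<subseteq> B \<Longrightarrow> test_fun B f"
  unfolding test_fun_def by blast

text \<open>Values of \<open>g\<close> outside \<open>\<Omega>\<close> are arbitrary, but points
  outside have a neighbourhood on which \<open>\<eta>\<close> vanishes; smoothness is therefore
  checked locally.\<close>

lemma test_fun_mult_smooth_on:
  assumes \<eta>: "test_fun \<Omega> \<eta>" and \<Omega>: "open \<Omega>" and g: "smooth_on \<Omega> g"
  shows "test_fun \<Omega> (\<lambda>x. \<eta> x * g x)"
proof (rule test_funI[where C="closure {x. \<eta> x \<noteq> 0}"])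
  show "smooth_on UNIV (\<lambda>x. \<eta> x * g x)"
    unfolding smooth_on_def
  proof (intro allI Ck_local)
    fix m x
    have \<eta>m: "Ck m \<Omega> \<eta>" using \<eta> Ck_subset[of \<Omega> UNIV m \<eta>] by (simp add: test_fun_def smooth_on_def)
    show "\<exists>V. open V \<and> x \<in> V \<and> Ck m V (\<lambda>x. \<eta> x * g x)"
    proof (cases "x \<in> \<Omega>")
      case True
      have "Ck m \<Omega> (\<lambda>x. \<eta> x * g x)" using g \<eta>m by (intro Ck_mult[OF \<Omega>]) (auto simp: smooth_on_def)
      then show ?thesis using True \<Omega> by blast
    next
      case False
      let ?V = "- closure {x. \<eta> x \<noteq> 0}"
      have "Ck m ?V (\<lambda>x. \<eta> x * g x)"
      proof (rule Ck_cong_imp[of _ "\<lambda>x. 0"])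
        show "0 = \<eta> y * g y" if "y \<in> ?V" for y using that closure_supportI[of \<eta> y] by auto
      qed auto
      moreover have "x \<in> ?V" using False \<eta> by (auto simp: test_fun_def)
      ultimately show ?thesis by blast
    qed
  qed
  show "{x. \<eta> x * g x \<noteq> 0} \<subseteq> closure {x. \<eta> x \<noteq> 0}" using closure_supportI[of \<eta>] by auto
qed (use \<eta> in \<open>auto simp: test_fun_def compact_imp_bounded\<close>)

text \<open>Fatou's lemma: the limit has integral 0. It is applied to squared distances, where the
  conclusion means equality almost everywhere.\<close>

lemma AE_nonpos_limit:
  fixes h :: "nat \<Rightarrow> 'a \<Rightarrow> real"
  assumes h: "\<And>j. integrable M (h j)" "\<And>j x. 0 \<le> h j x" and lim: "AE x in M. (\<lambda>j. h j x) \<longlonglongrightarrow> H x"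
    and int: "(\<lambda>j. \<integral>x. h j x \<partial>M) \<longlonglongrightarrow> 0"
  shows "AE x in M. H x \<le> 0"
proof -
  have [measurable]: "h j \<in> borel_measurable M" for j using h(1) by auto
  have "(\<integral>\<^sup>+x. liminf (\<lambda>j. ennreal (h j x)) \<partial>M) \<le> liminf (\<lambda>j. \<integral>\<^sup>+x. ennreal (h j x) \<partial>M)"
    by (rule nn_integral_liminf) measurable
  also have "(\<lambda>j. \<integral>\<^sup>+x. ennreal (h j x) \<partial>M) = (\<lambda>j. ennreal (\<integral>x. h j x \<partial>M))"
    using h by (intro ext nn_integral_eq_integral) auto
  also have "liminf (\<lambda>j. ennreal (\<integral>x. h j x \<partial>M)) = ennreal 0"
    by (rule lim_imp_Liminf[OF _ tendsto_ennrealI[OF int]]) simp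
  finally have "(\<integral>\<^sup>+x. liminf (\<lambda>j. ennreal (h j x)) \<partial>M) = 0" by simp
  then have "AE x in M. liminf (\<lambda>j. ennreal (h j x)) = 0"
    by (subst (asm) nn_integral_0_iff_AE) auto
  with lim show ?thesis
  proof eventually_elim
    case (elim x)
    have "liminf (\<lambda>j. ennreal (h j x)) = ennreal (H x)"
      by (rule lim_imp_Liminf[OF _ tendsto_ennrealI[OF elim(1)]]) simp
    then show ?case using elim(2) by (simp add: ennreal_eq_0_iff)
  qed
qed

lemma moll_seq_L2:
  assumes w: "L2c w" and \<eta>: "\<eta> > 0"
  obtains N where "\<And>j. j \<ge> N \<Longrightarrow> L2sq (\<lambda>x. conv (moll (1 / real (Suc j))) w x - w x) \<le> \<eta>"
proof -
  obtain \<delta> where \<delta>: "\<delta> > 0" "\<And>e. 0 < e \<Longrightarrow> e < \<delta> \<Longrightarrow> L2sq (\<lambda>x. conv (moll e) w x - w x) \<le> \<eta>"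
    using moll_L2[OF w \<eta>] by metis
  obtain N where N: "1 / real (Suc N) < \<delta>" using nat_approx_posE[OF \<delta>(1)] by metis
  have "L2sq (\<lambda>x. conv (moll (1 / real (Suc j))) w x - w x) \<le> \<eta>" if "j \<ge> N" for j
  proof (rule \<delta>(2))
    have "1 / real (Suc j) \<le> 1 / real (Suc N)" using that by (intro divide_left_mono) auto
    then show "1 / real (Suc j) < \<delta>" using N by linarith
  qed simp
  then show ?thesis using that by blast
qed

lemma moll_seq_AE:
  assumes w: "L2c w" and lim: "\<And>x. (\<lambda>j. conv (moll (1 / real (Suc j))) w x) \<longlonglongrightarrow> V x"
  shows "AE x in lborel. V x = w x"
proof -
  have L: "L2c (\<lambda>x. conv (moll (1 / real (Suc j))) w x - w x)" for j
    by (intro L2c_diff tf_L2c tf_conv tf_moll w) simp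
  have "AE x in lborel. (norm (V x - w x))\<^sup>2 \<le> 0"
  proof (rule AE_nonpos_limit[where h="\<lambda>j x. (norm (conv (moll (1 / real (Suc j))) w x - w x))\<^sup>2"])
    show "integrable lborel (\<lambda>x. (norm (conv (moll (1 / real (Suc j))) w x - w x))\<^sup>2)" for j
      by (rule L2cD(2)[OF L])
    show "AE x in lborel. (\<lambda>j. (norm (conv (moll (1 / real (Suc j))) w x - w x))\<^sup>2) \<longlonglongrightarrow> (norm (V x - w x))\<^sup>2"
      by (intro AE_I2 tendsto_intros lim)
    show "(\<lambda>j. \<integral>x. (norm (conv (moll (1 / real (Suc j))) w x - w x))\<^sup>2 \<partial>lborel) \<longlonglongrightarrow> 0"
      unfolding L2sq_def[symmetric]
    proof (rule LIMSEQ_I)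
      fix r :: real assume r: "r > 0"
      obtain N where N: "\<And>j. j \<ge> N \<Longrightarrow> L2sq (\<lambda>x. conv (moll (1 / real (Suc j))) w x - w x) \<le> r / 2"
        using moll_seq_L2[OF w half_gt_zero[OF r]] by metis
      show "\<exists>N. \<forall>j\<ge>N. norm (L2sq (\<lambda>x. conv (moll (1 / real (Suc j))) w x - w x) - 0) < r"
        by (rule exI[of _ N]) (use N r in \<open>auto intro: le_less_trans[OF N] simp del: of_nat_Suc\<close>)
    qed
  qed simp
  then show ?thesis by eventually_elim (auto)
qed

lemma moll_seq_L2Cauchy:
  assumes w: "L2c w"
  shows "L2Cauchy (\<lambda>j. conv (moll (1 / real (Suc (j + J)))) w)"
  unfolding L2Cauchy_def
proof (intro allI impI)
  fix \<eta> :: real assume \<eta>: "\<eta> > 0"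
  then have "\<eta> / 4 > 0" by simp
  then obtain N where N: "\<And>j. j \<ge> N \<Longrightarrow> L2sq (\<lambda>x. conv (moll (1 / real (Suc j))) w x - w x) \<le> \<eta> / 4"
    using moll_seq_L2[OF w] by metis
  let ?v = "\<lambda>j. conv (moll (1 / real (Suc j))) w"
  have v: "L2c (?v j)" for j by (intro tf_L2c tf_conv tf_moll w) simp
  show "\<exists>N. \<forall>i\<ge>N. \<forall>j\<ge>N. L2sq (\<lambda>x. ?v (i + J) x - ?v (j + J) x) \<le> \<eta>"
  proof (intro exI[of _ N] allI impI)
    fix i j assume ij: "N \<le> i" "N \<le> j"
    have "L2sq (\<lambda>x. (?v (i + J) x - w x) - (?v (j + J) x - w x)) \<le> 2 * L2sq (\<lambda>x. ?v (i + J) x - w x) + 2 * L2sq (\<lambda>x. ?v (j + J) x - w x)"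
      by (intro L2c_diff v w)
    also have "\<dots> \<le> 2 * (\<eta> / 4) + 2 * (\<eta> / 4)"
      using N[of "i + J"] N[of "j + J"] ij by (intro add_mono mult_left_mono) auto
    finally show "L2sq (\<lambda>x. ?v (i + J) x - ?v (j + J) x) \<le> \<eta>" by simp
  qed
qed

section \<open>Local representatives from the interior estimates\<close>

lemma (in elliptic) interior_limit:
  fixes U :: "nat \<Rightarrow> 'i \<Rightarrow> real^'n \<Rightarrow> complex"
  assumes \<beta>: "tf \<beta>" and U: "\<And>l n. l \<le> k \<Longrightarrow> L2c (U l n)" and B: "\<And>l n. l \<le> k \<Longrightarrow> L2sq (U l n) \<le> B l"
    and weak: "\<And>l n \<phi>. l < k \<Longrightarrow> test_fun Om \<phi> \<Longrightarrow> (\<integral>x. U (Suc l) n x * (\<beta> x * \<phi> x) \<partial>lborel) = (\<integral>x. U l n x * At \<phi> x \<partial>lborel)"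
    and k: "real k > real m / 2 + real CARD('n) / 4" and \<psi>: "test_fun Om \<psi>"
  shows "\<exists>D. \<forall>n. \<exists>V. CBon m UNIV D V \<and> (\<forall>x. (\<lambda>j. conv (moll (1 / real (Suc j))) (\<lambda>x. \<psi> x * U 0 n x) x) \<longlonglongrightarrow> V x)
     \<and> (AE x in lborel. V x = \<psi> x * U 0 n x)"
proof -
  have "Hbloc Om (2 * k) (U (k - k))" 
    by (rule regularity_chain[where U=U and B=B and \<beta>=\<beta> and k=k and j=k]) (rule \<beta> U B weak order_refl | assumption)+
  then have Hb: "Hb (2 * k) (\<lambda>n x. \<psi> x * U 0 n x)" using \<psi> by (simp add: Hbloc_def)
  obtain M \<delta> where M: "\<delta> > 0" "\<And>n e. 0 < e \<Longrightarrow> e < \<delta> \<Longrightarrow> sobn (2 * k) (conv (moll e) (\<lambda>x. \<psi> x * U 0 n x)) \<le> M"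
    using HbE[OF Hb] by metis
  \<comment> \<open>Of the \<open>2 * k\<close> derivatives bounded in the mean, \<open>m\<close>
    are kept and the remaining \<open>s\<close> pay for the embedding; k > m/2 + n/4 says exactly s
    > n/2.\<close>
  define s where "s = 2 * k - m"
  have "real m < real (2 * k)" using k by (simp add: field_simps)
  then have ms: "m + s = 2 * k" by (simp add: s_def)
  then have "real s = 2 * real k - real m" by linarith
  then have s: "real s > real CARD('n) / 2" using k by simp
  obtain C where C: "C \<ge> 0" "\<And>(v::real^'n \<Rightarrow> complex) x. tf v \<Longrightarrow> norm (v x) \<le> C * sqrt (sobn s v)"
    using sobolev_sup[OF s] by blast
  obtain J where J: "1 / real (Suc J) < \<delta>" using nat_approx_posE[OF M(1)] by metis
  have "\<exists>V. CBon m UNIV (C * sqrt M) V \<and> (\<forall>x. (\<lambda>j. conv (moll (1 / real (Suc j))) (\<lambda>x. \<psi> x * U 0 n x) x) \<longlonglongrightarrow> V x)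
     \<and> (AE x in lborel. V x = \<psi> x * U 0 n x)" for n
  proof -
    let ?w = "\<lambda>x. \<psi> x * U 0 n x"
    have w: "L2c ?w" by (intro L2c_tf_mult test_fun_tf[OF \<psi>] U) simp
    let ?v = "\<lambda>j. conv (moll (1 / real (Suc (j + J)))) ?w"
    have "\<exists>V. uniform_limit UNIV ?v V sequentially \<and> CBon m UNIV (C * sqrt M) V"
    proof (rule uniform_limit_CBon[OF s C(2,1)])
      show "tf (?v j)" for j by (intro tf_conv tf_moll w) simp
      show "sobn (m + s) (?v j) \<le> M" for j
        unfolding ms
      proof (rule M(2))
        have "1 / real (Suc (j + J)) \<le> 1 / real (Suc J)" by (intro divide_left_mono) auto
        then show "1 / real (Suc (j + J)) < \<delta>" using J by linarith
      qed simp
      show "L2Cauchy ?v" by (rule moll_seq_L2Cauchy[OF w])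
    qed
    then obtain V where V: "uniform_limit UNIV ?v V sequentially" "CBon m UNIV (C * sqrt M) V" by blast
    have lim: "(\<lambda>j. conv (moll (1 / real (Suc j))) ?w x) \<longlonglongrightarrow> V x" for x
    proof (rule LIMSEQ_offset[where k=J])
      show "(\<lambda>j. conv (moll (1 / real (Suc (j + J)))) ?w x) \<longlonglongrightarrow> V x"
        by (rule tendsto_uniform_limitI[OF V(1)]) simp
    qed
    show ?thesis using V(2) lim moll_seq_AE[OF w lim] by blast
  qed
  then show ?thesis by blast
qed

text \<open>\<open>L2loc\<close> speaks of Lebesgue measurable functions on \<open>\<Omega>\<close>;
  the calculus above needs Borel functions on all of space, here extended by 0.\<close>

lemma borel_representative:
  fixes f :: "real^'n::finite \<Rightarrow> complex"
  assumes "set_borel_measurable lebesgue \<Omega> f"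
  shows "\<exists>g \<in> borel_measurable borel. AE x in lborel. indicator \<Omega> x *\<^sub>R f x = g x"
proof -
  let ?f = "\<lambda>x. indicator \<Omega> x *\<^sub>R f x"
  have m: "?f \<in> borel_measurable lebesgue" using assms by (simp add: set_borel_measurable_def)
  have "(\<lambda>x. Re (?f x)) \<in> borel_measurable lebesgue" "(\<lambda>x. Im (?f x)) \<in> borel_measurable lebesgue"
    using m by measurable
  from this[THEN completion_ex_borel_measurable_real]
  obtain p q where [measurable]: "p \<in> borel_measurable lborel" "q \<in> borel_measurable lborel"
    and ae: "AE x in lborel. Re (?f x) = p x" "AE x in lborel. Im (?f x) = q x" by auto
  have "AE x in lborel. ?f x = Complex (p x) (q x)"
    using ae by eventually_elim (simp add: complex_eq_iff)
  moreover have "(\<lambda>x. of_real (p x) + \<i> * of_real (q x)) \<in> borel_measurable borel" by measurable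
  ultimately show ?thesis by (intro bexI[of _ "\<lambda>x. of_real (p x) + \<i> * of_real (q x)"]) (auto simp: Complex_eq)
qed

lemma representative_L2c:
  fixes h g :: "real^'n::finite \<Rightarrow> complex"
  assumes [measurable]: "g \<in> borel_measurable borel" and ae: "AE x in lborel. indicator \<Omega> x *\<^sub>R h x = g x"
    and A: "A \<subseteq> \<Omega>" "A \<in> sets borel" "bounded A" and int: "set_integrable lebesgue A (\<lambda>x. (norm (h x))\<^sup>2)"
  shows "L2c (\<lambda>x. of_real (indicator A x) * g x)"
    "L2sq (\<lambda>x. of_real (indicator A x) * g x) = (LINT x:A|lebesgue. (norm (h x))\<^sup>2)"
proof -
  have [measurable]: "A \<in> sets borel" by fact
  let ?u = "\<lambda>x. of_real (indicator A x) * g x"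
  have mu: "?u \<in> borel_measurable borel" by measurable
  then have mu2: "(\<lambda>x. (norm (?u x))\<^sup>2) \<in> borel_measurable lborel" by measurable
  have eq: "AE x in lebesgue. indicator A x *\<^sub>R (norm (h x))\<^sup>2 = (norm (?u x))\<^sup>2"
    using AE_completion[OF ae]
  proof eventually_elim
    case (elim x)
    then show ?case using A(1) by (cases "x \<in> A") (auto simp: indicator_def)
  qed
  have i: "integrable lebesgue (\<lambda>x. indicator A x *\<^sub>R (norm (h x))\<^sup>2)"
    using int by (simp add: set_integrable_def)
  have "integrable lebesgue (\<lambda>x. (norm (?u x))\<^sup>2)"
    by (rule integrable_cong_AE_imp[OF i measurable_completion[OF mu2]]) (use eq in \<open>auto simp: eq_commute\<close>)
  then have "integrable lborel (\<lambda>x. (norm (?u x))\<^sup>2)" using integrable_completion[OF mu2] by simp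
  moreover have "bounded {x. ?u x \<noteq> 0}" by (rule bounded_subset[OF A(3)]) (auto simp: indicator_def split: if_splits)
  ultimately show "L2c ?u" using mu by (simp add: L2c_def)
  have "L2sq ?u = (\<integral>x. (norm (?u x))\<^sup>2 \<partial>lebesgue)" unfolding L2sq_def by (rule integral_completion[OF mu2, symmetric])
  also have "\<dots> = (\<integral>x. indicator A x *\<^sub>R (norm (h x))\<^sup>2 \<partial>lebesgue)"
    by (rule integral_cong_AE[OF measurable_completion[OF mu2] borel_measurable_integrable[OF i]])
       (use eq in \<open>auto simp: eq_commute\<close>)
  finally show "L2sq ?u = (LINT x:A|lebesgue. (norm (h x))\<^sup>2)" by (simp add: set_lebesgue_integral_def)
qed

text \<open>Since \<open>q\<close> vanishes off \<open>A\<close>, cutting to \<open>A\<close> does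
  not change the pairing; this turns \<open>Lbar_weak\<close> into the identities over
  \<open>lborel\<close> required by the locale.\<close>

lemma representative_integral:
  fixes h g q :: "real^'n::finite \<Rightarrow> complex"
  assumes [measurable]: "g \<in> borel_measurable borel" and ae: "AE x in lborel. indicator \<Omega> x *\<^sub>R h x = g x"
    and h: "set_borel_measurable lebesgue \<Omega> h" and A: "A \<in> sets borel" and q: "tf q" "\<And>x. x \<notin> A \<Longrightarrow> q x = 0"
  shows "(LINT x:\<Omega>|lebesgue. h x * q x) = (\<integral>x. (of_real (indicator A x) * g x) * q x \<partial>lborel)"
proof -
  have [measurable]: "A \<in> sets borel" by fact
  have [measurable]: "q \<in> borel_measurable borel" by (rule tf_measurable[OF q(1)])
  have m: "(\<lambda>x. (of_real (indicator A x) * g x) * q x) \<in> borel_measurable lborel" by measurable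
  have q': "q \<in> borel_measurable lebesgue" by (rule measurable_completion) simp
  have "(\<lambda>x. (indicator \<Omega> x *\<^sub>R h x) * q x) \<in> borel_measurable lebesgue"
    using h unfolding set_borel_measurable_def by (intro borel_measurable_times q')
  then have m': "(\<lambda>x. indicator \<Omega> x *\<^sub>R (h x * q x)) \<in> borel_measurable lebesgue" by simp
  have "(LINT x:\<Omega>|lebesgue. h x * q x) = (\<integral>x. (of_real (indicator A x) * g x) * q x \<partial>lebesgue)"
    unfolding set_lebesgue_integral_def
  proof (rule integral_cong_AE[OF m' measurable_completion[OF m]])
    show "AE x in lebesgue. indicator \<Omega> x *\<^sub>R (h x * q x) = (of_real (indicator A x) * g x) * q x"
      using AE_completion[OF ae]
    proof eventually_elim
      case (elim x)
      have "indicator \<Omega> x *\<^sub>R (h x * q x) = g x * q x" using elim by (metis mult_scaleR_left)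
      then show ?case using q(2)[of x] by (cases "x \<in> A") auto
    qed
  qed
  then show ?thesis using integral_completion[OF m] by simp
qed

text \<open>The limit is stated for mollifications of the given Borel representative
  \<open>w\<close>, uncut. Hence the function obtained depends neither on the ball nor on the
  cutoffs, and local results fit together. \<open>D\<close> is common to the whole family.\<close>

lemma local_regularity:
  fixes \<Omega> :: "(real^'n::finite) set" and h :: "nat \<Rightarrow> 'i \<Rightarrow> real^'n \<Rightarrow> complex"
  assumes \<Omega>: "open \<Omega>" and b: "smooth_on \<Omega> b" "\<forall>x\<in>\<Omega>. b x > 0" and a: "\<forall>\<mu> \<nu>. smooth_on \<Omega> (a \<mu> \<nu>)"
    and ell: "continuous_on \<Omega> ell" "\<forall>x\<in>\<Omega>. ell x > 0"
    and ellip: "\<forall>x\<in>\<Omega>. \<forall>\<xi>::complex^'n. Re (\<Sum>\<mu>\<in>UNIV. \<Sum>\<nu>\<in>UNIV. a \<mu> \<nu> x * cnj (\<xi> $ \<mu>) * \<xi> $ \<nu>)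
             \<ge> ell x * (\<Sum>\<mu>\<in>UNIV. (cmod (\<xi> $ \<mu>))\<^sup>2)"
    and k: "real k > real m / 2 + real CARD('n) / 4"
    and h: "\<And>l n. l \<le> k \<Longrightarrow> L2loc \<Omega> (h l n)"
    and bd: "\<And>l A. l \<le> k \<Longrightarrow> relcompact_open A \<Omega> \<Longrightarrow> \<exists>B. \<forall>n. (LINT x:A|lebesgue. (norm (h l n x))\<^sup>2) \<le> B"
    and weak: "\<And>l n. l < k \<Longrightarrow> Lbar_weak \<Omega> a b (h l n) (h (Suc l) n)"
    and w: "\<And>n. w n \<in> borel_measurable borel" "\<And>n. AE x in lborel. indicator \<Omega> x *\<^sub>R h 0 n x = w n x"
    and x0: "x0 \<in> \<Omega>"
  shows "\<exists>r D. r > 0 \<and> ball x0 r \<subseteq> \<Omega> \<and> (\<forall>n. \<exists>V. CBon m (ball x0 r) D V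
      \<and> (\<forall>x\<in>ball x0 r. (\<lambda>j. conv (moll (1 / real (Suc j))) (w n) x) \<longlonglongrightarrow> V x)
      \<and> (AE x in lborel. x \<in> ball x0 r \<longrightarrow> V x = h 0 n x))"
proof -
  obtain e0 where e0: "e0 > 0" "ball x0 e0 \<subseteq> \<Omega>" using \<Omega> x0 open_contains_ball by blast
  \<comment> \<open>The cutoff below has support within \<open>4 * e\<close>, which stays inside the
    ball of radius \<open>e0\<close>.\<close>
  define e where "e = e0 / 8"
  have e: "e > 0" "ball x0 (4 * e) \<subseteq> \<Omega>" "cball x0 e \<subseteq> \<Omega>" using e0 by (auto simp: e_def)
  obtain \<eta> where \<eta>: "test_fun (ball x0 (4 * e)) \<eta>" "\<And>x. x \<in> ball x0 e \<Longrightarrow> \<eta> x = 1"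
    using cutoff_exists[OF e(1)] by metis
  have \<eta>\<Omega>: "test_fun \<Omega> \<eta>" by (rule test_fun_mono[OF \<eta>(1) e(2)])
  let ?Om = "ball x0 e"
  \<comment> \<open>On the ball of radius \<open>e\<close> these are the original coefficients and
    1/b, but they are test functions on all of space.\<close>
  define a' where "a' \<mu> \<nu> x = \<eta> x * a \<mu> \<nu> x" for \<mu> \<nu> x
  define \<beta> where "\<beta> x = \<eta> x * inverse (complex_of_real (b x))" for x
  have tfa: "tf (a' \<mu> \<nu>)" for \<mu> \<nu>
    unfolding a'_def[abs_def] by (rule test_fun_tf[OF test_fun_mult_smooth_on[OF \<eta>\<Omega> \<Omega>]]) (use a in blast)
  have "smooth_on \<Omega> (\<lambda>x. inverse (complex_of_real (b x)))"
    unfolding smooth_on_def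
  proof
    fix m
    have "Ck m \<Omega> (\<lambda>x. complex_of_real (b x))"
      using b(1) unfolding smooth_on_def by (intro Ck_bounded_linear[OF bounded_linear_of_real \<Omega>]) blast
    then show "Ck m \<Omega> (\<lambda>x. inverse (complex_of_real (b x)))"
      by (rule Ck_inverse[OF \<Omega>, rotated]) (use b(2) in force)
  qed
  then have \<beta>: "tf \<beta>"
    unfolding \<beta>_def[abs_def] by (rule test_fun_tf[OF test_fun_mult_smooth_on[OF \<eta>\<Omega> \<Omega>]])
  obtain y where y: "y \<in> cball x0 e" "\<And>x. x \<in> cball x0 e \<Longrightarrow> ell y \<le> ell x"
    using continuous_attains_inf[OF compact_cball _ continuous_on_subset[OF ell(1) e(3)]] e(1) by force
  have c: "ell y > 0" using y(1) e(3) ell(2) by blast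
  interpret elliptic a' ?Om "ell y"
  proof
    fix x and \<xi> :: "complex^'n" assume x: "x \<in> ?Om"
    then have x': "x \<in> cball x0 e" "x \<in> \<Omega>" using e(3) by auto
    have "ell y * (\<Sum>\<mu>\<in>UNIV. (cmod (\<xi> $ \<mu>))\<^sup>2) \<le> ell x * (\<Sum>\<mu>\<in>UNIV. (cmod (\<xi> $ \<mu>))\<^sup>2)"
      by (intro mult_right_mono y(2) x' sum_nonneg) auto
    also have "\<dots> \<le> Re (\<Sum>\<mu>\<in>UNIV. \<Sum>\<nu>\<in>UNIV. a \<mu> \<nu> x * cnj (\<xi> $ \<mu>) * \<xi> $ \<nu>)" using ellip x'(2) by blast
    finally show "ell y * (\<Sum>\<mu>\<in>UNIV. (cmod (\<xi> $ \<mu>))\<^sup>2) \<le> Re (\<Sum>\<mu>\<in>UNIV. \<Sum>\<nu>\<in>UNIV. a' \<mu> \<nu> x * cnj (\<xi> $ \<mu>) * \<xi> $ \<nu>)"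
      by (simp add: a'_def \<eta>(2)[OF x])
  qed (use tfa c in auto)
  have rc: "relcompact_open ?Om \<Omega>"
    using e closure_ball[OF e(1), of x0] by (simp add: relcompact_open_def)
  have hm: "set_borel_measurable lebesgue \<Omega> (h l n)" if "l \<le> k" for l n
    using h[OF that] by (simp add: L2loc_def)
  have "\<exists>g. l \<le> k \<longrightarrow> g \<in> borel_measurable borel \<and> (AE x in lborel. indicator \<Omega> x *\<^sub>R h l n x = g x)" for l n
    using borel_representative[OF hm[of l n]] by blast
  then obtain H0 where H0: "\<And>l n. l \<le> k \<Longrightarrow> H0 l n \<in> borel_measurable borel"
    "\<And>l n. l \<le> k \<Longrightarrow> AE x in lborel. indicator \<Omega> x *\<^sub>R h l n x = H0 l n x" by metis
  \<comment> \<open>At level 0 the prescribed \<open>w\<close> replaces the chosen representative,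
    so that the limit refers to \<open>w\<close> itself.\<close>
  define H where "H l n = (if l = 0 then w n else H0 l n)" for l n
  have H: "H l n \<in> borel_measurable borel" "AE x in lborel. indicator \<Omega> x *\<^sub>R h l n x = H l n x" if "l \<le> k" for l n
    using H0[OF that] w by (cases "l = 0"; simp add: H_def)+
  define U where "U l n x = of_real (indicator ?Om x) * H l n x" for l n x
  have U: "L2c (U l n)" "L2sq (U l n) = (LINT x:?Om|lebesgue. (norm (h l n x))\<^sup>2)" if "l \<le> k" for l n
  proof -
    have si: "set_integrable lebesgue ?Om (\<lambda>x. (norm (h l n x))\<^sup>2)" using h[OF that] rc by (simp add: L2loc_def)
    have sub: "?Om \<subseteq> \<Omega>" using e(3) by auto
    show "L2c (U l n)" "L2sq (U l n) = (LINT x:?Om|lebesgue. (norm (h l n x))\<^sup>2)"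
      unfolding U_def[abs_def]
      using representative_L2c[OF H[OF that] sub _ bounded_ball si] by auto
  qed
  have "\<exists>B. l \<le> k \<longrightarrow> (\<forall>n. (LINT x:?Om|lebesgue. (norm (h l n x))\<^sup>2) \<le> B)" for l
    using bd[OF _ rc] by blast
  then obtain B where B: "\<And>l n. l \<le> k \<Longrightarrow> (LINT x:?Om|lebesgue. (norm (h l n x))\<^sup>2) \<le> B l" by metis
  have weak': "(\<integral>x. U (Suc l) n x * (\<beta> x * \<phi> x) \<partial>lborel) = (\<integral>x. U l n x * At \<phi> x \<partial>lborel)"
    if l: "l < k" and \<phi>: "test_fun ?Om \<phi>" for l n \<phi>
  proof -
    \<comment> \<open>The factor \<open>b\<close> in the transpose cancels against
      \<open>\<beta>\<close>, leaving \<open>At \<phi>\<close>.\<close>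
    let ?\<Phi> = "\<lambda>x. \<beta> x * \<phi> x"
    have \<Phi>: "test_fun ?Om ?\<Phi>" by (rule test_fun_mult_right[OF \<phi> tf_smooth[OF \<beta>]])
    have out: "p x = 0" if "test_fun ?Om p" "x \<notin> ?Om" for p x
      using that closure_supportI[of p x] unfolding test_fun_def by blast
    have b\<Phi>: "(\<lambda>z. complex_of_real (b z) * ?\<Phi> z) = \<phi>"
    proof
      fix z show "complex_of_real (b z) * ?\<Phi> z = \<phi> z"
      proof (cases "z \<in> ?Om")
        case True
        then have "z \<in> cball x0 e" by simp
        then have "b z > 0" using e(3) b(2) by blast
        then show ?thesis using \<eta>(2)[OF True] by (simp add: \<beta>_def)
      qed (use out[OF \<phi>] in simp)
    qed
    have "(\<lambda>y. a \<mu> \<nu> y * partial \<mu> \<phi> y) = (\<lambda>y. a' \<mu> \<nu> y * partial \<mu> \<phi> y)" for \<mu> \<nu>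
    proof
      fix y show "a \<mu> \<nu> y * partial \<mu> \<phi> y = a' \<mu> \<nu> y * partial \<mu> \<phi> y"
        using \<eta>(2)[of y] out[OF test_fun_partial[OF \<phi>], of y \<mu>] by (cases "y \<in> ?Om") (auto simp: a'_def)
    qed
    then have Lt: "Lbar_transpose a b ?\<Phi> x = At \<phi> x" for x
      unfolding Lbar_transpose_def b\<Phi> At_def by simp
    have "(LINT x:\<Omega>|lebesgue. h (Suc l) n x * ?\<Phi> x) = (LINT x:\<Omega>|lebesgue. h l n x * At \<phi> x)"
      using weak[OF l, of n] test_fun_mono[OF \<Phi>, of \<Omega>] e(3) unfolding Lbar_weak_def Lt[symmetric] by force
    moreover have "(LINT x:\<Omega>|lebesgue. h (Suc l) n x * ?\<Phi> x) = (\<integral>x. U (Suc l) n x * ?\<Phi> x \<partial>lborel)"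
      unfolding U_def
      by (rule representative_integral[OF H hm]) (use l test_fun_tf[OF \<Phi>] out[OF \<Phi>] in auto)
    moreover have "(LINT x:\<Omega>|lebesgue. h l n x * At \<phi> x) = (\<integral>x. U l n x * At \<phi> x \<partial>lborel)"
      unfolding U_def
      by (rule representative_integral[OF H hm])
         (use l test_fun_tf[OF test_fun_At[OF \<phi>]] out[OF test_fun_At[OF \<phi>]] in auto)
    ultimately show ?thesis by simp
  qed
  \<comment> \<open>A second, smaller cutoff: support within 4e/5, hence inside the elliptic ball,
    and equal to 1 within e/5.\<close>
  have "e / 5 > 0" using e(1) by simp
  then obtain \<psi> where \<psi>: "test_fun (ball x0 (4 * (e / 5))) \<psi>" "\<And>x. x \<in> ball x0 (e / 5) \<Longrightarrow> \<psi> x = 1"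
    using cutoff_exists by metis
  have \<psi>Om: "test_fun ?Om \<psi>" by (rule test_fun_mono[OF \<psi>(1)]) (use e(1) in auto)
  have UB: "L2sq (U l n) \<le> B l" if "l \<le> k" for l n using U(2)[OF that] B[OF that] by simp
  have "\<exists>D. \<forall>n. \<exists>V. CBon m UNIV D V \<and> (\<forall>x. (\<lambda>j. conv (moll (1 / real (Suc j))) (\<lambda>x. \<psi> x * U 0 n x) x) \<longlonglongrightarrow> V x)
     \<and> (AE x in lborel. V x = \<psi> x * U 0 n x)"
    by (rule interior_limit[where U=U and B=B and \<beta>=\<beta> and k=k and m=m and \<psi>=\<psi>])
       (rule \<beta> U(1) UB weak' k \<psi>Om | assumption)+
  then obtain D where D: "\<forall>n. \<exists>V. CBon m UNIV D V \<and> (\<forall>x. (\<lambda>j. conv (moll (1 / real (Suc j))) (\<lambda>x. \<psi> x * U 0 n x) x) \<longlonglongrightarrow> V x)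
     \<and> (AE x in lborel. V x = \<psi> x * U 0 n x)"
    by (rule exE)
  \<comment> \<open>Mollification at a scale below \<open>r\<close> at a point within
    \<open>r\<close> of the centre only sees points within \<open>2 * r = e / 5\<close>, where
    \<open>\<psi>\<close> is 1; so eventually the cut-off and the uncut mollifications
    coincide.\<close>
  define r where "r = e / 10"
  have r: "r > 0" "ball x0 r \<subseteq> \<Omega>" "ball x0 (2 * r) \<subseteq> ball x0 (e / 5)" "ball x0 (2 * r) \<subseteq> ?Om"
    using e by (auto simp: r_def)
  have near: "\<psi> y * U 0 n y = w n y" if "y \<in> ball x0 (2 * r)" for y n
  proof -
    have "\<psi> y = 1" "y \<in> ?Om" using \<psi>(2) r(3,4) that by blast+
    then show ?thesis by (simp add: U_def H_def)
  qed
  show ?thesis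
  proof (rule exI[of _ r], rule exI[of _ D], intro conjI allI r(1,2))
    fix n
    obtain V where V: "CBon m UNIV D V" "\<And>x. (\<lambda>j. conv (moll (1 / real (Suc j))) (\<lambda>x. \<psi> x * U 0 n x) x) \<longlonglongrightarrow> V x"
      "AE x in lborel. V x = \<psi> x * U 0 n x" using D[rule_format, of n] by blast
    have lim: "(\<lambda>j. conv (moll (1 / real (Suc j))) (w n) x) \<longlonglongrightarrow> V x" if x: "x \<in> ball x0 r" for x
    proof (rule Lim_transform_eventually[OF V(2)])
      obtain N where N: "1 / real (Suc N) < r" using nat_approx_posE[OF r(1)] by metis
      show "\<forall>\<^sub>F j in sequentially. conv (moll (1 / real (Suc j))) (\<lambda>x. \<psi> x * U 0 n x) x = conv (moll (1 / real (Suc j))) (w n) x"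
        using eventually_ge_at_top[of N]
      proof eventually_elim
        case (elim j)
        let ?e = "1 / real (Suc j)"
        have "?e \<le> 1 / real (Suc N)" using elim by (intro divide_left_mono) auto
        then have ee: "?e > 0" "?e < r" using N by auto
        have "moll ?e (x - y) * (\<psi> y * U 0 n y) = moll ?e (x - y) * w n y" for y
        proof (cases "moll ?e (x - y) = 0")
          case False
          then have "dist x y < r" using moll_support[OF ee(1)] ee(2) by (force simp: dist_norm)
          then have "y \<in> ball x0 (2 * r)" using x dist_triangle[of x0 y x] by simp
          then show ?thesis by (simp add: near)
        qed simp
        then show ?case unfolding conv_def by (simp only:)
      qed
    qed
    have "AE x in lborel. x \<in> ball x0 r \<longrightarrow> V x = h 0 n x"
      using V(3) w(2)[of n]
    proof eventually_elim
      case (elim x)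
      show ?case
      proof
        assume x: "x \<in> ball x0 r"
        then have "x \<in> ball x0 (2 * r)" "x \<in> \<Omega>" using r(1,2) by auto
        then show "V x = h 0 n x" using elim near[of x n] by simp
      qed
    qed
    then show "\<exists>V. CBon m (ball x0 r) D V \<and> (\<forall>x\<in>ball x0 r. (\<lambda>j. conv (moll (1 / real (Suc j))) (w n) x) \<longlonglongrightarrow> V x)
      \<and> (AE x in lborel. x \<in> ball x0 r \<longrightarrow> V x = h 0 n x)"
      using CBon_subset[OF V(1)] lim by blast
  qed
qed

subsection \<open>Local square integrability\<close>

lemma indicator_norm_sq: "indicator A x *\<^sub>R (norm y)\<^sup>2 = (norm (indicator A x *\<^sub>R (y :: complex)))\<^sup>2"
  by (simp add: indicator_def)

lemma L2loc_restrict: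
  assumes f: "L2loc \<Omega> f" and A: "relcompact_open A \<Omega>"
  shows "(\<lambda>x. indicator A x *\<^sub>R f x) \<in> borel_measurable lebesgue"
    "integrable lebesgue (\<lambda>x. (norm (indicator A x *\<^sub>R f x))\<^sup>2)"
proof -
  have "A \<subseteq> \<Omega>" using A closure_subset unfolding relcompact_open_def by blast
  then have eq: "(\<lambda>x. indicator A x *\<^sub>R (indicator \<Omega> x *\<^sub>R f x)) = (\<lambda>x. indicator A x *\<^sub>R f x)"
    by (auto simp: indicator_def fun_eq_iff)
  have "A \<in> sets lebesgue" using A by (simp add: relcompact_open_def borel_open)
  moreover have "(\<lambda>x. indicator \<Omega> x *\<^sub>R f x) \<in> borel_measurable lebesgue"
    using f unfolding L2loc_def set_borel_measurable_def by blast
  ultimately have "(\<lambda>x. indicator A x *\<^sub>R (indicator \<Omega> x *\<^sub>R f x)) \<in> borel_measurable lebesgue"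
    by (rule borel_measurable_scaleR[OF borel_measurable_indicator])
  then show "(\<lambda>x. indicator A x *\<^sub>R f x) \<in> borel_measurable lebesgue" by (simp only: eq)
  show "integrable lebesgue (\<lambda>x. (norm (indicator A x *\<^sub>R f x))\<^sup>2)"
    using f A unfolding L2loc_def set_integrable_def indicator_norm_sq by blast
qed

lemma L2loc_cmult:
  assumes "L2loc \<Omega> f" shows "L2loc \<Omega> (\<lambda>x. c * f x)"
  unfolding L2loc_def
proof (intro conjI allI impI)
  have "(\<lambda>x. c * (indicator \<Omega> x *\<^sub>R f x)) \<in> borel_measurable lebesgue"
    using assms unfolding L2loc_def set_borel_measurable_def by (intro borel_measurable_times) auto
  then show "set_borel_measurable lebesgue \<Omega> (\<lambda>x. c * f x)" by (simp add: set_borel_measurable_def)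
  fix A assume A: "relcompact_open A \<Omega>"
  have "integrable lebesgue (\<lambda>x. (norm c)\<^sup>2 * (norm (indicator A x *\<^sub>R f x))\<^sup>2)"
    using L2loc_restrict(2)[OF assms A] by simp
  also have "(\<lambda>x. (norm c)\<^sup>2 * (norm (indicator A x *\<^sub>R f x))\<^sup>2) = (\<lambda>x. indicator A x *\<^sub>R (norm (c * f x))\<^sup>2)"
    by (rule ext) (simp add: indicator_def norm_mult power_mult_distrib)
  finally show "set_integrable lebesgue A (\<lambda>x. (norm (c * f x))\<^sup>2)"
    unfolding set_integrable_def .
qed

lemma integrable_norm_add_sq:
  fixes f g :: "'a \<Rightarrow> complex"
  assumes "f \<in> borel_measurable M" "g \<in> borel_measurable M"
    and "integrable M (\<lambda>x. (norm (f x))\<^sup>2)" "integrable M (\<lambda>x. (norm (g x))\<^sup>2)"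
  shows "integrable M (\<lambda>x. (norm (f x + g x))\<^sup>2)"
    "(\<integral>x. (norm (f x + g x))\<^sup>2 \<partial>M) \<le> 2 * (\<integral>x. (norm (f x))\<^sup>2 \<partial>M) + 2 * (\<integral>x. (norm (g x))\<^sup>2 \<partial>M)"
proof -
  have i: "integrable M (\<lambda>x. 2 * (norm (f x))\<^sup>2 + 2 * (norm (g x))\<^sup>2)"
    by (intro Bochner_Integration.integrable_add integrable_mult_right assms)
  show i2: "integrable M (\<lambda>x. (norm (f x + g x))\<^sup>2)"
    by (rule Bochner_Integration.integrable_bound[OF i]) (use assms norm_add_sq_le in auto)
  have "(\<integral>x. (norm (f x + g x))\<^sup>2 \<partial>M) \<le> (\<integral>x. 2 * (norm (f x))\<^sup>2 + 2 * (norm (g x))\<^sup>2 \<partial>M)"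
    by (intro integral_mono i i2 norm_add_sq_le)
  also have "\<dots> = 2 * (\<integral>x. (norm (f x))\<^sup>2 \<partial>M) + 2 * (\<integral>x. (norm (g x))\<^sup>2 \<partial>M)"
    using assms(3,4) by simp
  finally show "(\<integral>x. (norm (f x + g x))\<^sup>2 \<partial>M) \<le> 2 * (\<integral>x. (norm (f x))\<^sup>2 \<partial>M) + 2 * (\<integral>x. (norm (g x))\<^sup>2 \<partial>M)" .
qed

lemma L2loc_add:
  assumes f: "L2loc \<Omega> f" and g: "L2loc \<Omega> g" shows "L2loc \<Omega> (\<lambda>x. f x + g x)"
  unfolding L2loc_def
proof (intro conjI allI impI)
  have "(\<lambda>x. indicator \<Omega> x *\<^sub>R f x + indicator \<Omega> x *\<^sub>R g x) \<in> borel_measurable lebesgue"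
    using f g unfolding L2loc_def set_borel_measurable_def by (intro borel_measurable_add) auto
  then show "set_borel_measurable lebesgue \<Omega> (\<lambda>x. f x + g x)" by (simp add: set_borel_measurable_def scaleR_add_right)
  fix A assume A: "relcompact_open A \<Omega>"
  show "set_integrable lebesgue A (\<lambda>x. (norm (f x + g x))\<^sup>2)"
    using integrable_norm_add_sq(1)[OF L2loc_restrict(1)[OF f A] L2loc_restrict(1)[OF g A]
        L2loc_restrict(2)[OF f A] L2loc_restrict(2)[OF g A]]
    unfolding set_integrable_def indicator_norm_sq scaleR_add_right .
qed

lemma L2loc_diff: "L2loc \<Omega> f \<Longrightarrow> L2loc \<Omega> g \<Longrightarrow> L2loc \<Omega> (\<lambda>x. f x - g x)"
  using L2loc_add[of \<Omega> f "\<lambda>x. -1 * g x"] L2loc_cmult[of \<Omega> g "-1"] by simp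

lemma L2loc_sum: "(\<And>j. j < N \<Longrightarrow> L2loc \<Omega> (f j)) \<Longrightarrow> L2loc \<Omega> (\<lambda>x. \<Sum>j<(N::nat). f j x)"
proof (induction N)
  case 0
  then show ?case by (simp add: L2loc_def set_borel_measurable_def set_integrable_def)
next
  case (Suc N)
  then show ?case by (simp add: L2loc_add)
qed

lemma L2dist_eq: "L2dist A f g = (\<integral>x. (norm (indicator A x *\<^sub>R (f x - g x)))\<^sup>2 \<partial>lebesgue)"
  unfolding L2dist_def set_lebesgue_integral_def indicator_norm_sq ..

text \<open>A term is the difference of consecutive partial sums, both at bounded distance from
  \<open>G\<close>. This is where convergence of the series yields uniformity over the
  family.\<close>

lemma series_terms_bounded:
  assumes f: "\<And>j. L2loc \<Omega> (f j)" and G: "L2loc \<Omega> G"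
    and lim: "L2loc_lim \<Omega> (\<lambda>N x. \<Sum>j<N. f j x) G" and A: "relcompact_open A \<Omega>"
  shows "\<exists>B. \<forall>n. (LINT x:A|lebesgue. (norm (f n x))\<^sup>2) \<le> B"
proof -
  let ?S = "\<lambda>N x. \<Sum>j<N. f j x" and ?d = "\<lambda>N. L2dist A (\<lambda>x. \<Sum>j<N. f j x) G"
  have "?d \<longlonglongrightarrow> 0" using lim A by (simp add: L2loc_lim_def)
  then have "Bseq ?d" by (intro convergent_imp_Bseq convergentI)
  then obtain K where K: "\<And>N. norm (?d N) \<le> K" unfolding Bseq_def by blast
  have dK: "?d N \<le> K" for N using K[of N] by simp
  have D: "L2loc \<Omega> (\<lambda>x. ?S N x - G x)" "L2loc \<Omega> (\<lambda>x. G x - ?S N x)" for N by (intro L2loc_diff L2loc_sum f G)+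
  have "(LINT x:A|lebesgue. (norm (f n x))\<^sup>2) \<le> 4 * K" for n
  proof -
    note r1 = L2loc_restrict[OF D(1)[of "Suc n"] A] and r2 = L2loc_restrict[OF D(2)[of n] A]
    have "(\<integral>x. (norm (indicator A x *\<^sub>R (?S (Suc n) x - G x) + indicator A x *\<^sub>R (G x - ?S n x)))\<^sup>2 \<partial>lebesgue)
       \<le> 2 * (\<integral>x. (norm (indicator A x *\<^sub>R (?S (Suc n) x - G x)))\<^sup>2 \<partial>lebesgue) + 2 * (\<integral>x. (norm (indicator A x *\<^sub>R (G x - ?S n x)))\<^sup>2 \<partial>lebesgue)"
      by (rule integrable_norm_add_sq(2)[OF r1(1) r2(1) r1(2) r2(2)])
    also have "(\<integral>x. (norm (indicator A x *\<^sub>R (G x - ?S n x)))\<^sup>2 \<partial>lebesgue) = ?d n"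
      unfolding L2dist_eq by (simp add: norm_minus_commute)
    also have "(\<integral>x. (norm (indicator A x *\<^sub>R (?S (Suc n) x - G x)))\<^sup>2 \<partial>lebesgue) = ?d (Suc n)"
      unfolding L2dist_eq ..
    also have "(\<lambda>x. indicator A x *\<^sub>R (?S (Suc n) x - G x) + indicator A x *\<^sub>R (G x - ?S n x)) = (\<lambda>x. indicator A x *\<^sub>R f n x)"
      by (simp add: scaleR_add_right[symmetric] del: scaleR_add_right)
    finally have "(LINT x:A|lebesgue. (norm (f n x))\<^sup>2) \<le> 2 * ?d (Suc n) + 2 * ?d n"
      unfolding set_lebesgue_integral_def indicator_norm_sq .
    then show ?thesis using dK[of n] dK[of "Suc n"] by linarith
  qed
  then show ?thesis by blast
qed

lemma L2_limit_AE:
  assumes f: "\<And>j. L2loc \<Omega> (f j)" and G: "L2loc \<Omega> G"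
    and lim: "L2loc_lim \<Omega> (\<lambda>N x. \<Sum>j<N. f j x) G" and A: "relcompact_open A \<Omega>"
    and pt: "AE x in lebesgue. x \<in> A \<longrightarrow> (\<lambda>N. \<Sum>j<N. f j x) \<longlonglongrightarrow> V x"
  shows "AE x in lebesgue. x \<in> A \<longrightarrow> V x = G x"
proof -
  let ?S = "\<lambda>N x. \<Sum>j<N. f j x"
  have D: "L2loc \<Omega> (\<lambda>x. ?S N x - G x)" for N by (intro L2loc_diff L2loc_sum f G)
  have "AE x in lebesgue. (norm (indicator A x *\<^sub>R (V x - G x)))\<^sup>2 \<le> 0"
  proof (rule AE_nonpos_limit[where h="\<lambda>N x. (norm (indicator A x *\<^sub>R (?S N x - G x)))\<^sup>2"])
    show "integrable lebesgue (\<lambda>x. (norm (indicator A x *\<^sub>R (?S N x - G x)))\<^sup>2)" for N by (rule L2loc_restrict(2)[OF D A])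
    show "(\<lambda>N. \<integral>x. (norm (indicator A x *\<^sub>R (?S N x - G x)))\<^sup>2 \<partial>lebesgue) \<longlonglongrightarrow> 0"
      using lim A unfolding L2loc_lim_def L2dist_eq by blast
    show "AE x in lebesgue. (\<lambda>N. (norm (indicator A x *\<^sub>R (?S N x - G x)))\<^sup>2) \<longlonglongrightarrow> (norm (indicator A x *\<^sub>R (V x - G x)))\<^sup>2"
      using pt
    proof eventually_elim
      case (elim x)
      show ?case
      proof (cases "x \<in> A")
        case True
        then show ?thesis using elim by (intro tendsto_intros) simp
      qed simp
    qed
  qed simp
  then show ?thesis by eventually_elim (auto simp: indicator_def)
qed

lemma Lbar_weak_cmult:
  assumes "Lbar_weak \<Omega> a b u g" shows "Lbar_weak \<Omega> a b (\<lambda>x. c * u x) (\<lambda>x. c * g x)"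
  unfolding Lbar_weak_def
proof (intro allI impI)
  fix \<phi> assume "test_fun \<Omega> \<phi>"
  then have "(LINT x:\<Omega>|lebesgue. g x * \<phi> x) = (LINT x:\<Omega>|lebesgue. u x * Lbar_transpose a b \<phi> x)"
    using assms by (simp add: Lbar_weak_def)
  then have "c * (LINT x:\<Omega>|lebesgue. g x * \<phi> x) = c * (LINT x:\<Omega>|lebesgue. u x * Lbar_transpose a b \<phi> x)" by simp
  then show "(LINT x:\<Omega>|lebesgue. c * g x * \<phi> x) = (LINT x:\<Omega>|lebesgue. c * u x * Lbar_transpose a b \<phi> x)"
    by (simp only: mult.assoc set_integral_mult_right)
qed

lemma conv_cmult: "conv k (\<lambda>x. c * w x) x = c * conv k w x"
  unfolding conv_def by (simp only: mult.left_commute[of _ c] integral_mult_right_zero)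

section \<open>Assembling the smooth representative of the series\<close>

theorem theoremB2:
  fixes \<Omega> :: "(real^'n::finite) set"
    and a :: "'n \<Rightarrow> 'n \<Rightarrow> real^'n \<Rightarrow> complex"
    and b :: "real^'n \<Rightarrow> real"
    and ell :: "real^'n \<Rightarrow> real"
    and f :: "nat \<Rightarrow> real^'n \<Rightarrow> complex"
    and fL :: "nat \<Rightarrow> nat \<Rightarrow> real^'n \<Rightarrow> complex"
    and F :: "complex \<Rightarrow> real^'n \<Rightarrow> complex"
    and FL :: "nat \<Rightarrow> complex \<Rightarrow> real^'n \<Rightarrow> complex"
    and S :: real and k m :: nat
  assumes "open \<Omega>" and "connected \<Omega>"
    and "smooth_on \<Omega> b" and "\<forall>x\<in>\<Omega>. b x > 0"
    and "\<forall>\<mu> \<nu>. smooth_on \<Omega> (a \<mu> \<nu>)"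
    and "\<forall>\<mu> \<nu>. \<forall>x\<in>\<Omega>. a \<mu> \<nu> x = a \<nu> \<mu> x"
    and "continuous_on \<Omega> ell" and "\<forall>x\<in>\<Omega>. ell x > 0"
    and "\<forall>x\<in>\<Omega>. \<forall>\<xi>::complex^'n.
           Re (\<Sum>\<mu>\<in>UNIV. \<Sum>\<nu>\<in>UNIV. a \<mu> \<nu> x * cnj (\<xi> $ \<mu>) * \<xi> $ \<nu>)
             \<ge> ell x * (\<Sum>\<mu>\<in>UNIV. (cmod (\<xi> $ \<mu>))\<^sup>2)"
    and "k \<ge> 1"
    \<comment> \<open>fL j l is (a representative of) Lbar^l f_j\<close>
    and "\<forall>j. fL j 0 = f j"
    and "\<forall>j. \<forall>l\<le>k. L2loc \<Omega> (fL j l)"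
    and "\<forall>j. \<forall>l<k. Lbar_weak \<Omega> a b (fL j l) (fL j (Suc l))"
    \<comment> \<open>F analytic from B_S(0) into L^2_loc\<close>
    and "\<forall>z\<in>ball 0 S. L2loc \<Omega> (F z)"
    and "analytic_L2loc \<Omega> (ball 0 S) F"
    \<comment> \<open>(i)\<close>
    and "\<forall>z\<in>ball 0 S. L2loc_lim \<Omega> (\<lambda>N x. \<Sum>j<N. z ^ j / of_nat (fact j) * f j x) (F z)"
    \<comment> \<open>(ii): FL l z is (a representative of) Lbar^l F(z)\<close>
    and "\<forall>z\<in>ball 0 S. FL 0 z = F z"
    and "\<forall>z\<in>ball 0 S. \<forall>l\<le>k. L2loc \<Omega> (FL l z)"
    and "\<forall>z\<in>ball 0 S. \<forall>l<k. Lbar_weak \<Omega> a b (FL l z) (FL (Suc l) z)"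
    \<comment> \<open>(iii)\<close>
    and "\<forall>z\<in>ball 0 S. \<forall>l\<in>{1..k}.
           L2loc_lim \<Omega> (\<lambda>N x. \<Sum>j<N. z ^ j / of_nat (fact j) * fL j l x) (FL l z)"
    and "real k > real m / 2 + real CARD('n) / 4"
  shows "\<exists>Fr :: complex \<Rightarrow> real^'n \<Rightarrow> complex.
           (\<forall>z\<in>ball 0 S. AE x in lebesgue. x \<in> \<Omega> \<longrightarrow> Fr z x = F z x)
         \<and> (\<forall>z\<in>ball 0 S. Ck m \<Omega> (Fr z))
         \<and> Ck m (ball 0 S \<times> \<Omega>) (\<lambda>(z, x). Fr z x)"
proof -
  note \<Omega> = assms(1) and fL0 = assms(11) and fL2 = assms(12) and fLw = assms(13)
    and F2 = assms(14) and lim0 = assms(16) and FL0 = assms(17) and FL2 = assms(18) and limL = assms(20)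
  have f2: "L2loc \<Omega> (f j)" for j using fL2 fL0 by (metis le0)
  have "\<exists>g. g \<in> borel_measurable borel \<and> (AE x in lborel. indicator \<Omega> x *\<^sub>R f j x = g x)" for j
    using borel_representative[of \<Omega> "f j"] f2[of j] unfolding L2loc_def by blast
  then obtain w where w: "\<And>j. w j \<in> borel_measurable borel" "\<And>j. AE x in lborel. indicator \<Omega> x *\<^sub>R f j x = w j x"
    by metis
  \<comment> \<open>A representative of \<open>f j\<close> defined without reference to a ball or a
    radius \<open>\<rho>\<close>; where the mollifications diverge the value of \<open>lim\<close>
    is arbitrary, but \<open>loc\<close> shows that they converge on
    \<open>\<Omega>\<close>.\<close>
  define V where "V j x = lim (\<lambda>i. conv (moll (1 / real (Suc i))) (w j) x)" for j x
  define g where "g j x = V j x / of_nat (fact j)" for j x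
  \<comment> \<open>Hypothesis (i) supplies the case \<open>l = 0\<close> of (iii).\<close>
  have limz: "L2loc_lim \<Omega> (\<lambda>N x. \<Sum>j<N. z ^ j / of_nat (fact j) * fL j l x) (FL l z)"
    if "z \<in> ball 0 S" "l \<le> k" for z l
    using lim0 limL FL0 fL0 that by (cases "l = 0") auto
  have loc: "\<exists>r D. r > 0 \<and> ball x0 r \<subseteq> \<Omega> \<and> (\<forall>j. CBon m (ball x0 r) D (\<lambda>x. of_real (\<rho> ^ j) * g j x)
      \<and> (AE x in lborel. x \<in> ball x0 r \<longrightarrow> V j x = f j x))"
    if \<rho>: "0 < \<rho>" "\<rho> < S" and x0: "x0 \<in> \<Omega>" for \<rho> x0
  proof -
    \<comment> \<open>The family is scaled to the terms of the series at the point
      \<open>\<rho>\<close> itself, so its uniform bounds come from convergence there.\<close>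
    define c where "c j = complex_of_real \<rho> ^ j / of_nat (fact j)" for j
    have c0: "c j \<noteq> 0" for j using \<rho> by (simp add: c_def)
    have \<rho>S: "complex_of_real \<rho> \<in> ball 0 S" using \<rho> by simp
    define h where "h l j x = c j * fL j l x" for l j x
    have h2: "L2loc \<Omega> (h l j)" if "l \<le> k" for l j
      unfolding h_def[abs_def] by (rule L2loc_cmult) (use fL2 that in blast)
    have "\<exists>r D. r > 0 \<and> ball x0 r \<subseteq> \<Omega> \<and> (\<forall>j. \<exists>W. CBon m (ball x0 r) D W
      \<and> (\<forall>x\<in>ball x0 r. (\<lambda>i. conv (moll (1 / real (Suc i))) (\<lambda>x. c j * w j x) x) \<longlonglongrightarrow> W x)
      \<and> (AE x in lborel. x \<in> ball x0 r \<longrightarrow> W x = h 0 j x))"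
    proof (rule local_regularity[OF \<Omega> assms(3,4,5,7,8,9,21)])
      show "L2loc \<Omega> (h l j)" if "l \<le> k" for l j by (rule h2[OF that])
      show "\<exists>B. \<forall>j. (LINT x:A|lebesgue. (norm (h l j x))\<^sup>2) \<le> B" if l: "l \<le> k" and A: "relcompact_open A \<Omega>" for l A
      proof (rule series_terms_bounded[OF h2[OF l] _ _ A])
        show "L2loc \<Omega> (FL l (complex_of_real \<rho>))" using FL2 \<rho>S l by blast
        show "L2loc_lim \<Omega> (\<lambda>N x. \<Sum>j<N. h l j x) (FL l (complex_of_real \<rho>))"
          using limz[OF \<rho>S l] by (simp add: h_def c_def)
      qed
      show "Lbar_weak \<Omega> a b (h l j) (h (Suc l) j)" if "l < k" for l j
        unfolding h_def[abs_def] by (rule Lbar_weak_cmult) (use fLw that in blast)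
      show "(\<lambda>x. c j * w j x) \<in> borel_measurable borel" for j using w(1)[of j] by measurable
      show "AE x in lborel. indicator \<Omega> x *\<^sub>R h 0 j x = c j * w j x" for j
        using w(2)[of j] by eventually_elim (simp add: h_def fL0 mult_scaleR_right[symmetric] del: mult_scaleR_right)
    qed (rule x0)
    then obtain r D where r: "r > 0" "ball x0 r \<subseteq> \<Omega>" and W: "\<forall>j. \<exists>W. CBon m (ball x0 r) D W
      \<and> (\<forall>x\<in>ball x0 r. (\<lambda>i. conv (moll (1 / real (Suc i))) (\<lambda>x. c j * w j x) x) \<longlonglongrightarrow> W x)
      \<and> (AE x in lborel. x \<in> ball x0 r \<longrightarrow> W x = h 0 j x)"
      by (elim exE conjE)
    have "CBon m (ball x0 r) D (\<lambda>x. of_real (\<rho> ^ j) * g j x) \<and> (AE x in lborel. x \<in> ball x0 r \<longrightarrow> V j x = f j x)" for j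
    proof -
      obtain W' where W': "CBon m (ball x0 r) D W'"
        "\<And>x. x \<in> ball x0 r \<Longrightarrow> (\<lambda>i. conv (moll (1 / real (Suc i))) (\<lambda>x. c j * w j x) x) \<longlonglongrightarrow> W' x"
        "AE x in lborel. x \<in> ball x0 r \<longrightarrow> W' x = h 0 j x"
        using W[rule_format, of j] by blast
      \<comment> \<open>Mollification is linear, so the limit for the scaled term is the scaled
        \<open>V j\<close>; dividing by the nonzero \<open>c j\<close> gives convergence for
        \<open>w j\<close> as well.\<close>
      have WV: "W' x = c j * V j x" if x: "x \<in> ball x0 r" for x
      proof -
        have "(\<lambda>i. inverse (c j) * (c j * conv (moll (1 / real (Suc i))) (w j) x)) \<longlonglongrightarrow> inverse (c j) * W' x"
          using W'(2)[OF x] unfolding conv_cmult by (rule tendsto_mult_left)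
        then have "(\<lambda>i. conv (moll (1 / real (Suc i))) (w j) x) \<longlonglongrightarrow> inverse (c j) * W' x"
          using c0[of j] by (simp add: mult.assoc[symmetric])
        then have "V j x = inverse (c j) * W' x" unfolding V_def by (rule limI)
        then show ?thesis using c0[of j] by simp
      qed
      have "CBon m (ball x0 r) D (\<lambda>x. of_real (\<rho> ^ j) * g j x)"
        by (rule CBon_cong[OF open_ball _ W'(1)]) (simp add: WV c_def g_def)
      moreover have "AE x in lborel. x \<in> ball x0 r \<longrightarrow> V j x = f j x"
        using W'(3)
      proof eventually_elim
        case (elim x)
        then show ?case using WV[of x] c0[of j] by (auto simp: h_def fL0)
      qed
      ultimately show ?thesis by blast
    qed
    then show ?thesis using r by blast
  qed
  have sb: "series_bounded S \<Omega> m g"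
    unfolding series_bounded_def using loc by meson
  have C: "Ck m (ball 0 S \<times> \<Omega>) (pow_sum g)" by (rule pow_sum_Ck[OF \<Omega> sb])
  define Fr where "Fr z x = pow_sum g (z, x)" for z x
  have ae: "AE x in lebesgue. x \<in> \<Omega> \<longrightarrow> Fr z x = F z x" if z: "z \<in> ball 0 S" for z
  proof -
    have zS: "norm z < S" using z by simp
    then have S0: "0 < S" using norm_ge_zero[of z] by linarith
    have local: "\<exists>r>0. AE x in lebesgue. x \<in> ball x0 r \<longrightarrow> Fr z x = F z x" if x0: "x0 \<in> \<Omega>" for x0
    proof -
      obtain r D where r: "r > 0" "ball x0 r \<subseteq> \<Omega>" "\<And>j. AE x in lborel. x \<in> ball x0 r \<longrightarrow> V j x = f j x"
        \<comment> \<open>Only the ball and the almost everywhere identity are taken from this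
          instance, so a fixed radius below \<open>S\<close> serves for all
          \<open>z\<close>.\<close>
        using loc[of "S / 2" x0] S0 x0 by auto
      define r' where "r' = r / 2"
      have r': "r' > 0" "cball x0 r' \<subseteq> ball x0 r" using r(1) by (auto simp: r'_def)
      have rc: "relcompact_open (ball x0 r') \<Omega>"
        using r' r(2) closure_ball[OF r'(1), of x0] by (auto simp: relcompact_open_def)
      have "AE x in lebesgue. \<forall>j. x \<in> ball x0 r \<longrightarrow> V j x = f j x"
        unfolding AE_all_countable using AE_completion[OF r(3)] by blast
      then have pt: "AE x in lebesgue. x \<in> ball x0 r' \<longrightarrow> (\<lambda>N. \<Sum>j<N. z ^ j / of_nat (fact j) * f j x) \<longlonglongrightarrow> Fr z x"
      proof eventually_elim
        case (elim x)
        show ?case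
        proof
          assume "x \<in> ball x0 r'"
          then have "x \<in> cball x0 r'" by simp
          then have x: "x \<in> ball x0 r" "x \<in> \<Omega>" using r'(2) r(2) by blast+
          obtain \<rho> r1 q D1 where m: "norm z < \<rho>" "r1 > 0" "0 < q" "q < 1" "D1 \<ge> 0"
            "\<And>j z' y. norm z' < \<rho> \<Longrightarrow> y \<in> ball x r1 \<Longrightarrow> norm (z' ^ j * g j y) \<le> D1 * q ^ j"
            using series_majorant[OF sb zS x(2)] by metis
          have "summable (\<lambda>j. z ^ j * g j x)"
          proof (rule summable_comparison_test')
            show "summable (\<lambda>j. D1 * q ^ j)" using m(3,4) by (intro summable_mult summable_geometric) simp
            show "norm (z ^ j * g j x) \<le> D1 * q ^ j" for j by (rule m(6)) (use m in auto)
          qed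
          then have "(\<lambda>j. z ^ j * g j x) sums Fr z x" by (simp add: Fr_def pow_sum_def summable_sums)
          moreover have "z ^ j * g j x = z ^ j / of_nat (fact j) * f j x" for j
            using elim x(1) by (simp add: g_def)
          ultimately show "(\<lambda>N. \<Sum>j<N. z ^ j / of_nat (fact j) * f j x) \<longlonglongrightarrow> Fr z x"
            by (simp add: sums_def)
        qed
      qed
      have "AE x in lebesgue. x \<in> ball x0 r' \<longrightarrow> Fr z x = F z x"
        by (rule L2_limit_AE[OF L2loc_cmult[OF f2] _ _ rc pt]) (use F2 lim0 z in auto)
      then show ?thesis using r'(1) by blast
    qed
    then obtain R where R: "\<And>x0. x0 \<in> \<Omega> \<Longrightarrow> R x0 > 0"
      "\<And>x0. x0 \<in> \<Omega> \<Longrightarrow> AE x in lebesgue. x \<in> ball x0 (R x0) \<longrightarrow> Fr z x = F z x" by metis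
    let ?C = "(\<lambda>x0. ball x0 (R x0)) ` \<Omega>"
    \<comment> \<open>Each centre has its own null set; a countable subcover keeps their union
      null.\<close>
    obtain C' where C': "C' \<subseteq> ?C" "countable C'" "\<Union>C' = \<Union>?C"
      using Lindelof[of ?C] by blast
    have "AE x in lebesgue. \<forall>B\<in>C'. x \<in> B \<longrightarrow> Fr z x = F z x"
      using C'(1,2) R(2) by (subst AE_ball_countable) auto
    then show ?thesis
    proof eventually_elim
      case (elim x)
      show ?case
      proof
        assume "x \<in> \<Omega>"
        then have "x \<in> \<Union>?C" using R(1) by force
        then show "Fr z x = F z x" using elim C'(3) by auto
      qed
    qed
  qed
  have "Ck m \<Omega> (Fr z)" if "z \<in> ball 0 S" for z
    unfolding Fr_def[abs_def] by (rule Ck_slice[OF \<Omega> that C])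
  moreover have "(\<lambda>(z, x). Fr z x) = pow_sum g" by (auto simp: Fr_def)
  ultimately show ?thesis using ae C by (intro exI[of _ Fr]) auto
qed

end
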